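(* Let $N\ge 1$ and let $(a_n)_{n\ge 0}$ (positive) and $(b_n)_{n\ge 0}$ (real) be the Jacobi parameters of a Jacobi matrix $\mathcal{A}$. Suppose they are $N$-periodically modulated with respect to $N$-periodic sequences $(\alpha_n)_{n\ge0}$ (positive) and $(\beta_n)_{n\ge0}$ (real). Suppose that $\mathfrak{X}_N(0)=\varepsilon\operatorname{Id}$ for some $\varepsilon\in\{-1,1\}$ and that $$\Big(a_n\Big(\frac{a_{n-1}}{a_n}-\frac{\alpha_{n-1}}{\alpha_n}\Big)\Big),\quad \Big(a_n\Big(\frac{b_n}{a_n}-\frac{\beta_n}{\alpha_n}\Big)\Big),\quad\Big(\frac1{a_n}\Big)\in\mathcal{D}_1^N .$$ Then the limit $$h(z)=\lim_{j\to\infty}a_{jN+N-1}^2\operatorname{discr}X_{jN}(z),\qquad z\in\mathbb{C},$$ exists and defines a polynomial of degree $2$ with negative leading coefficient. Set $\Lambda=\{x\in\mathbb{R}:h(x)<0\}$ and $$\rho_n=\sum_{k=0}^n\frac{\alpha_k}{a_k}.$$ Then for every bounded continuous $f:\mathbb{R}\to\mathbb{C}$ satisfying $\sup_{x\in\mathbb{R}}(1+x^2)|f(x)|<\infty$ we have $$\lim_{n\to\infty}\frac1{\rho_n}\int_{\mathbb{R}}f\,d\nu_n=\int_{\mathbb{R}}f\,d\nu,$$ where the measure $\nu$ is purely absolutely continuous with the density $$\frac{d\nu}{dx}=\frac1{4\pi N\alpha_{N-1}}\frac{|h'(x)|}{\sqrt{-h(x)}}\,\mathbf{1}_\Lamb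da(x).$$
   Context: The Jacobi matrix $\mathcal{A}$ is the infinite symmetric tridiagonal matrix with diagonal $b_0,b_1,b_2,\dots$ and off-diagonal $a_0,a_1,a_2,\dots$; $\mathcal{A}_n$ is its upper-left $n\times n$ truncation, and $\nu_n=\sum_{y\in\sigma(\mathcal{A}_{n+1})}\delta_y$, where $\delta_y$ is the Dirac measure at $y$. $\mathbf{1}_\Lambda$ is the indicator function of $\Lambda$. The parameters are $N$-periodically modulated (with respect to the $N$-periodic sequences $\alpha_n>0$, $\beta_n\in\mathbb{R}$) if $$\lim_{n\to\infty}\Big|\frac{a_{n-1}}{a_n}-\frac{\alpha_{n-1}}{\alpha_n}\Big|=0,\quad \lim_{n\to\infty}\Big|\frac{b_n}{a_n}-\frac{\beta_n}{\alpha_n}\Big|=0,\quad \lim_{n\to\infty}a_n=\infty .$$ For $n\ge1$, $\mathfrak{X}_n(x)=\mathfrak{B}_{n+N-1}(x)\cdots\mathfrak{B}_n(x)$ with $\mathfrak{B}_j(x)=\begin{pmatrix}0&1\\-\frac{\alpha_{j-1}}{\alpha_j}&\frac{x-\beta_j}{\alpha_j}\end{pmatrix}$, and $X_n(x)=B_{n+N-1}(x)\cdots B_n(x)$ with $B_j(x)=\begin{pmatrix}0&1\\-\frac{a_{j-1}}{a_j}&\frac{x-b_j}{a_j}\end{pmatrix}$, $j\ge1$. For a $2\times2$ matrix $X$, $\operatorname{discr}X=(\operatorname{tr}X)^2-4\det X$. A sequence $(x_n)_{n\ge1}$ belongs to $\mathcal{D}_1^N$ if $\sum_{n=1}^\infty|x_{n+N}-x_n|<\infty$.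 *)

theory Defs
  imports
    "HOL-Analysis.Analysis"
    "HOL-Probability.Giry_Monad"
    "Jordan_Normal_Form.Spectral_Radius"
begin

hide_const (open) Matrix.mat Determinant.det

definition jacobi_matrix :: "(nat \<Rightarrow> real) \<Rightarrow> (nat \<Rightarrow> real) \<Rightarrow> nat \<Rightarrow> nat \<Rightarrow> real" where
  "jacobi_matrix a b i j =
     (if i = j then b i else if j = Suc i then a i else if i = Suc j then a j else 0)"

definition truncation :: "(nat \<Rightarrow> nat \<Rightarrow> real) \<Rightarrow> nat \<Rightarrow> real Matrix.mat" where
  "truncation A n = Matrix.mat n n (\<lambda>(i, j). A i j)"

text \<open>The spectrum is taken over the reals; since the truncations are real symmetric, this is
  their whole spectrum.\<close>

definition eigenvalue_measure :: "(nat \<Rightarrow> real) \<Rightarrow> (nat \<Rightarrow> real) \<Rightarrow> nat \<Rightarrow> real measure" where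
  "eigenvalue_measure a b n =
     measure_of UNIV (sets borel)
       (\<lambda>B. \<Sum>y\<in>spectrum (truncation (jacobi_matrix a b) (Suc n)). emeasure (return borel y) B)"

text \<open>The function passed to \<^const>\<open>measure_of\<close> above is a measure, so the definition does not
  degenerate to the null measure.\<close>

lemma space_eigenvalue_measure [simp]: "space (eigenvalue_measure a b n) = UNIV"
  and sets_eigenvalue_measure [simp, measurable_cong]: "sets (eigenvalue_measure a b n) = sets borel"
proof -
  have "sets borel \<subseteq> Pow (UNIV :: real set)" by simp
  then show "space (eigenvalue_measure a b n) = UNIV"
    "sets (eigenvalue_measure a b n) = sets borel"
    unfolding eigenvalue_measure_def
    by (simp_all add: space_measure_of_conv sets_measure_of_conv
        sets.sigma_sets_eq[of borel, unfolded space_borel])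
qed

lemma emeasure_eigenvalue_measure:
  assumes "B \<in> sets borel"
  shows "emeasure (eigenvalue_measure a b n) B =
    (\<Sum>y\<in>spectrum (truncation (jacobi_matrix a b) (Suc n)). emeasure (return borel y) B)"
proof (rule emeasure_measure_of[OF eigenvalue_measure_def])
  let ?m = "\<lambda>B. \<Sum>y\<in>spectrum (truncation (jacobi_matrix a b) (Suc n)).
    emeasure (return borel y) B"
  show "positive (sets (eigenvalue_measure a b n)) ?m"
    by (simp add: positive_def)
  show "countably_additive (sets (eigenvalue_measure a b n)) ?m"
  proof (rule countably_additiveI)
    fix A :: "nat \<Rightarrow> real set"
    assume A: "range A \<subseteq> sets (eigenvalue_measure a b n)" "disjoint_family A"
    have "(\<Sum>i. ?m (A i)) =
      (\<Sum>y\<in>spectrum (truncation (jacobi_matrix a b) (Suc n)).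
        \<Sum>i. emeasure (return borel y) (A i))"
      by (rule suminf_sum) (simp add: summableI)
    also have "\<dots> = ?m (\<Union>i. A i)"
      using A by (intro sum.cong refl suminf_emeasure) simp_all
    finally show "(\<Sum>i. ?m (A i)) = ?m (\<Union>i. A i)" .
  qed
qed (use assms in simp_all)

definition transfer_matrix ::
    "(nat \<Rightarrow> real) \<Rightarrow> (nat \<Rightarrow> real) \<Rightarrow> nat \<Rightarrow> complex \<Rightarrow> complex^2^2" where
  "transfer_matrix a b j z =
     vector [vector [0, 1],
             vector [- complex_of_real (a (j - 1) / a j),
                     (z - complex_of_real (b j)) / complex_of_real (a j)]]"

primrec transfer_product ::
    "(nat \<Rightarrow> real) \<Rightarrow> (nat \<Rightarrow> real) \<Rightarrow> nat \<Rightarrow> nat \<Rightarrow> complex \<Rightarrow> complex^2^2" where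
  "transfer_product a b 0 n z = mat 1"
| "transfer_product a b (Suc k) n z =
     transfer_matrix a b (n + k) z ** transfer_product a b k n z"

definition discr :: "complex^2^2 \<Rightarrow> complex" where
  "discr X = (trace X)\<^sup>2 - 4 * det X"

definition periodic :: "nat \<Rightarrow> (nat \<Rightarrow> real) \<Rightarrow> bool" where
  "periodic N x \<longleftrightarrow> (\<forall>n. x (n + N) = x n)"

definition periodically_modulated ::
    "(nat \<Rightarrow> real) \<Rightarrow> (nat \<Rightarrow> real) \<Rightarrow> (nat \<Rightarrow> real) \<Rightarrow> (nat \<Rightarrow> real) \<Rightarrow> bool" where
  "periodically_modulated \<alpha> \<beta> a b \<longleftrightarrow>
     ((\<lambda>n. \<bar>a (n - 1) / a n - \<alpha> (n - 1) / \<alpha> n\<bar>) \<longlonglongrightarrow> 0) \<and>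
     ((\<lambda>n. \<bar>b n / a n - \<beta> n / \<alpha> n\<bar>) \<longlonglongrightarrow> 0) \<and>
     filterlim a at_top sequentially"

text \<open>Sequences are indexed from 1; the value at 0 plays no role.\<close>

definition D1 :: "nat \<Rightarrow> (nat \<Rightarrow> real) set" where
  "D1 N = {x. summable (\<lambda>n. \<bar>x (Suc n + N) - x (Suc n)\<bar>)}"

definition rho :: "(nat \<Rightarrow> real) \<Rightarrow> (nat \<Rightarrow> real) \<Rightarrow> nat \<Rightarrow> real" where
  "rho \<alpha> a n = (\<Sum>k = 0..n. \<alpha> k / a k)"

definition limit_density :: "nat \<Rightarrow> (nat \<Rightarrow> real) \<Rightarrow> real poly \<Rightarrow> real \<Rightarrow> real" where
  "limit_density N \<alpha> h x =
     1 / (4 * pi * real N * \<alpha> (N - 1)) * (\<bar>poly (pderiv h) x\<bar> / sqrt (- poly h x))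
       * indicator {x. poly h x < 0} x"

definition limit_measure :: "nat \<Rightarrow> (nat \<Rightarrow> real) \<Rightarrow> real poly \<Rightarrow> real measure" where
  "limit_measure N \<alpha> h = density lborel (\<lambda>x. ennreal (limit_density N \<alpha> h x))"

end

theory Submission
  imports Defs
begin

text \<open>
  The zeros of the orthonormal polynomial \<open>p\<^sub>n\<close> are the eigenvalues of the \<open>n\<close> by \<open>n\<close> truncation, so
  \<open>Im\<close> of the Stieltjes transform of the counting measure of these zeros at \<open>x + i y\<close> is the
  \<open>y\<close>-derivative of \<open>ln |p\<^sub>n (x + i y)|\<close>; it is called \<open>poisson_sum\<close> below.
  The plan is to find the growth of \<open>|p\<^sub>n (z)|\<close> for each \<open>z\<close> in the upper half-plane on the
  logarithmic scale \<open>\<rho>\<^sub>n\<close>, to differentiate it, and to invert the Stieltjes transform.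

  Growth. Over one period the transfer matrix is \<open>\<epsilon> (Id + R(z) / A\<^sub>j + o(1 / A\<^sub>j))\<close> with
  \<open>A\<^sub>j = a\<^bsub>jN+N-1\<^esub>\<close> and \<open>R(z)\<close> affine in \<open>z\<close> (\<open>monodromy_expansion\<close>); hence \<open>h = discr R\<close> is the limit
  of \<open>A\<^sub>j\<^sup>2 discr X\<^bsub>jN\<^esub>\<close>. Green's formula for the periodic recurrence identifies the coefficient of \<open>z\<close> in \<open>R\<close> with a
  positive definite Gram matrix times the rotation by a right angle, which makes \<open>h\<close> quadratic with negative leading coefficient. For \<open>Im z > 0\<close> the same positivity forces
  the eigenvalues of \<open>R(z)\<close> to have different real parts and the left eigenvector \<open>(s, 1)\<close> of the one with
  the larger real part, \<open>(tr R + sqrt (h(z))) / 2\<close>, to satisfy \<open>Im s > 0\<close> (\<open>sqrt_h_slope_pos\<close>). On the other hand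
  \<open>p\<^sub>n / p\<^bsub>n-1\<^esub>\<close> stays in the upper half-plane. So the linear form \<open>s p\<^bsub>n-1\<^esub> + p\<^sub>n\<close> never degenerates
  and is multiplied in each period by \<open>\<epsilon> (1 + (tr R + sqrt (h(z))) / (2 A\<^sub>j) + o(1 / A\<^sub>j))\<close>
  (\<open>psi_growth_factor\<close>). Since \<open>1 / A\<^sub>j\<close> is asymptotically the increment of \<open>\<rho>\<close> over one period divided by
  \<open>N \<alpha>\<^bsub>N-1\<^esub>\<close>, and \<open>tr R\<close> does not depend on \<open>z\<close>, the differences of
  \<open>ln |p\<^sub>n|\<close> between two points, divided by \<open>\<rho>\<^sub>n\<close>, converge to the differences of
  \<open>Re (sqrt h) / (2 N \<alpha>\<^bsub>N-1\<^esub>)\<close> (\<open>log_mod_tendsto\<close>).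

  Differentiation. All zeros are real, so \<open>ln |p\<^sub>n (x + i e\<^sup>t)|\<close> is convex in \<open>t\<close>, and for convex functions
  pointwise convergence entails convergence of the derivatives.

  The passage from \<open>s p\<^bsub>n-1\<^esub> + p\<^sub>n\<close> to \<open>p\<^sub>n\<close>, and from the subsequence \<open>n = j N\<close> to all \<open>n\<close>, rests on one
  estimate of Schwarz--Pick type: \<open>|p\<^bsub>n+1\<^esub>' / p\<^bsub>n+1\<^esub> - p\<^sub>n' / p\<^sub>n| \<le> 1 / Im z\<close>. It follows by comparing two
  Christoffel--Darboux sums.

  Inversion. The limiting transform is \<open>-Im (d/dz sqrt h) / (2 N \<alpha>\<^bsub>N-1\<^esub>)\<close>, whose primitive in \<open>x\<close> is
  \<open>-Im (sqrt h) / (2 N \<alpha>\<^bsub>N-1\<^esub>)\<close>. That primitive has the boundary values \<open>limit_cdf\<close> on the real line, where it vanishes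
  on \<open>h \<ge> 0\<close> and equals \<open>\<plusminus> sqrt (-h) / (2 N \<alpha>\<^bsub>N-1\<^esub>)\<close> elsewhere; its derivative divided by
  \<open>\<pi>\<close> is the density in question. So the normalized number of zeros in each interval converges, and the
  weight \<open>1 + x\<^sup>2\<close> controls the rest because the transform at \<open>c + i R\<close> is bounded in \<open>R\<close>.
\<close>

hide_const (open) Module.smult

section \<open>Orthonormal polynomials and the spectrum of a truncation\<close>

text \<open>The orthonormal polynomials of the Jacobi matrix. They are polymorphic in the field so that the real zeros and
the values at complex points belong to one definition.\<close>

fun jpoly :: "(nat \<Rightarrow> real) \<Rightarrow> (nat \<Rightarrow> real) \<Rightarrow> nat \<Rightarrow> 'a::real_field poly" where
  "jpoly a b 0 = 1"
| "jpoly a b (Suc 0) = smult (1 / of_real (a 0)) [:- of_real (b 0), 1:]"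
| "jpoly a b (Suc (Suc n)) = smult (1 / of_real (a (Suc n)))
     ([:- of_real (b (Suc n)), 1:] * jpoly a b (Suc n) - smult (of_real (a n)) (jpoly a b n))"

lemma jpoly_rec:
  assumes "a n \<noteq> 0"
  shows "of_real (a n) * poly (jpoly a b (Suc n)) (z :: 'a::real_field) =
    (z - of_real (b n)) * poly (jpoly a b n) z
      - (if n = 0 then 0 else of_real (a (n - 1)) * poly (jpoly a b (n - 1)) z)"
  using assms by (cases n) (simp_all add: field_simps)

lemma jpoly_deriv_rec:
  assumes "a n \<noteq> 0"
  shows "of_real (a n) * poly (pderiv (jpoly a b (Suc n))) (z :: 'a::real_field) =
    poly (jpoly a b n) z + (z - of_real (b n)) * poly (pderiv (jpoly a b n)) z
      - (if n = 0 then 0 else of_real (a (n - 1)) * poly (pderiv (jpoly a b (n - 1))) z)"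
  using assms
  by (cases n) (simp_all add: field_simps pderiv_smult pderiv_diff pderiv_add pderiv_mult pderiv_pCons)

lemma poly_jpoly_of_real:
  "poly (jpoly a b n) (of_real x :: 'a::real_field) = of_real (poly (jpoly a b n) x)"
  by (induction a b n rule: jpoly.induct) simp_all

lemma poly_jpoly_cnj: "poly (jpoly a b n) (cnj z) = cnj (poly (jpoly a b n) z)"
  by (induction a b n rule: jpoly.induct) simp_all

text \<open>Both sides obey the same recurrence: passing from \<open>n\<close> to \<open>n + 1\<close> adds the square of one polynomial.\<close>

lemma christoffel_darboux_deriv:
  assumes a: "\<And>n. a n > 0"
  shows "of_real (a n) * (poly (pderiv (jpoly a b (Suc n))) z * poly (jpoly a b n) z
      - poly (pderiv (jpoly a b n)) z * poly (jpoly a b (Suc n)) z)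
    = (\<Sum>k\<le>n. (poly (jpoly a b k) (z :: 'a::real_field))\<^sup>2)"
proof (induction n)
  case 0
  show ?case using a[of 0] by (simp add: pderiv_smult pderiv_pCons power2_eq_square)
next
  case (Suc n)
  have nz: "a (Suc n) \<noteq> 0" using a[of "Suc n"] by simp
  note r = jpoly_rec[where a = a and n = "Suc n" and b = b and z = z, OF nz]
    jpoly_deriv_rec[where a = a and n = "Suc n" and b = b and z = z, OF nz]
  let ?A = "of_real (a (Suc n)) :: 'a" and ?p = "poly (jpoly a b (Suc n)) z"
    and ?p' = "poly (pderiv (jpoly a b (Suc n))) z"
    and ?q = "poly (jpoly a b (Suc (Suc n))) z"
    and ?q' = "poly (pderiv (jpoly a b (Suc (Suc n)))) z"
    and ?o = "poly (jpoly a b n) z" and ?o' = "poly (pderiv (jpoly a b n)) z"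
  have "?A * (?q' * ?p - ?p' * ?q) = (?A * ?q') * ?p - ?p' * (?A * ?q)"
    by (simp add: algebra_simps)
  also have "\<dots> = ?p\<^sup>2 + of_real (a n) * (?p' * ?o - ?o' * ?p)"
    unfolding r by (simp add: algebra_simps power2_eq_square)
  finally show ?case using Suc.IH by (simp del: jpoly.simps)
qed

text \<open>The same telescoping as before for the form \<open>Im (p\<^bsub>n+1\<^esub> cnj p\<^sub>n)\<close>. The two sums differ only by the absolute values
inside, which is what makes \<open>jpoly_log_deriv_step\<close> work.\<close>

lemma christoffel_darboux_Im:
  assumes a: "\<And>n. a n > 0"
  shows "a n * Im (poly (jpoly a b (Suc n)) z * cnj (poly (jpoly a b n) z))
    = Im z * (\<Sum>k\<le>n. (cmod (poly (jpoly a b k) z))\<^sup>2)"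
proof (induction n)
  case 0
  show ?case using a[of 0] by (simp add: field_simps)
next
  case (Suc n)
  have nz: "a (Suc n) \<noteq> 0" using a[of "Suc n"] by simp
  note r = jpoly_rec[where a = a and n = "Suc n" and b = b and z = z, OF nz]
  let ?A = "of_real (a (Suc n)) :: complex" and ?p = "poly (jpoly a b (Suc n)) z"
    and ?q = "poly (jpoly a b (Suc (Suc n))) z"
    and ?o = "poly (jpoly a b n) z"
  have "a (Suc n) * Im (?q * cnj ?p) = Im ((?A * ?q) * cnj ?p)"
    by (simp add: algebra_simps del: jpoly.simps)
  also have "\<dots> = Im z * (cmod ?p)\<^sup>2 + a n * Im (?p * cnj ?o)"
    unfolding r by (simp add: algebra_simps cmod_def power2_eq_square del: jpoly.simps)
  finally show ?case using Suc.IH by (simp add: ring_distribs del: jpoly.simps)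
qed

text \<open>The quotients \<open>p\<^bsub>n+1\<^esub> / p\<^sub>n\<close> map the upper half-plane into itself.\<close>

lemma jpoly_Im_pos:
  assumes a: "\<And>n. a n > 0" and z: "Im z > 0"
  shows "Im (poly (jpoly a b (Suc n)) z * cnj (poly (jpoly a b n) z)) > 0"
proof -
  have "1 \<le> (\<Sum>k\<le>n. (cmod (poly (jpoly a b k) z))\<^sup>2)"
    using member_le_sum[of 0 "{..n}" "\<lambda>k. (cmod (poly (jpoly a b k) z))\<^sup>2"] by simp
  then have "0 < Im z * (\<Sum>k\<le>n. (cmod (poly (jpoly a b k) z))\<^sup>2)" using z by simp
  then show ?thesis using christoffel_darboux_Im[where a = a and n = n and b = b and z = z, OF a] a[of n]
    by (metis zero_less_mult_pos)
qed

lemma jpoly_nonzero_upper: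
  assumes a: "\<And>n. a n > 0" and z: "Im z > 0"
  shows "poly (jpoly a b n) z \<noteq> 0"
  using jpoly_Im_pos[where a = a and b = b and n = n and z = z, OF a z] by auto

text \<open>By the two Christoffel--Darboux identities, the Wronskian \<open>p\<^bsub>n+1\<^esub>' p\<^sub>n - p\<^sub>n' p\<^bsub>n+1\<^esub>\<close> is a sum of squares
and \<open>Im (p\<^bsub>n+1\<^esub> cnj p\<^sub>n) / Im z\<close> is the sum of their moduli. This is the Schwarz--Pick inequality for \<open>p\<^bsub>n+1\<^esub> / p\<^sub>n\<close>.\<close>

lemma jpoly_log_deriv_step:
  assumes a: "\<And>n. a n > 0" and z: "Im z > 0"
  shows "cmod (poly (pderiv (jpoly a b (Suc n))) z / poly (jpoly a b (Suc n)) z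
      - poly (pderiv (jpoly a b n)) z / poly (jpoly a b n) z) \<le> 1 / Im z"
proof -
  let ?p = "poly (jpoly a b n) z" and ?q = "poly (jpoly a b (Suc n)) z"
    and ?p' = "poly (pderiv (jpoly a b n)) z" and ?q' = "poly (pderiv (jpoly a b (Suc n))) z"
  (* The Wronskian, whose quotient by p_n p_(n+1) is the difference of the logarithmic derivatives. *)
  let ?W = "?q' * ?p - ?p' * ?q"
  have nz: "?p \<noteq> 0" "?q \<noteq> 0" using jpoly_nonzero_upper[OF a z] by auto
  have "a n * cmod ?W = cmod (of_real (a n) * ?W)" using a[of n] by (simp add: norm_mult)
  also have "\<dots> \<le> (\<Sum>k\<le>n. (cmod (poly (jpoly a b k) z))\<^sup>2)"
    unfolding christoffel_darboux_deriv[where a = a, OF a]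
    by (rule order_trans[OF norm_sum]) (simp add: norm_power)
  finally have "Im z * (a n * cmod ?W) \<le> a n * Im (?q * cnj ?p)"
    unfolding christoffel_darboux_Im[where a = a, OF a] using z by simp
  then have "a n * (Im z * cmod ?W) \<le> a n * Im (?q * cnj ?p)" by (simp add: algebra_simps)
  then have "Im z * cmod ?W \<le> Im (?q * cnj ?p)" using a[of n] by simp
  also have "\<dots> \<le> cmod (?q * ?p)"
    using abs_Im_le_cmod[of "?q * cnj ?p"] by (simp add: norm_mult)
  finally have "cmod ?W / cmod (?q * ?p) \<le> 1 / Im z"
    using nz z by (simp add: field_simps)
  moreover have "?q' / ?q - ?p' / ?p = ?W / (?q * ?p)" using nz by (simp add: field_simps)
  ultimately show ?thesis by (simp add: norm_divide)
qed

abbreviation jacobi_zeros :: "(nat \<Rightarrow> real) \<Rightarrow> (nat \<Rightarrow> real) \<Rightarrow> nat \<Rightarrow> real set" where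
  "jacobi_zeros a b n \<equiv> {y. poly (jpoly a b n) y = 0}"

lemma jpoly_complex_roots:
  assumes a: "\<And>n. a n > 0"
  shows "{z :: complex. poly (jpoly a b n) z = 0} = of_real ` (jacobi_zeros a b n)"
proof -
  have "Im z = 0" if "poly (jpoly a b n) z = 0" for z
  proof (rule ccontr)
    assume "Im z \<noteq> 0"
    then consider "Im z > 0" | "Im (cnj z) > 0" by fastforce
    then show False
      using jpoly_nonzero_upper[OF a] that poly_jpoly_cnj[where a = a and b = b and n = n and z = z] by cases auto
  qed
  then have "\<exists>y. poly (jpoly a b n) y = 0 \<and> z = of_real y" if "poly (jpoly a b n) z = 0" for z :: complex
    using that poly_jpoly_of_real[where a = a and b = b and n = n and x = "Re z" and 'a = complex]
    by (metis complex.exhaust_sel complex_of_real_def of_real_eq_0_iff)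
  then show ?thesis by (auto simp: poly_jpoly_of_real)
qed

text \<open>A common zero of \<open>p\<^sub>n\<close> and \<open>p\<^sub>n'\<close> would annihilate a sum of squares that contains \<open>p\<^sub>0\<^sup>2 = 1\<close>.\<close>

lemma jpoly_simple_real_roots:
  assumes a: "\<And>n. a n > 0" and "poly (jpoly a b n) (y::real) = 0"
  shows "poly (pderiv (jpoly a b n)) y \<noteq> 0"
proof (cases n)
  case (Suc m)
  have "1 \<le> (\<Sum>k\<le>m. (poly (jpoly a b k) y)\<^sup>2)"
    using member_le_sum[of 0 "{..m}" "\<lambda>k. (poly (jpoly a b k) y)\<^sup>2"] by simp
  then show ?thesis using christoffel_darboux_deriv[where a = a and n = m and b = b and z = y, OF a] assms(2) Suc by auto
qed (use assms in auto)

lemma jpoly_deriv_of_real: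
  "poly (pderiv (jpoly a b n)) (of_real x :: 'a::real_field) = of_real (poly (pderiv (jpoly a b n)) x)"
  by (induction a b n rule: jpoly.induct)
     (simp_all add: pderiv_smult pderiv_diff pderiv_mult pderiv_pCons pderiv_add poly_jpoly_of_real)

lemma finite_jpoly_roots:
  assumes a: "\<And>n. a n > 0"
  shows "finite (jacobi_zeros a b n)"
proof -
  have "(jpoly a b n :: complex poly) \<noteq> 0" using jpoly_nonzero_upper[where a = a and b = b and n = n and z = \<i>, OF a] by auto
  then have "finite {z :: complex. poly (jpoly a b n) z = 0}" by (rule poly_roots_finite)
  then show ?thesis unfolding jpoly_complex_roots[OF a]
    by (rule finite_imageD) (simp add: inj_on_def)
qed

lemma jpoly_factor:
  assumes a: "\<And>n. a n > 0"
  shows "(jpoly a b n :: complex poly) =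
    smult (lead_coeff (jpoly a b n)) (\<Prod>y\<in>jacobi_zeros a b n. [:- of_real y, 1:])"
proof -
  have "rsquarefree (jpoly a b n :: complex poly)"
    unfolding rsquarefree_roots
  proof (intro allI notI)
    fix z :: complex assume z: "poly (jpoly a b n) z = 0 \<and> poly (pderiv (jpoly a b n)) z = 0"
    then obtain y where "z = of_real y" "poly (jpoly a b n) y = 0"
      using jpoly_complex_roots[where a = a and b = b and n = n, OF a] by blast
    then show False using z jpoly_simple_real_roots[OF a] by (auto simp: jpoly_deriv_of_real)
  qed
  from complex_poly_decompose_rsquarefree[OF this, symmetric]
  show ?thesis unfolding jpoly_complex_roots[OF a]
    by (subst (asm) prod.reindex) (simp_all add: inj_on_def)
qed

lemma jpoly_log_deriv:
  assumes a: "\<And>n. a n > 0" and z: "Im z > 0"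
  shows "poly (pderiv (jpoly a b n)) z / poly (jpoly a b n) z =
    (\<Sum>y\<in>jacobi_zeros a b n. 1 / (z - of_real y))"
proof -
  let ?S = "jacobi_zeros a b n" and ?c = "lead_coeff (jpoly a b n) :: complex"
  let ?g = "\<Prod>y\<in>?S. [:- complex_of_real y, 1:]"
  have ne: "z - of_real y \<noteq> 0" for y :: real using z by (auto simp: complex_eq_iff)
  have fin: "finite ?S" by (rule finite_jpoly_roots[OF a])
  have pg: "poly ?g z = (\<Prod>y\<in>?S. z - of_real y)" by (simp add: poly_prod)
  have g: "poly ?g z \<noteq> 0" unfolding pg using fin ne by simp
  have "poly (pderiv ?g) z = (\<Sum>y\<in>?S. \<Prod>x\<in>?S - {y}. z - of_real x)"
    by (simp add: pderiv_prod poly_sum poly_prod pderiv_pCons)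
  also have "\<dots> = (\<Sum>y\<in>?S. poly ?g z / (z - of_real y))"
    using fin ne by (intro sum.cong refl) (simp add: pg prod_diff1)
  finally have d: "poly (pderiv ?g) z = poly ?g z * (\<Sum>y\<in>?S. 1 / (z - of_real y))"
    by (simp add: sum_distrib_left)
  have eq: "jpoly a b n = smult ?c ?g" by (rule jpoly_factor[OF a])
  have c: "?c \<noteq> 0" using jpoly_nonzero_upper[where a = a and b = b and n = n and z = z, OF a z] by auto
  have "poly (pderiv (jpoly a b n)) z = ?c * poly (pderiv ?g) z"
    by (subst eq) (simp add: pderiv_smult)
  moreover have "poly (jpoly a b n) z = ?c * poly ?g z" by (subst eq) simp
  ultimately show ?thesis using c g d by simp
qed

lemma tridiagonal_row_sum:
  assumes "i \<le> n"
  shows "(\<Sum>j = 0..<Suc n. jacobi_matrix a b i j * v j) =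
    (if i = 0 then 0 else a (i - 1) * v (i - 1)) + b i * v i + (if i = n then 0 else a i * v (Suc i))"
proof -
  have "(\<Sum>j = 0..<Suc n. jacobi_matrix a b i j * v j) =
    (\<Sum>j = 0..<Suc n. (if j = i - 1 then (if i = 0 then 0 else a (i - 1) * v (i - 1)) else 0)
      + (if j = i then b i * v i else 0) + (if j = Suc i then a i * v (Suc i) else 0))"
    by (intro sum.cong refl) (auto simp: jacobi_matrix_def)
  also have "\<dots> = (if i = 0 then 0 else a (i - 1) * v (i - 1)) + b i * v i + (if i = n then 0 else a i * v (Suc i))"
    using assms by (auto simp: sum.distrib sum.delta)
  finally show ?thesis .
qed

text \<open>The eigenvector equation read row by row; the first and the last row lack one neighbour.\<close>

lemma truncation_eigenvector_iff:
  "eigenvector (truncation (jacobi_matrix a b) (Suc n)) v y \<longleftrightarrow>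
    v \<in> carrier_vec (Suc n) \<and> v \<noteq> 0\<^sub>v (Suc n) \<and>
    (\<forall>i\<le>n. (if i = 0 then 0 else a (i - 1) * v $ (i - 1)) + b i * v $ i
      + (if i = n then 0 else a i * v $ Suc i) = y * v $ i)"
proof -
  have "truncation (jacobi_matrix a b) (Suc n) *\<^sub>v v = y \<cdot>\<^sub>v v \<longleftrightarrow>
    (\<forall>i\<le>n. (if i = 0 then 0 else a (i - 1) * v $ (i - 1)) + b i * v $ i
      + (if i = n then 0 else a i * v $ Suc i) = y * v $ i)" if v: "v \<in> carrier_vec (Suc n)"
  proof -
    have d: "dim_vec v = Suc n" using v by auto
    have row: "(truncation (jacobi_matrix a b) (Suc n) *\<^sub>v v) $ i =
      (if i = 0 then 0 else a (i - 1) * v $ (i - 1)) + b i * v $ i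
      + (if i = n then 0 else a i * v $ Suc i)" if "i \<le> n" for i
      using that v tridiagonal_row_sum[OF that, of a b "\<lambda>j. v $ j"]
      by (simp add: truncation_def scalar_prod_def)
    have "truncation (jacobi_matrix a b) (Suc n) *\<^sub>v v = y \<cdot>\<^sub>v v \<longleftrightarrow>
      (\<forall>i<Suc n. (truncation (jacobi_matrix a b) (Suc n) *\<^sub>v v) $ i = (y \<cdot>\<^sub>v v) $ i)"
      using d by (auto simp: vec_eq_iff truncation_def)
    then show ?thesis using d row by (simp add: less_Suc_eq_le)
  qed
  note rows = this
  have dim: "dim_row (truncation (jacobi_matrix a b) (Suc n)) = Suc n"
    by (simp add: truncation_def)
  show ?thesis
  proof (cases "v \<in> carrier_vec (Suc n)")
    case True
    show ?thesis by (simp only: eigenvector_def dim rows[OF True] True simp_thms)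
  next
    case False
    then show ?thesis by (simp only: eigenvector_def dim simp_thms)
  qed
qed

text \<open>The first rows of the eigenvector equation are the recurrence of the polynomials, so an eigenvector is a multiple of
\<open>(p\<^sub>0, \<dots>, p\<^sub>n)\<close>; the last row then says that \<open>p\<^bsub>n+1\<^esub>\<close> vanishes.\<close>

lemma spectrum_truncation:
  assumes a: "\<And>n. a n > 0"
  shows "spectrum (truncation (jacobi_matrix a b) (Suc n)) = jacobi_zeros a b (Suc n)"
proof (intro Set.set_eqI iffI)
  fix y assume "y \<in> spectrum (truncation (jacobi_matrix a b) (Suc n))"
  then obtain v where "eigenvector (truncation (jacobi_matrix a b) (Suc n)) v y"
    by (auto simp: spectrum_def eigenvalue_def)
  then have v: "v \<in> carrier_vec (Suc n)" "v \<noteq> 0\<^sub>v (Suc n)"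
    and rows: "\<And>i. i \<le> n \<Longrightarrow> (if i = 0 then 0 else a (i - 1) * v $ (i - 1)) + b i * v $ i
      + (if i = n then 0 else a i * v $ Suc i) = y * v $ i"
    by (auto simp: truncation_eigenvector_iff)
  let ?p = "\<lambda>i. poly (jpoly a b i) y"
  have rec: "a i * ?p (Suc i) = (y - b i) * ?p i - (if i = 0 then 0 else a (i - 1) * ?p (i - 1))" for i
    using jpoly_rec[where a = a and n = i and b = b and z = y] a[of i] by simp
  have vp: "v $ i = v $ 0 * ?p i" if "i \<le> n" for i
    using that
  proof (induction i rule: less_induct)
    case (less i)
    show ?case
    proof (cases i)
      case (Suc k)
      then have k: "k \<le> n" "k \<noteq> n" using less.prems by auto
      have "a k * v $ Suc k = (y - b k) * v $ k - (if k = 0 then 0 else a (k - 1) * v $ (k - 1))"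
        using rows[OF k(1)] k(2) by (auto simp: algebra_simps split: if_splits)
      also have "\<dots> = v $ 0 * ((y - b k) * ?p k - (if k = 0 then 0 else a (k - 1) * ?p (k - 1)))"
        using less.IH[of k] less.IH[of "k - 1"] Suc k
        by (auto simp: algebra_simps)
      also have "\<dots> = a k * (v $ 0 * ?p (Suc k))" unfolding rec[symmetric] by simp
      finally show ?thesis using a[of k] Suc by simp
    qed simp
  qed
  have v0: "v $ 0 \<noteq> 0"
  proof
    assume "v $ 0 = 0"
    then have "v $ i = 0" if "i < Suc n" for i using vp[of i] that by simp
    then have "v = 0\<^sub>v (Suc n)" using v(1) by auto
    then show False using v(2) by simp
  qed
  have "v $ 0 * (a n * ?p (Suc n)) = (y - b n) * v $ n - (if n = 0 then 0 else a (n - 1) * v $ (n - 1))"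
    unfolding rec using vp[of n] vp[of "n - 1"] by (auto simp: algebra_simps)
  also have "\<dots> = 0" using rows[of n] by (auto simp: algebra_simps)
  finally show "y \<in> jacobi_zeros a b (Suc n)" using v0 a[of n] by simp
next
  fix y :: real assume "y \<in> jacobi_zeros a b (Suc n)"
  then have sqrt_h: "poly (jpoly a b (Suc n)) y = 0" by simp
  let ?p = "\<lambda>i. poly (jpoly a b i) y"
  have rec: "a i * ?p (Suc i) = (y - b i) * ?p i - (if i = 0 then 0 else a (i - 1) * ?p (i - 1))" for i
    using jpoly_rec[where a = a and n = i and b = b and z = y] a[of i] by simp
  have "Matrix.vec (Suc n) ?p $ 0 = 1" by simp
  then have "Matrix.vec (Suc n) ?p \<noteq> 0\<^sub>v (Suc n)" by force
  moreover have "(if i = 0 then 0 else a (i - 1) * Matrix.vec (Suc n) ?p $ (i - 1))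
      + b i * Matrix.vec (Suc n) ?p $ i
      + (if i = n then 0 else a i * Matrix.vec (Suc n) ?p $ Suc i) = y * Matrix.vec (Suc n) ?p $ i"
    if "i \<le> n" for i
    using rec[of i] sqrt_h that by (auto simp: algebra_simps simp del: jpoly.simps)
  ultimately have "eigenvector (truncation (jacobi_matrix a b) (Suc n)) (Matrix.vec (Suc n) ?p) y"
    unfolding truncation_eigenvector_iff by (intro conjI allI impI vec_carrier)
  then show "y \<in> spectrum (truncation (jacobi_matrix a b) (Suc n))"
    by (auto simp: spectrum_def eigenvalue_def)
qed

lemma eigenvalue_measure_eq_distr:
  assumes a: "\<And>n. a n > 0"
  shows "eigenvalue_measure a b n =
    distr (count_space (jacobi_zeros a b (Suc n))) borel (\<lambda>y. y)"
proof (rule measure_eqI)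
  fix B assume "B \<in> sets (eigenvalue_measure a b n)"
  then have B: "B \<in> sets borel" by simp
  let ?S = "jacobi_zeros a b (Suc n)"
  have fin: "finite ?S" by (rule finite_jpoly_roots[OF a])
  have "emeasure (eigenvalue_measure a b n) B = (\<Sum>y\<in>?S. indicator B y)"
    using B by (simp add: emeasure_eigenvalue_measure spectrum_truncation[OF a] emeasure_return)
  also have "\<dots> = of_nat (card (B \<inter> ?S))" using fin
    by (simp add: indicator_def sum.If_cases Int_commute)
  also have "\<dots> = emeasure (distr (count_space ?S) borel (\<lambda>y. y)) B"
    using B fin by (subst emeasure_distr) (auto simp: emeasure_count_space)
  finally show "emeasure (eigenvalue_measure a b n) B = emeasure (distr (count_space ?S) borel (\<lambda>y. y)) B" .
qed simp

lemma integral_eigenvalue_measure: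
  fixes f :: "real \<Rightarrow> 'b::{banach, second_countable_topology}"
  assumes a: "\<And>n. a n > 0" and f: "f \<in> borel_measurable borel"
  shows "(\<integral>x. f x \<partial>eigenvalue_measure a b n) = (\<Sum>y\<in>jacobi_zeros a b (Suc n). f y)"
  unfolding eigenvalue_measure_eq_distr[OF a] using f finite_jpoly_roots[where a = a and b = b and n = "Suc n", OF a]
  by (subst integral_distr) (simp_all add: lebesgue_integral_count_space_finite)

(* From here on the dollar sign denotes the components of vectors and matrices of fixed size only. *)
no_notation Matrix.vec_index (infixl "$" 100)

section \<open>Limits of quotients and of derivatives\<close>

text \<open>The Stolz--Cesaro theorem.\<close>

lemma tendsto_ratio_of_increments:
  fixes x y :: "nat \<Rightarrow> real"
  assumes pos: "\<And>n. y (Suc n) > y n" and top: "filterlim y at_top sequentially"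
    and lim: "(\<lambda>n. (x (Suc n) - x n) / (y (Suc n) - y n)) \<longlonglongrightarrow> L"
  shows "(\<lambda>n. x n / y n) \<longlonglongrightarrow> L"
proof (rule LIMSEQ_I)
  fix e :: real assume e: "e > 0"
  (* Subtracting L y reduces the claim to the limit 0. *)
  define w where "w n = x n - L * y n" for n
  from LIMSEQ_D[OF lim, of "e / 2"] e obtain M
    where M: "\<And>n. n \<ge> M \<Longrightarrow> norm ((x (Suc n) - x n) / (y (Suc n) - y n) - L) < e / 2" by auto
  have incr: "\<bar>w (Suc n) - w n\<bar> \<le> e / 2 * (y (Suc n) - y n)" if "n \<ge> M" for n
  proof -
    have d: "y (Suc n) - y n > 0" using pos[of n] by simp
    have "w (Suc n) - w n = ((x (Suc n) - x n) / (y (Suc n) - y n) - L) * (y (Suc n) - y n)"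
      using d by (simp add: w_def field_simps)
    then have "\<bar>w (Suc n) - w n\<bar> = norm ((x (Suc n) - x n) / (y (Suc n) - y n) - L) * (y (Suc n) - y n)"
      using d by (simp add: abs_mult)
    then show ?thesis using M[OF that] d by (simp add: mult_right_mono less_imp_le)
  qed
  have bound: "\<bar>w n - w M\<bar> \<le> e / 2 * (y n - y M)" if "n \<ge> M" for n
    using that
  proof (induction n rule: dec_induct)
    case (step n)
    have "e / 2 * (y (Suc n) - y M) = e / 2 * (y (Suc n) - y n) + e / 2 * (y n - y M)"
      by (subst distrib_left[symmetric]) simp
    then show ?case using incr[of n] step by linarith
  qed simp
  define K where "K = \<bar>w M\<bar> + e / 2 * \<bar>y M\<bar>"
  have "eventually (\<lambda>n. y n > 2 * K / e + 1) sequentially"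
    using top by (simp add: filterlim_at_top_dense)
  then obtain M' where M': "\<And>n. n \<ge> M' \<Longrightarrow> y n > 2 * K / e + 1"
    by (auto simp: eventually_sequentially)
  have "norm (x n / y n - L) < e" if n: "n \<ge> max M M'" for n
  proof -
    have K0: "K \<ge> 0" unfolding K_def using e by simp
    have yn: "y n > 2 * K / e + 1" using M' n by simp
    moreover have "2 * K / e \<ge> 0" using K0 e by simp
    ultimately have y0: "y n > 0" by linarith
    have "2 * K < e * y n" using yn e K0 by (simp add: field_simps)
    moreover have "\<bar>w n\<bar> \<le> K + e / 2 * y n"
    proof -
      have "e / 2 * (y n - y M) \<le> e / 2 * y n + e / 2 * \<bar>y M\<bar>"
        using mult_left_mono[of "- y M" "\<bar>y M\<bar>" "e / 2"] e by (simp add: right_diff_distrib)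
      moreover have "\<bar>w n - w M\<bar> \<le> e / 2 * (y n - y M)" using bound[of n] n by simp
      ultimately show ?thesis unfolding K_def by linarith
    qed
    ultimately have "\<bar>w n\<bar> < e * y n" by simp
    moreover have "x n / y n - L = w n / y n" using y0 by (simp add: w_def field_simps)
    ultimately show ?thesis using y0 by (simp add: field_simps)
  qed
  then show "\<exists>no. \<forall>n\<ge>no. norm (x n / y n - L) < e" by blast
qed

text \<open>A sequence with bounded increments moves by a bounded amount within a block of length \<open>N\<close>, which is negligible against a
denominator that tends to infinity.\<close>

lemma tendsto_ratio_along_multiples:
  fixes x y :: "nat \<Rightarrow> real"
  assumes N: "N \<ge> 1" and top: "filterlim y at_top sequentially"
    and dx: "\<And>n. \<bar>x (Suc n) - x n\<bar> \<le> B" and dy: "\<And>n. \<bar>y (Suc n) - y n\<bar> \<le> C"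
    and lim: "(\<lambda>j. x (j * N) / y (j * N)) \<longlonglongrightarrow> L"
  shows "(\<lambda>n. x n / y n) \<longlonglongrightarrow> L"
proof -
  (* The largest multiple of N not exceeding n. *)
  define m where "m n = n div N * N" for n
  have near: "\<bar>u n - u (m n)\<bar> \<le> real N * D" if "\<And>n. \<bar>u (Suc n) - u n\<bar> \<le> D" for u :: "nat \<Rightarrow> real" and D :: real and n
  proof -
    have st: "\<bar>u (k + i) - u k\<bar> \<le> real i * D" for k i
    proof (induction i)
      case (Suc i)
      then show ?case using that[of "k + i"] by (simp add: algebra_simps)
    qed simp
    have D: "D \<ge> 0" using that[of 0] by linarith
    have "n = m n + n mod N" by (simp add: m_def)
    then have "\<bar>u n - u (m n)\<bar> \<le> real (n mod N) * D" using st[of "m n" "n mod N"] by simp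
    also have "\<dots> \<le> real N * D" using N D by (intro mult_right_mono) (auto simp: less_imp_le)
    finally show ?thesis .
  qed
  have dt: "filterlim (\<lambda>n. n div N) at_top sequentially"
    using N by (intro filterlim_at_top_div_const_nat) simp
  have l1: "(\<lambda>n. x (m n) / y (m n)) \<longlonglongrightarrow> L"
    unfolding m_def using filterlim_compose[OF lim dt] by simp
  have inv: "(\<lambda>n. inverse (y n)) \<longlonglongrightarrow> 0" using tendsto_inverse_0_at_top[OF top] .
  have small: "(\<lambda>n. (u n - u (m n)) * inverse (y n)) \<longlonglongrightarrow> 0" if "\<And>n. \<bar>u (Suc n) - u n\<bar> \<le> D"
    for u :: "nat \<Rightarrow> real" and D :: real
  proof (rule tendsto_0_le[OF inv, of _ "real N * D"], intro always_eventually allI)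
    fix n show "norm ((u n - u (m n)) * inverse (y n)) \<le> norm (inverse (y n)) * (real N * D)"
      using mult_right_mono[OF near[of u D n, OF that], of "\<bar>inverse (y n)\<bar>"]
      by (simp add: abs_mult mult.commute)
  qed
  have ynz: "eventually (\<lambda>n. y n > 0) sequentially" using top by (simp add: filterlim_at_top_dense)
  have mt: "filterlim m at_top sequentially"
  proof -
    have "filterlim (\<lambda>n. n div N * N) at_top sequentially"
      by (rule filterlim_at_top_mono[OF dt]) (use N in \<open>auto intro!: always_eventually\<close>)
    then show ?thesis by (simp add: m_def[abs_def])
  qed
  have ymz: "eventually (\<lambda>n. y (m n) > 0) sequentially"
    using filterlim_compose[OF top mt] by (simp add: filterlim_at_top_dense)
  have "(\<lambda>n. 1 - (y n - y (m n)) * inverse (y n)) \<longlonglongrightarrow> 1"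
    using tendsto_diff[OF tendsto_const small[where u = y and D = C, OF dy], of 1] by simp
  then have r: "(\<lambda>n. y (m n) / y n) \<longlonglongrightarrow> 1"
    by (rule Lim_transform_eventually) (use ynz in \<open>auto elim!: eventually_mono simp: field_simps\<close>)
  have "(\<lambda>n. (x n - x (m n)) * inverse (y n) + x (m n) / y (m n) * (y (m n) / y n)) \<longlonglongrightarrow> L"
    using tendsto_add[OF small[where u = x and D = B, OF dx] tendsto_mult[OF l1 r]] by simp
  then show ?thesis
    by (rule Lim_transform_eventually)
       (use eventually_conj[OF ynz ymz] in \<open>auto elim!: eventually_mono simp: field_simps\<close>)
qed

text \<open>The derivative of a convex function lies between its left and right difference quotients, and these converge.\<close>

lemma tendsto_derivs_of_convex:
  fixes F G :: "nat \<Rightarrow> real \<Rightarrow> real" and L :: "real \<Rightarrow> real"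
  assumes deriv: "\<And>n t. (F n has_real_derivative G n t) (at t)"
    and mono: "\<And>n s t. s \<le> t \<Longrightarrow> G n s \<le> G n t"
    and lim: "\<And>s t. (\<lambda>n. F n t - F n s) \<longlonglongrightarrow> L t - L s"
    and L: "(L has_real_derivative L') (at t)"
  shows "(\<lambda>n. G n t) \<longlonglongrightarrow> L'"
proof -
  have up: "G n t \<le> (F n (t + h) - F n t) / h" and lo: "(F n t - F n (t - h)) / h \<le> G n t"
    if "h > 0" for h n
  proof -
    have "t < t + h" "t - h < t" using that by auto
    note mvt = MVT2[where f = "F n" and f' = "G n", OF _ deriv]
    obtain z where z: "t < z" "z < t + h" "F n (t + h) - F n t = (t + h - t) * G n z"
      using mvt[OF \<open>t < t + h\<close>] by blast
    then have "(F n (t + h) - F n t) / h = G n z" using that by simp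
    then show "G n t \<le> (F n (t + h) - F n t) / h" using mono[of t z n] z by simp
    obtain z where z: "t - h < z" "z < t" "F n t - F n (t - h) = (t - (t - h)) * G n z"
      using mvt[OF \<open>t - h < t\<close>] by blast
    then have "(F n t - F n (t - h)) / h = G n z" using that by simp
    then show "(F n t - F n (t - h)) / h \<le> G n t" using mono[of z t n] z by simp
  qed
  show ?thesis
  proof (rule LIMSEQ_I)
    fix e :: real assume e: "e > 0"
    from L have "(\<lambda>h. (L (t + h) - L t) / h) \<midarrow>0\<rightarrow> L'" by (simp add: DERIV_def)
    from LIM_D[OF this, of "e / 2"] e obtain d where d: "d > 0"
      and dq: "\<And>h. h \<noteq> 0 \<Longrightarrow> \<bar>h\<bar> < d \<Longrightarrow> \<bar>(L (t + h) - L t) / h - L'\<bar> < e / 2" by auto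
    define h where "h = d / 2"
    have h: "h > 0" "h < d" using d by (auto simp: h_def)
    have q1: "\<bar>(L (t + h) - L t) / h - L'\<bar> < e / 2" using dq[of h] h by simp
    have q2: "\<bar>(L t - L (t - h)) / h - L'\<bar> < e / 2"
      using dq[of "- h"] h by (simp add: minus_divide_right[symmetric] minus_divide_left)
    have "(\<lambda>n. (F n (t + h) - F n t) / h) \<longlonglongrightarrow> (L (t + h) - L t) / h"
      using h by (intro tendsto_intros lim) auto
    from LIMSEQ_D[OF this, of "e / 2"] e obtain M1
      where M1: "\<And>n. n \<ge> M1 \<Longrightarrow> \<bar>(F n (t + h) - F n t) / h - (L (t + h) - L t) / h\<bar> < e / 2" by auto
    have "(\<lambda>n. (F n t - F n (t - h)) / h) \<longlonglongrightarrow> (L t - L (t - h)) / h"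
      using h by (intro tendsto_intros lim) auto
    from LIMSEQ_D[OF this, of "e / 2"] e obtain M2
      where M2: "\<And>n. n \<ge> M2 \<Longrightarrow> \<bar>(F n t - F n (t - h)) / h - (L t - L (t - h)) / h\<bar> < e / 2" by auto
    have "norm (G n t - L') < e" if "n \<ge> max M1 M2" for n
    proof -
      from that have n: "n \<ge> M1" "n \<ge> M2" by auto
      show ?thesis using up[OF h(1), of n] lo[OF h(1), of n] M1[OF n(1)] M2[OF n(2)] q1 q2
        unfolding real_norm_def by linarith
    qed
    then show "\<exists>no. \<forall>n\<ge>no. norm (G n t - L') < e" by blast
  qed
qed

section \<open>Growth of the polynomials along vertical lines\<close>

definition log_mod :: "(nat \<Rightarrow> real) \<Rightarrow> (nat \<Rightarrow> real) \<Rightarrow> nat \<Rightarrow> real \<Rightarrow> real \<Rightarrow> real" where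
  "log_mod a b n x t = ln (cmod (poly (jpoly a b n) (Complex x (exp t))))"

text \<open>The imaginary part at \<open>x + i y\<close> of the Stieltjes transform of the unit masses on \<open>S\<close>.\<close>

definition poisson_sum :: "real set \<Rightarrow> real \<Rightarrow> real \<Rightarrow> real" where
  "poisson_sum S x y = (\<Sum>s\<in>S. y / ((x - s)\<^sup>2 + y\<^sup>2))"

lemma poisson_sum_log_deriv:
  assumes a: "\<And>n. a n > 0" and y: "y > 0"
  shows "poisson_sum (jacobi_zeros a b n) x y =
    - Im (poly (pderiv (jpoly a b n)) (Complex x y) / poly (jpoly a b n) (Complex x y))"
  using y unfolding poisson_sum_def
  by (subst jpoly_log_deriv[where a = a, OF a])
     (auto simp: Im_divide sum_negf[symmetric] intro!: sum.cong)

text \<open>Since all zeros \<open>y\<close> are real, \<open>ln |p\<^sub>n|\<close> is a sum of terms \<open>ln ((x - y)\<^sup>2 + e\<^bsup>2t\<^esup>) / 2\<close>.\<close>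

lemma has_derivative_log_mod:
  assumes a: "\<And>n. a n > 0"
  shows "((\<lambda>t. log_mod a b n x t) has_real_derivative
    exp t * poisson_sum (jacobi_zeros a b n) x (exp t)) (at t)"
proof -
  let ?S = "jacobi_zeros a b n" and ?c = "lead_coeff (jpoly a b n) :: complex"
  have fin: "finite ?S" by (rule finite_jpoly_roots[where a = a, OF a])
  have c: "?c \<noteq> 0"
    using jpoly_nonzero_upper[where a = a and b = b and n = n and z = \<i>, OF a] by auto
  have pos: "(x - y)\<^sup>2 + (exp t)\<^sup>2 > 0" for y t :: real by (simp add: add_nonneg_pos)
  have cm: "cmod (Complex x (exp t) - of_real y) = sqrt ((x - y)\<^sup>2 + (exp t)\<^sup>2)" for y t :: real
    by (simp add: cmod_def)
  have ev: "log_mod a b n x t = ln (cmod ?c) + (\<Sum>y\<in>?S. ln ((x - y)\<^sup>2 + (exp t)\<^sup>2) / 2)" for t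
  proof -
    have "poly (jpoly a b n) (Complex x (exp t)) = ?c * (\<Prod>y\<in>?S. Complex x (exp t) - of_real y)"
      by (subst jpoly_factor[where a = a, OF a]) (simp add: poly_prod)
    then have "cmod (poly (jpoly a b n) (Complex x (exp t))) =
      cmod ?c * (\<Prod>y\<in>?S. sqrt ((x - y)\<^sup>2 + (exp t)\<^sup>2))"
      by (simp add: norm_mult prod_norm[symmetric] cm)
    moreover have "sqrt ((x - y)\<^sup>2 + (exp t)\<^sup>2) > 0" for y using pos[of y t] by simp
    ultimately have "log_mod a b n x t = ln (cmod ?c) + (\<Sum>y\<in>?S. ln (sqrt ((x - y)\<^sup>2 + (exp t)\<^sup>2)))"
      unfolding log_mod_def using c fin by (simp only:) (subst ln_mult_pos; simp add: prod_pos ln_prod)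
    then show ?thesis using pos by (simp add: ln_sqrt)
  qed
  have d1: "((\<lambda>t. ln ((x - y)\<^sup>2 + (exp t)\<^sup>2) / 2) has_real_derivative
      exp t * (exp t / ((x - y)\<^sup>2 + (exp t)\<^sup>2))) (at t)" for y t
  proof -
    define g where "g t = (x - y)\<^sup>2 + (exp t)\<^sup>2" for t
    have g: "(g has_real_derivative 2 * exp t * exp t) (at t)"
      unfolding g_def by (auto intro!: derivative_eq_intros)
    have "g t > 0" using pos by (simp add: g_def)
    from DERIV_cdivide[OF DERIV_chain2[where f = ln and g = g, OF DERIV_ln[OF this] g], of 2]
    have "((\<lambda>t. ln (g t) / 2) has_real_derivative inverse (g t) * (2 * exp t * exp t) / 2) (at t)" .
    moreover have "inverse (g t) * (2 * exp t * exp t) / 2 = exp t * (exp t / g t)"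
      using \<open>g t > 0\<close> by (simp add: field_simps)
    ultimately show ?thesis by (simp only: g_def)
  qed
  have "((\<lambda>t. ln (cmod ?c) + (\<Sum>y\<in>?S. ln ((x - y)\<^sup>2 + (exp t)\<^sup>2) / 2)) has_real_derivative
      0 + (\<Sum>y\<in>?S. exp t * (exp t / ((x - y)\<^sup>2 + (exp t)\<^sup>2)))) (at t)"
    by (rule DERIV_add[OF DERIV_const DERIV_sum[where f = "\<lambda>t y. ln ((x - y)\<^sup>2 + (exp t)\<^sup>2) / 2"
      and f' = "\<lambda>y. exp t * (exp t / ((x - y)\<^sup>2 + (exp t)\<^sup>2))"]]) (rule d1)
  then show ?thesis unfolding ev poisson_sum_def sum_distrib_left add_0 .
qed

text \<open>This is the convexity of \<open>ln |p\<^sub>n (x + i e\<^sup>t)|\<close> in \<open>t\<close>. In the variable \<open>e\<^sup>t\<close> itself it would fail, hence the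
logarithmic parametrization of the vertical line.\<close>

lemma poisson_sum_scaled_mono:
  assumes "s \<le> t"
  shows "exp s * poisson_sum S x (exp s) \<le> exp t * poisson_sum S x (exp t)"
proof -
  have *: "exp s * (exp s / ((x - y)\<^sup>2 + (exp s)\<^sup>2)) \<le> exp t * (exp t / ((x - y)\<^sup>2 + (exp t)\<^sup>2))" for y
  proof -
    define d u v where "d = (x - y)\<^sup>2" and "u = (exp s)\<^sup>2" and "v = (exp t)\<^sup>2"
    have uv: "0 < u" "u \<le> v" "0 \<le> d" using assms by (auto simp: d_def u_def v_def)
    have "d * u \<le> d * v" using uv by (intro mult_left_mono) auto
    then have "u / (d + u) \<le> v / (d + v)" using uv by (simp add: divide_simps algebra_simps)
    then show ?thesis by (simp add: d_def u_def v_def power2_eq_square)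
  qed
  show ?thesis unfolding poisson_sum_def sum_distrib_left by (rule sum_mono) (rule *)
qed

lemma poisson_sum_step:
  assumes a: "\<And>n. a n > 0" and y: "y > 0"
  shows "\<bar>poisson_sum (jacobi_zeros a b (Suc n)) x y - poisson_sum (jacobi_zeros a b n) x y\<bar> \<le> 1 / y"
proof -
  have "\<bar>Im (poly (pderiv (jpoly a b (Suc n))) (Complex x y) / poly (jpoly a b (Suc n)) (Complex x y)
      - poly (pderiv (jpoly a b n)) (Complex x y) / poly (jpoly a b n) (Complex x y))\<bar> \<le> 1 / Im (Complex x y)"
    using y by (intro order_trans[OF abs_Im_le_cmod] jpoly_log_deriv_step[where a = a, OF a]) simp
  then show ?thesis unfolding poisson_sum_log_deriv[where a = a, OF a y] by simp
qed

text \<open>The increment of \<open>ln |p\<^sub>n|\<close> along a vertical line hardly depends on \<open>n\<close>; this compares neighbouring polynomials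
without any lower bound on their quotient.\<close>

lemma log_mod_step:
  assumes a: "\<And>n. a n > 0"
  shows "\<bar>(log_mod a b (Suc n) x t - log_mod a b (Suc n) x s) - (log_mod a b n x t - log_mod a b n x s)\<bar> \<le> \<bar>t - s\<bar>"
proof -
  define f where "f t = log_mod a b (Suc n) x t - log_mod a b n x t" for t
  define f' where "f' t = exp t * (poisson_sum (jacobi_zeros a b (Suc n)) x (exp t) - poisson_sum (jacobi_zeros a b n) x (exp t))" for t
  have d: "(f has_real_derivative f' t) (at t)" for t
    unfolding f_def f'_def right_diff_distrib
    by (intro derivative_intros has_derivative_log_mod a)
  have "norm (f t - f s) \<le> 1 * norm (t - s)"
  proof (rule field_differentiable_bound[of UNIV f f'])
    fix t
    have "\<bar>f' t\<bar> \<le> exp t * (1 / exp t)" unfolding f'_def abs_mult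
      using mult_left_mono[OF poisson_sum_step[where a = a and y = "exp t" and b = b and n = n and x = x, OF a], of "exp t"] by simp
    then show "norm (f' t) \<le> 1" by simp
  qed (use d in auto)
  then show ?thesis by (simp add: f_def)
qed

section \<open>First order expansion of the monodromy matrix\<close>

text \<open>Bounded variation along steps of length \<open>N\<close> makes every residue class modulo \<open>N\<close> a Cauchy sequence.\<close>

lemma D1_tendsto:
  assumes N: "N \<ge> 1" and x: "x \<in> D1 N"
  shows "\<exists>l. (\<lambda>j. x (j * N + k)) \<longlonglongrightarrow> l"
proof -
  define u where "u j = x (Suc j * N + k)" for j
  define g where "g j = Suc j * N + k - 1" for j
  have Sg: "Suc (g j) = Suc j * N + k" for j using N by (simp add: g_def)
  have "summable ((\<lambda>n. \<bar>x (Suc n + N) - x (Suc n)\<bar>) \<circ> g)"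
  proof (rule summable_reindex)
    have "i = j" if "g i = g j" for i j
    proof -
      have "Suc i * N + k = Suc j * N + k" using that by (simp only: Sg[symmetric])
      then have "Suc i * N = Suc j * N" by (simp only: add_right_cancel)
      then show ?thesis using N by (simp only: mult_cancel2) simp
    qed
    then show "inj g" by (rule injI)
  qed (use x in \<open>auto simp: D1_def\<close>)
  then have "summable (\<lambda>j. \<bar>u (Suc j) - u j\<bar>)"
    unfolding comp_def Sg u_def by (simp add: algebra_simps)
  then have "summable (\<lambda>j. u (Suc j) - u j)" by (rule summable_rabs_cancel)
  then obtain l where "(\<lambda>n. \<Sum>j<n. u (Suc j) - u j) \<longlonglongrightarrow> l"
    by (auto simp: summable_def sums_def)
  then have "(\<lambda>n. u n - u 0) \<longlonglongrightarrow> l" by (simp add: sum_lessThan_telescope)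
  from tendsto_add[OF this tendsto_const[of "u 0"]]
  have "(\<lambda>n. x (Suc n * N + k)) \<longlonglongrightarrow> l + u 0" by (simp add: u_def)
  then have "(\<lambda>n. x (n * N + k)) \<longlonglongrightarrow> l + u 0"
    by (rule LIMSEQ_imp_Suc)
  then show ?thesis by blast
qed

lemma bounded_of_bounded_residues:
  fixes x :: "nat \<Rightarrow> real"
  assumes N: "N \<ge> 1" and conv: "\<And>k. \<exists>l. (\<lambda>j. x (j * N + k)) \<longlonglongrightarrow> l"
  shows "\<exists>B. \<forall>n. \<bar>x n\<bar> \<le> B"
proof -
  have "\<exists>B. \<forall>j. \<bar>x (j * N + k)\<bar> \<le> B" for k
  proof -
    have "Bseq (\<lambda>j. x (j * N + k))" using conv[of k] convergent_imp_Bseq convergent_def by blast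
    then show ?thesis by (auto simp: Bseq_def)
  qed
  then obtain B where B: "\<And>k j. \<bar>x (j * N + k)\<bar> \<le> B k" by metis
  have B0: "0 \<le> B k" for k using B[of 0 k] by linarith
  have "\<bar>x n\<bar> \<le> (\<Sum>k<N. B k)" for n
  proof -
    have "\<bar>x n\<bar> \<le> B (n mod N)" using B[of "n div N" "n mod N"] by simp
    also have "\<dots> \<le> (\<Sum>k<N. B k)" using N B0 by (intro member_le_sum) auto
    finally show ?thesis .
  qed
  then show ?thesis by blast
qed

lemma periodic_add_mult: "periodic N x \<Longrightarrow> x (j * N + k) = x k"
proof (induction j)
  case (Suc j)
  have "x (Suc j * N + k) = x (j * N + k + N)" by (simp add: algebra_simps)
  with Suc show ?case by (simp add: periodic_def)
qed simp

lemma transfer_product_Suc_entries: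
  "transfer_product a b (Suc k) n z $ 1 $ c = transfer_product a b k n z $ 2 $ c"
  "transfer_product a b (Suc k) n z $ 2 $ c =
    - of_real (a (n + k - 1) / a (n + k)) * transfer_product a b k n z $ 1 $ c
    + (z - of_real (b (n + k))) / of_real (a (n + k)) * transfer_product a b k n z $ 2 $ c"
  by (simp_all add: matrix_matrix_mult_def sum_2 transfer_matrix_def)

fun three_term :: "(nat \<Rightarrow> real) \<Rightarrow> (nat \<Rightarrow> real) \<Rightarrow> (nat \<Rightarrow> real) \<Rightarrow> real \<Rightarrow> real \<Rightarrow> nat \<Rightarrow> real" where
  "three_term p q g x0 x1 0 = x0"
| "three_term p q g x0 x1 (Suc 0) = x1"
| "three_term p q g x0 x1 (Suc (Suc k)) =
     p k * three_term p q g x0 x1 k + q k * three_term p q g x0 x1 (Suc k) + g k"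

lemma transfer_product_first_row_Suc_Suc:
  "transfer_product a b (Suc (Suc k)) n z $ 1 $ c =
    - of_real (a (n + k - 1) / a (n + k)) * transfer_product a b k n z $ 1 $ c
    + (z - of_real (b (n + k))) / of_real (a (n + k)) * transfer_product a b (Suc k) n z $ 1 $ c"
  unfolding transfer_product_Suc_entries ..

lemma transfer_product_three_term:
  "transfer_product a b k n 0 $ 1 $ c =
    of_real (three_term (\<lambda>k. - (a (n + k - 1) / a (n + k))) (\<lambda>k. - (b (n + k) / a (n + k))) (\<lambda>_. 0)
      (if c = 1 then 1 else 0) (if c = 2 then 1 else 0) k)"
proof (induction k rule: induct_nat_012)
  case 0
  then show ?case by (auto simp: Finite_Cartesian_Product.mat_def)
next
  case 1
  then show ?case unfolding transfer_product_Suc_entries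
    by (auto simp: Finite_Cartesian_Product.mat_def)
next
  case (ge2 k)
  then show ?case unfolding transfer_product_first_row_Suc_Suc by simp
qed

text \<open>Green's formula: the weighted Casoratian of a homogeneous solution
and of a solution with source \<open>g\<close> that starts at \<open>0, 0\<close> changes only through the source.\<close>

lemma three_term_green:
  assumes per: "\<And>k. al (Suc k) * p k = - al k"
  shows "al k * (three_term p q (\<lambda>_. 0) x0 x1 k * three_term p q g 0 0 (Suc k)
      - three_term p q (\<lambda>_. 0) x0 x1 (Suc k) * three_term p q g 0 0 k)
    = (\<Sum>i<k. al (Suc i) * three_term p q (\<lambda>_. 0) x0 x1 (Suc i) * g i)"
proof (induction k)
  case (Suc k)
  let ?f = "three_term p q (\<lambda>_. 0) x0 x1" and ?g = "three_term p q g 0 0"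
  have "al (Suc k) * (?f (Suc k) * ?g (Suc (Suc k)) - ?f (Suc (Suc k)) * ?g (Suc k)) =
    - (al (Suc k) * p k) * (?f k * ?g (Suc k) - ?f (Suc k) * ?g k) + al (Suc k) * ?f (Suc k) * g k"
    by (simp add: algebra_simps)
  then show ?case using Suc.IH by (simp add: per)
qed simp

text \<open>Modulation at a point where the periodic monodromy matrix is \<open>\<plusminus>Id\<close>.\<close>

locale critical_jacobi =
  fixes N :: nat and a b \<alpha> \<beta> :: "nat \<Rightarrow> real" and \<epsilon> :: real
  assumes N: "N \<ge> 1"
    and a: "\<And>n. a n > 0"
    and \<alpha>: "\<And>n. \<alpha> n > 0"
    and per_\<alpha>: "periodic N \<alpha>" and per_\<beta>: "periodic N \<beta>"
    and modul: "periodically_modulated \<alpha> \<beta> a b"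
    and eps: "\<epsilon> \<in> {-1, 1}"
    and monodromy: "transfer_product \<alpha> \<beta> N N 0 = \<epsilon> *\<^sub>R Finite_Cartesian_Product.mat 1"
    and D1_a: "(\<lambda>n. a n * (a (n - 1) / a n - \<alpha> (n - 1) / \<alpha> n)) \<in> D1 N"
    and D1_b: "(\<lambda>n. a n * (b n / a n - \<beta> n / \<alpha> n)) \<in> D1 N"
begin

lemma a_top: "filterlim a at_top sequentially"
  using modul by (simp add: periodically_modulated_def)

lemma index_at_top: "filterlim (\<lambda>j. j * N + k) at_top sequentially"
proof (rule filterlim_at_top_mono[OF filterlim_ident], intro always_eventually allI)
  fix j have "j * 1 \<le> j * N" using N by (intro mult_le_mono2)
  then have "j \<le> j * N" by (simp only: mult_1_right)
  then show "j \<le> j * N + k" by (rule trans_le_add1)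
qed

lemma \<alpha>_shift: "\<alpha> (j * N + k) = \<alpha> k" and \<beta>_shift: "\<beta> (j * N + k) = \<beta> k"
  using periodic_add_mult per_\<alpha> per_\<beta> by auto

lemma \<alpha>_shift_pred: "j \<ge> 1 \<Longrightarrow> \<alpha> (j * N + k - 1) = \<alpha> (N + k - 1)"
proof -
  assume "j \<ge> 1"
  then obtain i where i: "j = Suc i" by (cases j) auto
  have "j * N + k - 1 = i * N + (N + k - 1)" using N i by simp
  then show ?thesis by (simp only: \<alpha>_shift)
qed

lemma ratio_pred_tendsto: "(\<lambda>j. a (j * N + k - 1) / a (j * N + k)) \<longlonglongrightarrow> \<alpha> (N + k - 1) / \<alpha> k"
proof -
  have "(\<lambda>n. a (n - 1) / a n - \<alpha> (n - 1) / \<alpha> n) \<longlonglongrightarrow> 0"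
    using modul by (simp add: periodically_modulated_def tendsto_rabs_zero_iff)
  from filterlim_compose[OF this index_at_top[of k]]
  have "(\<lambda>j. a (j * N + k - 1) / a (j * N + k) - \<alpha> (j * N + k - 1) / \<alpha> (j * N + k)) \<longlonglongrightarrow> 0" .
  then have "(\<lambda>j. a (j * N + k - 1) / a (j * N + k) - \<alpha> (N + k - 1) / \<alpha> k) \<longlonglongrightarrow> 0"
    by (rule Lim_transform_eventually)
       (use eventually_ge_at_top[of 1] in \<open>eventually_elim; simp add: \<alpha>_shift \<alpha>_shift_pred del: One_nat_def\<close>)
  then show ?thesis by (simp only: LIM_zero_iff)
qed

lemma b_ratio_tendsto: "(\<lambda>j. b (j * N + k) / a (j * N + k)) \<longlonglongrightarrow> \<beta> k / \<alpha> k"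
proof -
  have "(\<lambda>n. b n / a n - \<beta> n / \<alpha> n) \<longlonglongrightarrow> 0"
    using modul by (simp add: periodically_modulated_def tendsto_rabs_zero_iff)
  from filterlim_compose[OF this index_at_top[of k]]
  show ?thesis by (simp only: LIM_zero_iff \<alpha>_shift \<beta>_shift)
qed

lemma ratio_tendsto: "(\<lambda>j. a (j * N + k) / a (j * N + (k + i))) \<longlonglongrightarrow> \<alpha> k / \<alpha> (k + i)"
proof (induction i)
  case 0
  have "a (j * N + k) \<noteq> 0" for j using a[of "j * N + k"] by simp
  then show ?case using \<alpha>[of k] by simp
next
  case (Suc i)
  have nz: "a n \<noteq> 0" for n using a[of n] by simp
  have "\<alpha> (N + Suc (k + i) - 1) = \<alpha> (k + i)" using \<alpha>_shift[of 1] by simp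
  then have "(\<lambda>j. a (j * N + (k + i)) / a (j * N + (k + Suc i))) \<longlonglongrightarrow> \<alpha> (k + i) / \<alpha> (k + Suc i)"
    using ratio_pred_tendsto[of "Suc (k + i)"] by simp
  from tendsto_mult[OF Suc this] show ?case using nz \<alpha>[of "k + i"] by simp
qed

text \<open>The scale of the expansion: over the \<open>j\<close>-th period the transfer matrix differs from \<open>\<plusminus>Id\<close> by a term of order \<open>1 / A j\<close>.\<close>

abbreviation A :: "nat \<Rightarrow> real" where "A j \<equiv> a (j * N + N - 1)"

lemma A_ratio_tendsto: "k < N \<Longrightarrow> (\<lambda>j. A j / a (j * N + k)) \<longlonglongrightarrow> \<alpha> (N - 1) / \<alpha> k"
proof -
  assume k: "k < N"
  then have e: "j * N + (N - 1) = j * N + N - 1" for j by simp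
  have kk: "k + (N - 1 - k) = N - 1" using k by simp
  from ratio_tendsto[of k "N - 1 - k", unfolded kk e]
  have "(\<lambda>j. a (j * N + k) / A j) \<longlonglongrightarrow> \<alpha> k / \<alpha> (N - 1)" .
  from tendsto_inverse[OF this] \<alpha>[of k] \<alpha>[of "N - 1"] show ?thesis by simp
qed

lemma A_top: "filterlim A at_top sequentially"
  using filterlim_compose[OF a_top index_at_top[of "N - 1"]] N by simp

abbreviation (input) p_hom :: "nat \<Rightarrow> real" where "p_hom k \<equiv> - (\<alpha> (N + k - 1) / \<alpha> (N + k))"
abbreviation (input) q_hom :: "nat \<Rightarrow> real" where "q_hom k \<equiv> - (\<beta> (N + k) / \<alpha> (N + k))"

text \<open>Entries of the partial transfer products solve a three-term recurrence whose coefficients are perturbations of order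
\<open>1 / A\<^sub>j\<close> of the periodic ones, so their first order terms solve the periodic recurrence with a
source. The part \<open>w\<close> that multiplies \<open>z\<close> has the source \<open>x\<^bsub>k+1\<^esub> / \<alpha>\<^sub>k\<close>, up to the constant \<open>\<alpha>\<^bsub>N-1\<^esub>\<close>.\<close>

lemma first_order_expansion:
  fixes c :: 2
  assumes s: "\<And>k. (\<lambda>j. a (j * N + k) * (a (j * N + k - 1) / a (j * N + k)
      - \<alpha> (j * N + k - 1) / \<alpha> (j * N + k))) \<longlonglongrightarrow> s k"
    and r: "\<And>k. (\<lambda>j. a (j * N + k) * (b (j * N + k) / a (j * N + k)
      - \<beta> (j * N + k) / \<alpha> (j * N + k))) \<longlonglongrightarrow> r k"
    and x: "x = three_term p_hom q_hom (\<lambda>_. 0) (if c = 1 then 1 else 0) (if c = 2 then 1 else 0)"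
    and u: "u = three_term p_hom q_hom (\<lambda>k. \<alpha> (N - 1) / \<alpha> k * (- s k * x k - r k * x (Suc k))) 0 0"
    and w: "w = three_term p_hom q_hom (\<lambda>k. \<alpha> (N - 1) / \<alpha> k * x (Suc k)) 0 0"
    and k: "k \<le> Suc N"
  shows "(\<lambda>j. of_real (A j) * (transfer_product a b k (j * N) z $ 1 $ c - of_real (x k)))
    \<longlonglongrightarrow> of_real (u k) + z * of_real (w k)"
  using k
proof (induction k rule: induct_nat_012)
  case 0
  show ?case by (auto simp: x u w Finite_Cartesian_Product.mat_def)
next
  case 1
  show ?case unfolding One_nat_def transfer_product_Suc_entries
    by (auto simp: x u w Finite_Cartesian_Product.mat_def)
next
  case (ge2 k)
  then have k: "k < N" by simp
  let ?T = "\<lambda>k j. transfer_product a b k (j * N) z $ 1 $ c"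
  let ?E = "\<lambda>k j. of_real (A j) * (?T k j - of_real (x k))"
  let ?n = "\<lambda>j. j * N + k"
  have nz: "a n \<noteq> 0" "\<alpha> n \<noteq> 0" for n using a[of n] \<alpha>[of n] by auto
  have sh: "\<alpha> (N + k) = \<alpha> k" "\<beta> (N + k) = \<beta> k" using \<alpha>_shift[of 1 k] \<beta>_shift[of 1 k] by auto
  have ia: "(\<lambda>j. inverse (complex_of_real (a (?n j)))) \<longlonglongrightarrow> 0"
    using tendsto_of_real[OF tendsto_inverse_0_at_top[OF filterlim_compose[OF a_top index_at_top[of k]]], where 'a = complex]
    by simp
  have l1: "(\<lambda>j. - complex_of_real (a (?n j - 1) / a (?n j))) \<longlonglongrightarrow> - of_real (\<alpha> (N + k - 1) / \<alpha> k)"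
    by (intro tendsto_minus tendsto_of_real ratio_pred_tendsto)
  have "(\<lambda>j. z * inverse (complex_of_real (a (?n j))) - of_real (b (?n j) / a (?n j)))
      \<longlonglongrightarrow> z * 0 - of_real (\<beta> k / \<alpha> k)"
    by (intro tendsto_diff tendsto_mult tendsto_const ia tendsto_of_real b_ratio_tendsto)
  then have l2: "(\<lambda>j. (z - of_real (b (?n j))) / complex_of_real (a (?n j))) \<longlonglongrightarrow> - of_real (\<beta> k / \<alpha> k)"
    by (simp add: divide_inverse left_diff_distrib)
  have "(\<lambda>j. A j / a (?n j) * (a (?n j) * (a (?n j - 1) / a (?n j)
      - \<alpha> (?n j - 1) / \<alpha> (?n j)))) \<longlonglongrightarrow> \<alpha> (N - 1) / \<alpha> k * s k"
    by (intro tendsto_mult A_ratio_tendsto k s)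
  then have "(\<lambda>j. A j * (a (?n j - 1) / a (?n j) - \<alpha> (N + k - 1) / \<alpha> k)) \<longlonglongrightarrow> \<alpha> (N - 1) / \<alpha> k * s k"
    by (rule Lim_transform_eventually)
       (use eventually_ge_at_top[of 1] in \<open>eventually_elim; simp add: \<alpha>_shift \<alpha>_shift_pred nz del: One_nat_def\<close>)
  then have l3: "(\<lambda>j. of_real (A j * (a (?n j - 1) / a (?n j) - \<alpha> (N + k - 1) / \<alpha> k)) :: complex)
      \<longlonglongrightarrow> of_real (\<alpha> (N - 1) / \<alpha> k * s k)"
    by (rule tendsto_of_real)
  have "(\<lambda>j. z * of_real (A j / a (?n j)) - of_real (A j / a (?n j) * (a (?n j) * (b (?n j) / a (?n j)
      - \<beta> (?n j) / \<alpha> (?n j))))) \<longlonglongrightarrow> z * of_real (\<alpha> (N - 1) / \<alpha> k) - complex_of_real (\<alpha> (N - 1) / \<alpha> k * r k)"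
    by (intro tendsto_mult tendsto_diff tendsto_of_real tendsto_const A_ratio_tendsto k r)
  then have l4: "(\<lambda>j. of_real (A j) * ((z - of_real (b (?n j))) / of_real (a (?n j)) + of_real (\<beta> k / \<alpha> k)))
      \<longlonglongrightarrow> z * of_real (\<alpha> (N - 1) / \<alpha> k) - complex_of_real (\<alpha> (N - 1) / \<alpha> k * r k)"
  proof (rule Lim_transform_eventually, intro always_eventually allI)
    fix j
    have "z * of_real (A0 / a0) - of_real (A0 / a0 * (a0 * (b0 / a0 - q)))
      = of_real A0 * ((z - of_real b0) / of_real a0 + of_real q)" if "a0 \<noteq> 0" for A0 a0 b0 q :: real
      using that by (simp add: field_simps)
    from this[OF nz(1)[of "?n j"]]
    show "z * of_real (A j / a (?n j)) - of_real (A j / a (?n j) * (a (?n j) * (b (?n j) / a (?n j)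
      - \<beta> (?n j) / \<alpha> (?n j)))) = of_real (A j) * ((z - of_real (b (?n j))) / of_real (a (?n j)) + of_real (\<beta> k / \<alpha> k))"
      unfolding \<alpha>_shift \<beta>_shift .
  qed
  have "(\<lambda>j. - complex_of_real (a (?n j - 1) / a (?n j)) * ?E k j
      + (z - of_real (b (?n j))) / complex_of_real (a (?n j)) * ?E (Suc k) j
      - of_real (A j * (a (?n j - 1) / a (?n j) - \<alpha> (N + k - 1) / \<alpha> k)) * of_real (x k)
      + of_real (A j) * ((z - of_real (b (?n j))) / of_real (a (?n j)) + of_real (\<beta> k / \<alpha> k)) * of_real (x (Suc k)))
    \<longlonglongrightarrow> - of_real (\<alpha> (N + k - 1) / \<alpha> k) * (of_real (u k) + z * of_real (w k))
      + - of_real (\<beta> k / \<alpha> k) * (of_real (u (Suc k)) + z * of_real (w (Suc k)))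
      - of_real (\<alpha> (N - 1) / \<alpha> k * s k) * of_real (x k)
      + (z * of_real (\<alpha> (N - 1) / \<alpha> k) - complex_of_real (\<alpha> (N - 1) / \<alpha> k * r k)) * of_real (x (Suc k))"
    (is "_ \<longlonglongrightarrow> ?L")
    by (intro tendsto_add tendsto_diff tendsto_mult l1 l2 l3 l4 tendsto_const ge2) (use k in auto)
  moreover have "?L = of_real (u (Suc (Suc k))) + z * of_real (w (Suc (Suc k)))"
    by (simp add: u w sh algebra_simps)
  moreover have "- complex_of_real (a (?n j - 1) / a (?n j)) * ?E k j
      + (z - of_real (b (?n j))) / complex_of_real (a (?n j)) * ?E (Suc k) j
      - of_real (A j * (a (?n j - 1) / a (?n j) - \<alpha> (N + k - 1) / \<alpha> k)) * of_real (x k)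
      + of_real (A j) * ((z - of_real (b (?n j))) / of_real (a (?n j)) + of_real (\<beta> k / \<alpha> k)) * of_real (x (Suc k))
    = ?E (Suc (Suc k)) j" for j
  proof -
    have xr: "complex_of_real (x (Suc (Suc k))) = - of_real (\<alpha> (N + k - 1) / \<alpha> k) * of_real (x k)
      - of_real (\<beta> k / \<alpha> k) * of_real (x (Suc k))"
      by (simp add: x sh)
    have alg: "- c1 * (B * (T - y)) + c2 * (B * (T' - y')) - (B * (c1 - d1)) * y + (B * (c2 + d2)) * y'
      = B * ((- c1 * T + c2 * T') - (- d1 * y - d2 * y'))" for B c1 c2 T T' y y' d1 d2 :: complex
      by (simp add: algebra_simps)
    show ?thesis unfolding transfer_product_first_row_Suc_Suc xr of_real_mult of_real_diff
      by (rule alg)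
  qed
  ultimately show ?case by simp
qed

text \<open>With \<open>x\<close>, \<open>y\<close> the two basic solutions of the periodic recurrence, Green's formula turns the coefficient of \<open>z\<close> into
the Gram data \<open>X = \<Sum> x\<^sub>k\<^sup>2\<close>, \<open>Y = \<Sum> y\<^sub>k\<^sup>2\<close>, \<open>\<sigma> = \<Sum> x\<^sub>k y\<^sub>k\<close> over one period. The Cauchy--Schwarz inequality
\<open>\<sigma>\<^sup>2 < X Y\<close> is strict because at \<open>k = N\<close> the first solution is \<open>\<epsilon>\<close> and the second vanishes.\<close>

lemma monodromy_expansion:
  obtains X Y \<sigma> u11 u12 u21 u22 :: real where
    "Y > 0" "\<sigma>\<^sup>2 < X * Y"
    "\<And>z. (\<lambda>j. of_real (A j) * (transfer_product a b N (j * N) z $ 1 $ 1 - of_real \<epsilon>))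
      \<longlonglongrightarrow> of_real \<epsilon> * (of_real u11 - z * of_real \<sigma>)"
    "\<And>z. (\<lambda>j. of_real (A j) * transfer_product a b N (j * N) z $ 1 $ 2)
      \<longlonglongrightarrow> of_real \<epsilon> * (of_real u12 - z * of_real Y)"
    "\<And>z. (\<lambda>j. of_real (A j) * transfer_product a b N (j * N) z $ 2 $ 1)
      \<longlonglongrightarrow> of_real \<epsilon> * (of_real u21 + z * of_real X)"
    "\<And>z. (\<lambda>j. of_real (A j) * (transfer_product a b N (j * N) z $ 2 $ 2 - of_real \<epsilon>))
      \<longlonglongrightarrow> of_real \<epsilon> * (of_real u22 + z * of_real \<sigma>)"
proof -
  have "\<forall>k. \<exists>l. (\<lambda>j. a (j * N + k) * (a (j * N + k - 1) / a (j * N + k)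
      - \<alpha> (j * N + k - 1) / \<alpha> (j * N + k))) \<longlonglongrightarrow> l"
    by (intro allI D1_tendsto[OF N D1_a])
  from choice[OF this] obtain s where s: "\<And>k. (\<lambda>j. a (j * N + k) * (a (j * N + k - 1) / a (j * N + k)
      - \<alpha> (j * N + k - 1) / \<alpha> (j * N + k))) \<longlonglongrightarrow> s k" by blast
  have "\<forall>k. \<exists>l. (\<lambda>j. a (j * N + k) * (b (j * N + k) / a (j * N + k)
      - \<beta> (j * N + k) / \<alpha> (j * N + k))) \<longlonglongrightarrow> l"
    by (intro allI D1_tendsto[OF N D1_b])
  from choice[OF this] obtain r where r: "\<And>k. (\<lambda>j. a (j * N + k) * (b (j * N + k) / a (j * N + k)
      - \<beta> (j * N + k) / \<alpha> (j * N + k))) \<longlonglongrightarrow> r k" by blast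
  define x where "x = (\<lambda>c::2. three_term p_hom q_hom (\<lambda>_. 0) (if c = 1 then 1 else 0) (if c = 2 then 1 else 0))"
  define u where "u = (\<lambda>c. three_term p_hom q_hom (\<lambda>k. \<alpha> (N - 1) / \<alpha> k * (- s k * x c k - r k * x c (Suc k))) 0 0)"
  define w where "w = (\<lambda>c. three_term p_hom q_hom (\<lambda>k. \<alpha> (N - 1) / \<alpha> k * x c (Suc k)) 0 0)"
  have ee: "\<epsilon> * \<epsilon> = 1" using eps by auto
  have xT: "complex_of_real (x c k) = transfer_product \<alpha> \<beta> k N 0 $ 1 $ c" for c k
    unfolding transfer_product_three_term x_def by simp
  have xN: "x 1 N = \<epsilon>" "x 2 N = 0" "x 1 (Suc N) = 0" "x 2 (Suc N) = \<epsilon>"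
  proof -
    have "complex_of_real (x 1 N) = of_real \<epsilon>" "complex_of_real (x 2 N) = 0"
      "complex_of_real (x 1 (Suc N)) = 0" "complex_of_real (x 2 (Suc N)) = of_real \<epsilon>"
      unfolding xT transfer_product_Suc_entries monodromy
      by (simp_all add: Finite_Cartesian_Product.mat_def of_real_def)
    then show "x 1 N = \<epsilon>" "x 2 N = 0" "x 1 (Suc N) = 0" "x 2 (Suc N) = \<epsilon>" by simp_all
  qed
  define ip where "ip c d = (\<Sum>k<N. x c (Suc k) * x d (Suc k))" for c d
  have green: "x c N * w d (Suc N) - x c (Suc N) * w d N = ip c d" for c d
  proof -
    have e1: "\<alpha> (N + Suc k - 1) * p_hom k = - \<alpha> (N + k - 1)" for k
      using \<alpha>[of "N + k"] by simp
    have "\<alpha> (N + N - 1) * (x c N * w d (Suc N) - x c (Suc N) * w d N)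
      = (\<Sum>k<N. \<alpha> (N + Suc k - 1) * x c (Suc k) * (\<alpha> (N - 1) / \<alpha> k * x d (Suc k)))"
      unfolding x_def w_def
      by (rule three_term_green[where al = "\<lambda>k. \<alpha> (N + k - 1)"]) (rule e1)
    also have "\<dots> = (\<Sum>k<N. \<alpha> (N - 1) * (x c (Suc k) * x d (Suc k)))"
    proof (rule sum.cong[OF refl])
      fix k
      have "\<alpha> (N + Suc k - 1) = \<alpha> k" using \<alpha>_shift[of 1 k] by simp
      then show "\<alpha> (N + Suc k - 1) * x c (Suc k) * (\<alpha> (N - 1) / \<alpha> k * x d (Suc k))
        = \<alpha> (N - 1) * (x c (Suc k) * x d (Suc k))" using \<alpha>[of k] by simp
    qed
    also have "\<dots> = \<alpha> (N - 1) * ip c d" by (simp add: ip_def sum_distrib_left)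
    also have "\<alpha> (N + N - 1) = \<alpha> (N - 1)" using \<alpha>_shift[of 1 "N - 1"] N by simp
    finally show ?thesis using \<alpha>[of "N - 1"] by simp
  qed
  have w1: "\<epsilon> * w d (Suc N) = ip 1 d" and w2: "- \<epsilon> * w d N = ip 2 d" for d
    using green[of 1 d] green[of 2 d] by (simp_all add: xN)
  have sym: "ip 1 2 = ip 2 1" by (simp add: ip_def mult.commute)
  have wN1: "w d (Suc N) = \<epsilon> * ip 1 d" and wN2: "w d N = - (\<epsilon> * ip 2 d)" for d
  proof -
    have "w d (Suc N) = \<epsilon> * (\<epsilon> * w d (Suc N))" by (simp only: mult.assoc[symmetric] ee mult_1)
    then show "w d (Suc N) = \<epsilon> * ip 1 d" by (simp only: w1)
    have "w d N = - (\<epsilon> * (- \<epsilon> * w d N))"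
      by (simp only: mult_minus_left mult_minus_right minus_minus mult.assoc[symmetric] ee mult_1)
    then show "w d N = - (\<epsilon> * ip 2 d)" by (simp only: w2)
  qed
  have x21: "x 2 (Suc 0) = 1" by (simp add: x_def)
  have Y: "ip 2 2 > 0"
  proof -
    have "x 2 (Suc 0) * x 2 (Suc 0) \<le> ip 2 2" unfolding ip_def
      using N by (intro member_le_sum) auto
    then show ?thesis by (simp add: x21)
  qed
  have cs: "(ip 2 1)\<^sup>2 < ip 1 1 * ip 2 2"
  proof -
    (* The minimizer of the sum of (c y_k - x_k)^2 over c; the term k = N of this sum equals 1. *)
    define c where "c = ip 2 1 / ip 2 2"
    have "(c * x 2 (Suc (N - 1)) - x 1 (Suc (N - 1)))\<^sup>2 \<le> (\<Sum>k<N. (c * x 2 (Suc k) - x 1 (Suc k))\<^sup>2)"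
      using N by (intro member_le_sum) auto
    also have "\<dots> = c * c * ip 2 2 - 2 * c * ip 2 1 + ip 1 1"
      unfolding ip_def sum_distrib_left sum_subtractf[symmetric] sum.distrib[symmetric]
      by (intro sum.cong refl) (simp add: power2_eq_square algebra_simps)
    finally have "1 \<le> c * c * ip 2 2 - 2 * c * ip 2 1 + ip 1 1"
      using N ee by (simp add: xN power2_eq_square)
    also have "\<dots> = ip 1 1 - (ip 2 1)\<^sup>2 / ip 2 2" using Y by (simp add: c_def power2_eq_square field_simps)
    finally have "(ip 2 1)\<^sup>2 / ip 2 2 < ip 1 1" by linarith
    then show ?thesis using Y by (simp add: field_simps)
  qed
  have exp: "(\<lambda>j. of_real (A j) * (transfer_product a b k (j * N) z $ 1 $ c - of_real (x c k)))
      \<longlonglongrightarrow> of_real (u c k) + z * of_real (w c k)" if "k \<le> Suc N" for c k and z :: complex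
    by (rule first_order_expansion[OF s r _ _ _ that]) (simp_all add: x_def u_def w_def)
  have ue: "u c k = \<epsilon> * (\<epsilon> * u c k)" for c k using ee by (simp add: mult.assoc[symmetric])
  show thesis
  proof (rule that[OF Y cs, of "\<epsilon> * u 1 N" "\<epsilon> * u 2 N" "\<epsilon> * u 1 (Suc N)" "\<epsilon> * u 2 (Suc N)"])
    fix z :: complex
    have lim: "complex_of_real \<epsilon> * (of_real (\<epsilon> * u c k) - z * of_real v) = of_real (u c k) + z * of_real (w c k)"
      if "w c k = - (\<epsilon> * v)" for c k v
      unfolding that using ee by (subst (2) ue) (simp add: algebra_simps)
    have lim': "complex_of_real \<epsilon> * (of_real (\<epsilon> * u c k) + z * of_real v) = of_real (u c k) + z * of_real (w c k)"
      if "w c k = \<epsilon> * v" for c k v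
      unfolding that using ee by (subst (2) ue) (simp add: algebra_simps)
    show "(\<lambda>j. of_real (A j) * (transfer_product a b N (j * N) z $ 1 $ 1 - of_real \<epsilon>))
      \<longlonglongrightarrow> of_real \<epsilon> * (of_real (\<epsilon> * u 1 N) - z * of_real (ip 2 1))"
      using exp[of N z 1] unfolding lim[OF wN2] by (simp only: xN le_SucI[OF order_refl] simp_thms)
    show "(\<lambda>j. of_real (A j) * transfer_product a b N (j * N) z $ 1 $ 2)
      \<longlonglongrightarrow> of_real \<epsilon> * (of_real (\<epsilon> * u 2 N) - z * of_real (ip 2 2))"
      using exp[of N z 2] unfolding lim[OF wN2] by (simp only: xN of_real_0 diff_zero le_SucI[OF order_refl] simp_thms)
    show "(\<lambda>j. of_real (A j) * transfer_product a b N (j * N) z $ 2 $ 1)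
      \<longlonglongrightarrow> of_real \<epsilon> * (of_real (\<epsilon> * u 1 (Suc N)) + z * of_real (ip 1 1))"
      using exp[of "Suc N" z 1] unfolding transfer_product_Suc_entries lim'[OF wN1]
      by (simp only: xN of_real_0 diff_zero order_refl simp_thms)
    show "(\<lambda>j. of_real (A j) * (transfer_product a b N (j * N) z $ 2 $ 2 - of_real \<epsilon>))
      \<longlonglongrightarrow> of_real \<epsilon> * (of_real (\<epsilon> * u 2 (Suc N)) + z * of_real (ip 2 1))"
      using exp[of "Suc N" z 2] unfolding transfer_product_Suc_entries lim'[OF wN1[of 2, unfolded sym]]
      by (simp only: xN order_refl simp_thms)
  qed
qed

end

section \<open>Growth rate in the upper half-plane\<close>

text \<open>\<open>|1 + w t|\<^sup>2 = 1 + (2 Re w + |w|\<^sup>2 t) t\<close> and \<open>ln (1 + u) = u + O(u\<^sup>2)\<close>.\<close>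

lemma tendsto_scaled_ln_cmod:
  fixes w :: "nat \<Rightarrow> complex" and A :: "nat \<Rightarrow> real"
  assumes A: "filterlim A at_top sequentially" and w: "w \<longlonglongrightarrow> l"
  shows "(\<lambda>j. A j * ln (cmod (1 + w j / of_real (A j)))) \<longlonglongrightarrow> Re l"
proof -
  define y where "y j = 2 * Re (w j) + (cmod (w j))\<^sup>2 * inverse (A j)" for j
  have iA: "(\<lambda>j. inverse (A j)) \<longlonglongrightarrow> 0" by (rule tendsto_inverse_0_at_top[OF A])
  have "y \<longlonglongrightarrow> 2 * Re l + (cmod l)\<^sup>2 * 0" unfolding y_def by (intro tendsto_intros w iA)
  then have y: "y \<longlonglongrightarrow> 2 * Re l" by simp
  have "(\<lambda>j. y j * inverse (A j)) \<longlonglongrightarrow> 2 * Re l * 0" by (intro tendsto_mult y iA)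
  then have small: "(\<lambda>j. y j * inverse (A j)) \<longlonglongrightarrow> 0" by simp
  have "eventually (\<lambda>j. \<bar>y j * inverse (A j)\<bar> < 1 / 2) sequentially"
    using tendstoD[OF small, of "1/2"] by simp
  moreover have "eventually (\<lambda>j. A j > 0) sequentially" using A by (simp add: filterlim_at_top_dense)
  ultimately have ev: "eventually (\<lambda>j. norm (A j * ln (cmod (1 + w j / of_real (A j))) - y j / 2) \<le>
      norm ((y j)\<^sup>2 * inverse (A j)) * 1) sequentially"
  proof eventually_elim
    case (elim j)
    define t where "t = inverse (A j)"
    have t: "t > 0" and At: "A j * t = 1" using elim(2) by (auto simp: t_def)
    have "(cmod (1 + w j * of_real t))\<^sup>2 = 1 + y j * t"
      unfolding y_def cmod_power2 by (simp add: t_def[symmetric] power2_eq_square algebra_simps)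
    moreover have "1 + y j * t > 0" using elim(1) by (simp add: t_def)
    moreover have "ln ((cmod v)\<^sup>2) = 2 * ln (cmod v)" if "(cmod v)\<^sup>2 > 0" for v
      using that by (simp add: ln_realpow)
    ultimately have l: "ln (cmod (1 + w j * of_real t)) = ln (1 + y j * t) / 2"
      by (metis nonzero_mult_div_cancel_left zero_neq_numeral)
    have "\<bar>ln (1 + y j * t) - y j * t\<bar> \<le> 2 * (y j * t)\<^sup>2"
      using elim(1) by (intro abs_ln_one_plus_x_minus_x_bound) (simp add: t_def)
    then have "A j * \<bar>ln (1 + y j * t) - y j * t\<bar> \<le> A j * (2 * (y j * t)\<^sup>2)"
      using elim(2) by (intro mult_left_mono) auto
    also have "A j * (2 * (y j * t)\<^sup>2) = 2 * ((y j)\<^sup>2 * t) * (A j * t)"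
      by (simp add: power2_eq_square)
    finally have m1: "A j * \<bar>ln (1 + y j * t) - y j * t\<bar> \<le> 2 * ((y j)\<^sup>2 * t)" by (simp add: At)
    have "A j * ln (cmod (1 + w j * of_real t)) - y j / 2 = A j * (ln (1 + y j * t) - y j * t) / 2"
    proof -
      have "A j * (y j * t) = y j * (A j * t)" by simp
      then show ?thesis unfolding l by (simp add: At right_diff_distrib diff_divide_distrib)
    qed
    note eq = this
    have "\<bar>A j * ln (cmod (1 + w j * of_real t)) - y j / 2\<bar> \<le> (y j)\<^sup>2 * t"
      unfolding eq using m1 elim(2) by (simp add: abs_mult)
    moreover have "w j * of_real t = w j / of_real (A j)"
      unfolding t_def of_real_inverse divide_inverse ..
    moreover have "norm ((y j)\<^sup>2 * inverse (A j)) * 1 = (y j)\<^sup>2 * t"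
      unfolding t_def[symmetric] using t by simp
    ultimately show ?case by (simp only: real_norm_def)
  qed
  have "(\<lambda>j. (y j)\<^sup>2 * inverse (A j)) \<longlonglongrightarrow> (2 * Re l)\<^sup>2 * 0" by (intro tendsto_intros y iA)
  then have "(\<lambda>j. (y j)\<^sup>2 * inverse (A j)) \<longlonglongrightarrow> 0" by simp
  from tendsto_0_le[OF this ev]
  have "(\<lambda>j. A j * ln (cmod (1 + w j / of_real (A j))) - y j / 2) \<longlonglongrightarrow> 0" .
  from tendsto_add[OF this tendsto_divide[OF y tendsto_const[of 2]]] show ?thesis by simp
qed

text \<open>The vectors \<open>(v\<^sub>1, v\<^sub>2)\<close> with \<open>v\<^sub>2 / v\<^sub>1\<close> in the closed upper half-plane stay away from the kernel of
\<open>s v\<^sub>1 + v\<^sub>2\<close> when \<open>Im s > 0\<close>, since \<open>-s\<close> lies in the lower half-plane.\<close>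

lemma cmod_first_le_of_upper_cone:
  assumes "Im (v2 * cnj v1) \<ge> 0"
  shows "Im s * cmod v1 \<le> cmod (s * v1 + v2)"
proof (cases "v1 = 0")
  case False
  have "(s * v1 + v2) * cnj v1 = s * of_real ((cmod v1)\<^sup>2) + v2 * cnj v1"
    by (simp add: distrib_right mult.assoc complex_norm_square del: of_real_power)
  then have "Im s * (cmod v1)\<^sup>2 + Im (v2 * cnj v1) = Im ((s * v1 + v2) * cnj v1)"
    by simp
  then have "Im s * (cmod v1)\<^sup>2 \<le> Im ((s * v1 + v2) * cnj v1)" using assms by linarith
  also have "\<dots> \<le> cmod (s * v1 + v2) * cmod v1"
    using abs_Im_le_cmod[of "(s * v1 + v2) * cnj v1"] by (simp add: norm_mult)
  finally have "(Im s * cmod v1) * cmod v1 \<le> cmod (s * v1 + v2) * cmod v1"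
    by (simp add: power2_eq_square)
  then show ?thesis using False by simp
qed simp

lemma transfer_product_jpoly:
  assumes a: "\<And>n. a n > 0" and n: "n \<ge> 1"
  shows "transfer_product a b k n z $ 1 $ 1 * poly (jpoly a b (n - 1)) z
      + transfer_product a b k n z $ 1 $ 2 * poly (jpoly a b n) z = poly (jpoly a b (n + k - 1)) z
    \<and> transfer_product a b k n z $ 2 $ 1 * poly (jpoly a b (n - 1)) z
      + transfer_product a b k n z $ 2 $ 2 * poly (jpoly a b n) z = poly (jpoly a b (n + k)) z"
proof (induction k)
  case 0
  show ?case by (simp add: Finite_Cartesian_Product.mat_def)
next
  case (Suc k)
  let ?T = "transfer_product a b k n z" and ?p = "\<lambda>n. poly (jpoly a b n) z"
  have nz: "a (n + k) \<noteq> 0" using a[of "n + k"] by simp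
  have "of_real (a (n + k)) * ?p (Suc (n + k)) =
      (z - of_real (b (n + k))) * ?p (n + k) - of_real (a (n + k - 1)) * ?p (n + k - 1)"
    using jpoly_rec[where a = a and n = "n + k" and b = b and z = z, OF nz] n by simp
  then have "?p (Suc (n + k)) = ((z - of_real (b (n + k))) * ?p (n + k)
      - of_real (a (n + k - 1)) * ?p (n + k - 1)) / of_real (a (n + k))"
    using nz by (simp add: nonzero_eq_divide_eq mult.commute del: jpoly.simps)
  moreover have gen: "(u * x - c * y) / d = - (c / d) * y + u / d * x" for u x c y d :: complex
    by (simp add: diff_divide_distrib)
  ultimately have rec: "?p (Suc (n + k)) = - of_real (a (n + k - 1) / a (n + k)) * ?p (n + k - 1)
      + (z - of_real (b (n + k))) / of_real (a (n + k)) * ?p (n + k)"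
    by (simp only: of_real_divide gen)
  let ?c = "- complex_of_real (a (n + k - 1) / a (n + k))"
    and ?d = "(z - of_real (b (n + k))) / of_real (a (n + k))"
  have alg: "(c * t + d * t') * x + (c * u + d * u') * y = c * (t * x + u * y) + d * (t' * x + u' * y)"
    for c d t t' u u' x y :: complex by (simp add: algebra_simps)
  have "(?c * ?T $ 1 $ 1 + ?d * ?T $ 2 $ 1) * ?p (n - 1) + (?c * ?T $ 1 $ 2 + ?d * ?T $ 2 $ 2) * ?p n
    = ?c * (?T $ 1 $ 1 * ?p (n - 1) + ?T $ 1 $ 2 * ?p n) + ?d * (?T $ 2 $ 1 * ?p (n - 1) + ?T $ 2 $ 2 * ?p n)"
    by (rule alg)
  also have "\<dots> = ?p (Suc (n + k))" unfolding Suc.IH[THEN conjunct1] Suc.IH[THEN conjunct2] rec ..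
  finally have second: "(?c * ?T $ 1 $ 1 + ?d * ?T $ 2 $ 1) * ?p (n - 1)
      + (?c * ?T $ 1 $ 2 + ?d * ?T $ 2 $ 2) * ?p n = ?p (Suc (n + k))" .
  have idx: "n + Suc k - 1 = n + k" "n + Suc k = Suc (n + k)" by simp_all
  show ?case unfolding transfer_product_Suc_entries idx diff_Suc_1
    by (rule conjI[OF Suc.IH[THEN conjunct2] second])
qed

text \<open>The expansion just proved, with its coefficients fixed: \<open>R11, \<dots>, R22\<close> are the entries of the matrix \<open>R(z)\<close>.\<close>

locale monodromy_limit = critical_jacobi +
  fixes X Y \<sigma> u11 u12 u21 u22 :: real
  assumes Y_pos: "Y > 0" and det_pos: "\<sigma>\<^sup>2 < X * Y"
    and lim11: "\<And>z. (\<lambda>j. of_real (A j) * (transfer_product a b N (j * N) z $ 1 $ 1 - of_real \<epsilon>))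
      \<longlonglongrightarrow> of_real \<epsilon> * (of_real u11 - z * of_real \<sigma>)"
    and lim12: "\<And>z. (\<lambda>j. of_real (A j) * transfer_product a b N (j * N) z $ 1 $ 2)
      \<longlonglongrightarrow> of_real \<epsilon> * (of_real u12 - z * of_real Y)"
    and lim21: "\<And>z. (\<lambda>j. of_real (A j) * transfer_product a b N (j * N) z $ 2 $ 1)
      \<longlonglongrightarrow> of_real \<epsilon> * (of_real u21 + z * of_real X)"
    and lim22: "\<And>z. (\<lambda>j. of_real (A j) * (transfer_product a b N (j * N) z $ 2 $ 2 - of_real \<epsilon>))
      \<longlonglongrightarrow> of_real \<epsilon> * (of_real u22 + z * of_real \<sigma>)"
begin

abbreviation (input) "R11 z \<equiv> complex_of_real u11 - z * of_real \<sigma>"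
abbreviation (input) "R12 z \<equiv> complex_of_real u12 - z * of_real Y"
abbreviation (input) "R21 z \<equiv> complex_of_real u21 + z * of_real X"
abbreviation (input) "R22 z \<equiv> complex_of_real u22 + z * of_real \<sigma>"

text \<open>The discriminant of \<open>R(z)\<close>, written out as a polynomial in \<open>z\<close>.\<close>

definition hpoly :: "real poly" where
  "hpoly = [: (u11 - u22)\<^sup>2 + 4 * u12 * u21, 4 * (u12 * X - Y * u21) - 4 * \<sigma> * (u11 - u22), 4 * (\<sigma>\<^sup>2 - X * Y) :]"

abbreviation h_at :: "complex \<Rightarrow> complex" where "h_at z \<equiv> poly (map_poly complex_of_real hpoly) z"

lemma h_eq: "h_at z = (R11 z - R22 z)\<^sup>2 + 4 * R12 z * R21 z"
proof -
  have "map_poly complex_of_real [:c0, c1, c2:] = [:of_real c0, of_real c1, of_real c2:]" for c0 c1 c2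
    by (simp add: Polynomial.map_poly_pCons)
  then show ?thesis unfolding hpoly_def by (simp add: power2_eq_square algebra_simps)
qed

lemma discr_tendsto:
  "(\<lambda>j. (of_real (A j))\<^sup>2 * discr (transfer_product a b N (j * N) z)) \<longlonglongrightarrow> h_at z"
proof -
  let ?T = "\<lambda>j. transfer_product a b N (j * N) z"
  have "(\<lambda>j. (of_real (A j) * (?T j $ 1 $ 1 - of_real \<epsilon>) - of_real (A j) * (?T j $ 2 $ 2 - of_real \<epsilon>))\<^sup>2
      + 4 * (of_real (A j) * ?T j $ 1 $ 2) * (of_real (A j) * ?T j $ 2 $ 1))
    \<longlonglongrightarrow> (of_real \<epsilon> * R11 z - of_real \<epsilon> * R22 z)\<^sup>2 + 4 * (of_real \<epsilon> * R12 z) * (of_real \<epsilon> * R21 z)"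
    by (intro tendsto_intros lim11 lim12 lim21 lim22)
  moreover have "(of_real \<epsilon> * R11 z - of_real \<epsilon> * R22 z)\<^sup>2 + 4 * (of_real \<epsilon> * R12 z) * (of_real \<epsilon> * R21 z) = h_at z"
    unfolding h_eq using eps by (auto simp: power2_eq_square algebra_simps)
  moreover have "(B * (t11 - e) - B * (t22 - e))\<^sup>2 + 4 * (B * t12) * (B * t21)
    = B\<^sup>2 * ((t11 + t22)\<^sup>2 - 4 * (t11 * t22 - t12 * t21))" for B t11 t12 t21 t22 e :: complex
    by (simp add: power2_eq_square algebra_simps)
  ultimately show ?thesis unfolding discr_def det_2 trace_def sum_2 by simp
qed

definition sqrt_h :: "complex \<Rightarrow> complex" where "sqrt_h z = csqrt (h_at z)"
text \<open>The eigenvalue of \<open>R(z)\<close> with the larger real part.\<close>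

definition exponent :: "complex \<Rightarrow> complex" where "exponent z = (of_real (u11 + u22) + sqrt_h z) / 2"
text \<open>The vector \<open>(slope z, 1)\<close> is a left eigenvector of \<open>R(z)\<close> for the eigenvalue \<open>exponent z\<close>.\<close>

definition slope :: "complex \<Rightarrow> complex" where "slope z = (exponent z - R22 z) / R12 z"

text \<open>Completing the square in \<open>s\<close>.\<close>

lemma quadratic_form_pos:
  fixes s :: complex
  shows "0 < Y * (cmod s)\<^sup>2 - 2 * \<sigma> * Re s + X"
proof -
  have "0 < (Y * Re s - \<sigma>)\<^sup>2 + (Y * Im s)\<^sup>2 + (X * Y - \<sigma>\<^sup>2)" using det_pos by (intro add_nonneg_pos) auto
  also have "\<dots> = Y * (Y * (cmod s)\<^sup>2 - 2 * \<sigma> * Re s + X)"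
    unfolding cmod_power2 by (simp add: power2_eq_square algebra_simps)
  finally show ?thesis using Y_pos by (simp add: zero_less_mult_iff)
qed

lemma two_exponent: "2 * exponent z = R11 z + R22 z + sqrt_h z"
  by (simp add: exponent_def)

lemma slope_eqs:
  assumes z: "Im z > 0"
  shows "slope z * R12 z + R22 z = exponent z" "slope z * R11 z + R21 z = exponent z * slope z"
proof -
  have "Im (R12 z) \<noteq> 0" using z Y_pos by simp
  then have nz: "R12 z \<noteq> 0" by (metis zero_complex.sel(2))
  show 1: "slope z * R12 z + R22 z = exponent z" unfolding slope_def using nz by simp
  have "(sqrt_h z)\<^sup>2 = (R11 z - R22 z)\<^sup>2 + 4 * R12 z * R21 z" by (simp add: sqrt_h_def h_eq)
  moreover have "4 * ((exponent z - R11 z) * (exponent z - R22 z)) = (2 * exponent z - 2 * R11 z) * (2 * exponent z - 2 * R22 z)"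
    by (simp add: algebra_simps)
  moreover have "\<dots> = (sqrt_h z)\<^sup>2 - (R11 z - R22 z)\<^sup>2"
    unfolding two_exponent by (simp add: power2_eq_square algebra_simps)
  ultimately have "4 * ((exponent z - R11 z) * (exponent z - R22 z)) = 4 * (R12 z * R21 z)" by simp
  then have "(exponent z - R11 z) * (exponent z - R22 z) = R12 z * R21 z" by simp
  then have "(exponent z - R11 z) * slope z = R21 z" unfolding slope_def using nz by (simp add: field_simps)
  then show "slope z * R11 z + R21 z = exponent z * slope z" by (simp add: algebra_simps)
qed

text \<open>Combining the two eigenvector equations so that \<open>sqrt_h z\<close> is multiplied by \<open>s - cnj s\<close> leaves, in the imaginary
part, only the coefficients of \<open>z\<close>. They form the positive quadratic form above times \<open>Im z\<close>,
so \<open>Re (sqrt_h z)\<close> and \<open>Im s\<close> are both nonzero and have the same sign.\<close>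

lemma sqrt_h_slope_pos:
  assumes z: "Im z > 0"
  shows "Re (sqrt_h z) > 0" "Im (slope z) > 0"
proof -
  let ?s = "slope z" and ?q = "sqrt_h z"
  have q: "?q = 2 * exponent z - R11 z - R22 z" unfolding two_exponent by simp
  have q1: "?q = 2 * ?s * R12 z + R22 z - R11 z"
    unfolding q slope_eqs(1)[OF z, symmetric] by (simp add: algebra_simps)
  have "?q * ?s = 2 * (exponent z * ?s) - ?s * R11 z - ?s * R22 z" unfolding q by (simp add: algebra_simps)
  then have q2: "?q * ?s = ?s * (R11 z - R22 z) + 2 * R21 z"
    unfolding slope_eqs(2)[OF z, symmetric] by (simp add: algebra_simps)
  have "?q * (?s - cnj ?s) = ?q * ?s - cnj ?s * ?q" by (simp add: algebra_simps)
  also have "\<dots> = (?s + cnj ?s) * (R11 z - R22 z) + 2 * R21 z - 2 * (?s * cnj ?s) * R12 z"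
    unfolding q2 by (subst q1) (simp add: algebra_simps)
  also have "?s + cnj ?s = of_real (2 * Re ?s)" by (simp add: complex_add_cnj)
  also have "?s * cnj ?s = of_real ((cmod ?s)\<^sup>2)" by (rule complex_norm_square[symmetric])
  finally have "Im (?q * (?s - cnj ?s)) =
    Im (of_real (2 * Re ?s) * (R11 z - R22 z) + 2 * R21 z - 2 * of_real ((cmod ?s)\<^sup>2) * R12 z)" by simp
  then have "2 * (Re ?q * Im ?s) = 2 * (Im z * (Y * (cmod ?s)\<^sup>2 - 2 * \<sigma> * Re ?s + X))"
    by (simp add: algebra_simps)
  then have "Re ?q * Im ?s > 0" using quadratic_form_pos[of ?s] z by simp
  moreover have "Re ?q \<ge> 0" using csqrt_principal[of "h_at z"] unfolding sqrt_h_def by linarith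
  ultimately show "Re ?q > 0" "Im ?s > 0" by (auto simp: zero_less_mult_iff)
qed

text \<open>Like \<open>rho\<close>, but with the summation index below \<open>m\<close>: \<open>p\<^sub>m\<close> has \<open>m\<close> zeros and is paired with \<open>tau m\<close>.\<close>

definition tau :: "nat \<Rightarrow> real" where "tau m = (\<Sum>k<m. \<alpha> k / a k)"

lemma rho_eq_tau: "rho \<alpha> a n = tau (Suc n)"
  by (simp add: rho_def tau_def atLeast0AtMost lessThan_Suc_atMost)

lemma tau_strict: "tau n < tau (Suc n)"
  using a[of n] \<alpha>[of n] by (simp add: tau_def)

lemma D1_bounded: "x \<in> D1 N \<Longrightarrow> \<exists>B. \<forall>n. \<bar>x n\<bar> \<le> B"
  by (rule bounded_of_bounded_residues[OF N]) (rule D1_tendsto[OF N])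

lemma \<alpha>_bounds: "\<exists>B. \<forall>n. \<bar>\<alpha> n\<bar> \<le> B" "\<exists>B. \<forall>n. \<bar>1 / \<alpha> n\<bar> \<le> B"
  by (rule bounded_of_bounded_residues[OF N], simp add: \<alpha>_shift, rule exI, rule tendsto_const)+

text \<open>Condition \<open>D1_a\<close> bounds the increments of \<open>r\<^sub>n = a\<^sub>n / \<alpha>\<^sub>n\<close>. Hence
\<open>ln r\<^bsub>n+1\<^esub> - ln r\<^sub>n \<le> K / r\<^sub>n\<close>, and the sum of the right-hand sides diverges together with \<open>ln r\<^sub>n\<close>.\<close>

lemma tau_top: "filterlim tau at_top sequentially"
proof -
  define r where "r n = a n / \<alpha> n" for n
  have r: "r n > 0" for n using a[of n] \<alpha>[of n] by (simp add: r_def)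
  obtain B1 where B1: "\<And>n. \<bar>a n * (a (n - 1) / a n - \<alpha> (n - 1) / \<alpha> n)\<bar> \<le> B1"
    using D1_bounded[OF D1_a] by (elim exE) blast
  obtain B2 where B2: "\<And>n. \<bar>1 / \<alpha> n\<bar> \<le> B2" using \<alpha>_bounds(2) by (elim exE) blast
  obtain B3 where B3: "\<And>n. \<bar>\<alpha> n\<bar> \<le> B3" using \<alpha>_bounds(1) by (elim exE) blast
  have inc: "r (Suc n) - r n \<le> B1 * B2" for n
  proof -
    have "r (Suc n) - r n = - (a (Suc n) * (a (Suc n - 1) / a (Suc n) - \<alpha> (Suc n - 1) / \<alpha> (Suc n))) * (1 / \<alpha> n)"
    proof -
      have "a1 / p1 - a0 / p0 = - (a1 * (a0 / a1 - p0 / p1)) * (1 / p0)"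
        if "a1 > 0" "p0 > 0" for a0 a1 p0 p1 :: real
      proof -
        have "a1 * (a0 / a1 - p0 / p1) = a0 - a1 * p0 / p1" using that by (simp add: right_diff_distrib)
        then show ?thesis using that by (simp add: diff_divide_distrib)
      qed
      then show ?thesis unfolding r_def diff_Suc_1 using a[of "Suc n"] \<alpha>[of n] by blast
    qed
    also have "\<dots> \<le> \<bar>a (Suc n) * (a (Suc n - 1) / a (Suc n) - \<alpha> (Suc n - 1) / \<alpha> (Suc n))\<bar> * \<bar>1 / \<alpha> n\<bar>"
      by (rule order_trans[OF abs_ge_self]) (simp only: abs_mult abs_minus_cancel order_refl)
    also have "\<dots> \<le> B1 * B2" by (intro mult_mono B1 B2) (use B1[of 0] in auto)
    finally show ?thesis .
  qed
  define K where "K = max (B1 * B2) 1"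
  have K: "K > 0" by (simp add: K_def)
  have step: "ln (r (Suc n)) - ln (r n) \<le> K * (\<alpha> n / a n)" for n
  proof -
    have "ln (r (Suc n)) - ln (r n) = ln (r (Suc n) / r n)" using r[of n] r[of "Suc n"] by (simp add: ln_div)
    also have "\<dots> \<le> r (Suc n) / r n - 1" using r[of n] r[of "Suc n"] by (intro ln_le_minus_one) simp
    also have "\<dots> = (r (Suc n) - r n) / r n" using r[of n] by (simp add: field_simps)
    also have "\<dots> \<le> K / r n" using inc[of n] r[of n] by (intro divide_right_mono) (auto simp: K_def)
    finally show ?thesis by (simp add: r_def)
  qed
  have tot: "ln (r n) - ln (r 0) \<le> K * tau n" for n
  proof (induction n)
    case (Suc n)
    have "K * tau (Suc n) = K * tau n + K * (\<alpha> n / a n)" by (simp add: tau_def distrib_left)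
    then show ?case using Suc step[of n] by linarith
  qed (simp add: tau_def)
  have B3p: "B3 > 0" using B3[of 0] \<alpha>[of 0] by simp
  have "filterlim (\<lambda>n. 1 / B3 * a n) at_top sequentially"
    using B3p by (intro filterlim_tendsto_pos_mult_at_top[OF tendsto_const _ a_top]) simp
  then have "filterlim r at_top sequentially"
  proof (rule filterlim_at_top_mono, intro always_eventually allI)
    fix n show "1 / B3 * a n \<le> r n"
      unfolding r_def using B3[of n] \<alpha>[of n] a[of n] B3p by (simp add: frac_le less_imp_le)
  qed
  then have "filterlim (\<lambda>n. ln (r n)) at_top sequentially" by (rule filterlim_compose[OF ln_at_top])
  then have "filterlim (\<lambda>n. - ln (r 0) + ln (r n)) at_top sequentially"
    by (rule filterlim_tendsto_add_at_top[OF tendsto_const])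
  then have "filterlim (\<lambda>n. 1 / K * (- ln (r 0) + ln (r n))) at_top sequentially"
    using K by (intro filterlim_tendsto_pos_mult_at_top[OF tendsto_const]) auto
  then show ?thesis
  proof (rule filterlim_at_top_mono, intro always_eventually allI)
    fix n show "1 / K * (- ln (r 0) + ln (r n)) \<le> tau n" using tot[of n] K by (simp add: field_simps)
  qed
qed

lemma tau_block_tendsto: "(\<lambda>j. A j * (tau (Suc j * N) - tau (j * N))) \<longlonglongrightarrow> N * \<alpha> (N - 1)"
proof -
  have blk: "tau (Suc j * N) - tau (j * N) = (\<Sum>i<N. \<alpha> i / a (j * N + i))" for j
  proof -
    have "tau (m + i) - tau m = (\<Sum>k<i. \<alpha> (m + k) / a (m + k))" for m i
      by (induction i) (simp_all add: tau_def)
    from this[of "j * N" N] show ?thesis by (simp add: \<alpha>_shift add.commute[of N])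
  qed
  have "(\<lambda>j. \<Sum>i<N. \<alpha> i * (A j / a (j * N + i))) \<longlonglongrightarrow> (\<Sum>i<N. \<alpha> i * (\<alpha> (N - 1) / \<alpha> i))"
    by (intro tendsto_sum tendsto_mult tendsto_const A_ratio_tendsto) simp
  moreover have "(\<Sum>i<N. \<alpha> i * (\<alpha> (N - 1) / \<alpha> i)) = N * \<alpha> (N - 1)"
    using \<alpha> by (simp add: less_imp_neq[symmetric])
  ultimately show ?thesis unfolding blk by (simp add: sum_distrib_left mult.commute)
qed

abbreviation P :: "nat \<Rightarrow> complex \<Rightarrow> complex" where "P n z \<equiv> poly (jpoly a b n) z"

definition psi :: "complex \<Rightarrow> nat \<Rightarrow> complex" where
  "psi z j = slope z * P (j * N - 1) z + P (j * N) z"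

text \<open>The linear form \<open>psi\<close> controls both components: its coefficient has positive imaginary part, and so has the
quotient of consecutive polynomials.\<close>

lemma psi_bounds:
  assumes z: "Im z > 0"
  obtains C where "C > 0" "\<And>j. j \<ge> 1 \<Longrightarrow> cmod (P (j * N - 1) z) \<le> C * cmod (psi z j)"
    "\<And>j. j \<ge> 1 \<Longrightarrow> cmod (P (j * N) z) \<le> C * cmod (psi z j)"
proof -
  let ?s = "slope z"
  have s: "Im ?s > 0" by (rule sqrt_h_slope_pos(2)[OF z])
  define C where "C = 1 + (1 + cmod ?s) / Im ?s"
  have C1: "1 / Im ?s \<le> C" "1 + cmod ?s / Im ?s \<le> C" "C > 0"
    using s by (auto simp: C_def add_divide_distrib add_pos_nonneg)
  have one: "cmod (P (j * N - 1) z) \<le> 1 / Im ?s * cmod (psi z j)" if j: "j \<ge> 1" for j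
  proof -
    have "j * N \<ge> 1" using j N by (simp add: Suc_le_eq)
    then have Sj: "Suc (j * N - 1) = j * N" by simp
    have "Im (P (j * N) z * cnj (P (j * N - 1) z)) > 0"
      using jpoly_Im_pos[where a = a and b = b and n = "j * N - 1" and z = z, OF a z] unfolding Sj .
    then have "Im ?s * cmod (P (j * N - 1) z) \<le> cmod (psi z j)"
      unfolding psi_def by (intro cmod_first_le_of_upper_cone) simp
    then show ?thesis using s by (simp add: field_simps)
  qed
  show thesis
  proof (rule that[OF C1(3)])
    fix j :: nat assume j: "j \<ge> 1"
    show "cmod (P (j * N - 1) z) \<le> C * cmod (psi z j)"
      using one[OF j] C1(1) by (meson mult_right_mono norm_ge_zero order_trans)
    have "P (j * N) z = psi z j - ?s * P (j * N - 1) z" by (simp add: psi_def)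
    then have "cmod (P (j * N) z) \<le> cmod (psi z j) + cmod ?s * cmod (P (j * N - 1) z)"
      by (metis norm_mult norm_triangle_ineq4)
    also have "\<dots> \<le> cmod (psi z j) + cmod ?s * (1 / Im ?s * cmod (psi z j))"
      by (intro add_left_mono mult_left_mono one[OF j]) simp
    also have "\<dots> = (1 + cmod ?s / Im ?s) * cmod (psi z j)" by (simp add: algebra_simps)
    also have "\<dots> \<le> C * cmod (psi z j)" by (intro mult_right_mono C1) simp
    finally show "cmod (P (j * N) z) \<le> C * cmod (psi z j)" .
  qed
qed

lemma psi_nonzero: "Im z > 0 \<Longrightarrow> j \<ge> 1 \<Longrightarrow> psi z j \<noteq> 0"
  using psi_bounds[of z] jpoly_nonzero_upper[where a = a and b = b and n = "j * N" and z = z, OF a]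
  by (metis mult_zero_right norm_eq_zero norm_le_zero_iff)

text \<open>The pair \<open>(p\<^bsub>jN-1\<^esub>, p\<^bsub>jN\<^esub>)\<close> is multiplied by the transfer matrix, and \<open>psi\<close> is a left eigenvector of its first order
term. The remaining error is small relative to \<open>psi\<close> by \<open>psi_bounds\<close>.\<close>

lemma psi_growth_factor:
  assumes z: "Im z > 0"
  shows "(\<lambda>j. of_real (A j) * (psi z (Suc j) / (of_real \<epsilon> * psi z j) - 1)) \<longlonglongrightarrow> exponent z"
proof -
  let ?T = "\<lambda>j. transfer_product a b N (j * N) z" and ?s = "slope z"
  let ?p = "\<lambda>j. P (j * N - 1) z" and ?p' = "\<lambda>j. P (j * N) z"
  obtain C where C: "C > 0" "\<And>j. j \<ge> 1 \<Longrightarrow> cmod (?p j) \<le> C * cmod (psi z j)"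
    "\<And>j. j \<ge> 1 \<Longrightarrow> cmod (?p' j) \<le> C * cmod (psi z j)" using psi_bounds[OF z] by blast
  have e: "complex_of_real \<epsilon> \<noteq> 0" "of_real \<epsilon> * complex_of_real \<epsilon> = 1" using eps by auto
  (* The deviations of the two components of A_j (s, 1) (X - eps) from eps times the eigenvalue times (s, 1). *)
  define f where "f j = ?s * (of_real (A j) * (?T j $ 1 $ 1 - of_real \<epsilon>)) + of_real (A j) * ?T j $ 2 $ 1
      - of_real \<epsilon> * (exponent z * ?s)" for j
  define g where "g j = ?s * (of_real (A j) * ?T j $ 1 $ 2) + of_real (A j) * (?T j $ 2 $ 2 - of_real \<epsilon>)
      - of_real \<epsilon> * exponent z" for j
  have "f \<longlonglongrightarrow> ?s * (of_real \<epsilon> * R11 z) + of_real \<epsilon> * R21 z - of_real \<epsilon> * (exponent z * ?s)"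
    unfolding f_def by (intro tendsto_intros lim11 lim21)
  also have "?s * (of_real \<epsilon> * R11 z) + of_real \<epsilon> * R21 z - of_real \<epsilon> * (exponent z * ?s) = 0"
    unfolding slope_eqs(2)[OF z, symmetric] by (simp add: algebra_simps)
  finally have f: "f \<longlonglongrightarrow> 0" .
  have "g \<longlonglongrightarrow> ?s * (of_real \<epsilon> * R12 z) + of_real \<epsilon> * R22 z - of_real \<epsilon> * exponent z"
    unfolding g_def by (intro tendsto_intros lim12 lim22)
  also have "?s * (of_real \<epsilon> * R12 z) + of_real \<epsilon> * R22 z - of_real \<epsilon> * exponent z = 0"
    by (subst slope_eqs(1)[OF z, symmetric]) (simp add: algebra_simps)
  finally have g: "g \<longlonglongrightarrow> 0" .
  have quot: "cmod (h * (v / psi z j)) \<le> cmod h * C" if "j \<ge> 1" "cmod v \<le> C * cmod (psi z j)" for h v j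
    unfolding norm_mult
    by (intro mult_left_mono) (use that psi_nonzero[OF z that(1)] in \<open>simp_all add: norm_divide divide_simps\<close>)
  have "(\<lambda>j. f j * (?p j / psi z j)) \<longlonglongrightarrow> 0"
    by (rule tendsto_0_le[OF f, of _ C], use eventually_ge_at_top[of 1] in eventually_elim) (intro quot C(2))
  moreover have "(\<lambda>j. g j * (?p' j / psi z j)) \<longlonglongrightarrow> 0"
    by (rule tendsto_0_le[OF g, of _ C], use eventually_ge_at_top[of 1] in eventually_elim) (intro quot C(3))
  ultimately have lims: "(\<lambda>j. f j * (?p j / psi z j)) \<longlonglongrightarrow> 0" "(\<lambda>j. g j * (?p' j / psi z j)) \<longlonglongrightarrow> 0" .
  from tendsto_add[OF tendsto_const[of "exponent z"] tendsto_mult[OF tendsto_const[of "of_real \<epsilon>"] tendsto_add[OF lims]]]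
  have "(\<lambda>j. exponent z + of_real \<epsilon> * (f j * (?p j / psi z j) + g j * (?p' j / psi z j))) \<longlonglongrightarrow> exponent z" by simp
  then show ?thesis
  proof (rule Lim_transform_eventually)
    show "eventually (\<lambda>j. exponent z + of_real \<epsilon> * (f j * (?p j / psi z j) + g j * (?p' j / psi z j))
      = of_real (A j) * (psi z (Suc j) / (of_real \<epsilon> * psi z j) - 1)) sequentially"
      using eventually_ge_at_top[of 1]
    proof eventually_elim
      case (elim j)
      have jN: "j * N \<ge> 1" using elim N by (simp add: Suc_le_eq)
      have nz: "psi z j \<noteq> 0" by (rule psi_nonzero[OF z elim])
      have idx: "j * N + N = Suc j * N" by simp
      note tp = transfer_product_jpoly[where a = a and b = b and n = "j * N" and k = N and z = z, OF a jN, unfolded idx]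
      have "psi z (Suc j) = ?s * (?T j $ 1 $ 1 * ?p j + ?T j $ 1 $ 2 * ?p' j) + (?T j $ 2 $ 1 * ?p j + ?T j $ 2 $ 2 * ?p' j)"
        unfolding psi_def using tp by simp
      then have "of_real (A j) * (psi z (Suc j) - of_real \<epsilon> * psi z j) = of_real \<epsilon> * exponent z * psi z j + f j * ?p j + g j * ?p' j"
        unfolding f_def g_def by (simp add: psi_def algebra_simps)
      then have "of_real (A j) * ((psi z (Suc j) - of_real \<epsilon> * psi z j) / (of_real \<epsilon> * psi z j))
        = (of_real \<epsilon> * exponent z * psi z j + f j * ?p j + g j * ?p' j) / (of_real \<epsilon> * psi z j)" by simp
      also have "\<dots> = exponent z + of_real \<epsilon> * (f j * (?p j / psi z j) + g j * (?p' j / psi z j))"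
      proof -
        have ie: "1 / complex_of_real \<epsilon> = of_real \<epsilon>" using eps by auto
        have "x / (of_real \<epsilon> * psi z j) = 1 / of_real \<epsilon> * (x / psi z j)" for x by simp
        then have dv: "x / (of_real \<epsilon> * psi z j) = of_real \<epsilon> * (x / psi z j)" for x unfolding ie .
        have "(of_real \<epsilon> * exponent z * psi z j + f j * ?p j + g j * ?p' j) / psi z j =
          of_real \<epsilon> * exponent z + (f j * (?p j / psi z j) + g j * (?p' j / psi z j))"
          using nz by (simp add: add_divide_distrib)
        then show ?thesis unfolding dv by (simp only: distrib_left mult.assoc[symmetric] e(2) mult_1)
      qed
      finally show ?case using nz e(1) by (simp add: diff_divide_distrib)
    qed
  qed
qed

lemma ln_psi_tendsto:
  assumes z: "Im z > 0"
  shows "(\<lambda>j. ln (cmod (psi z j)) / tau (j * N)) \<longlonglongrightarrow> Re (exponent z) / (N * \<alpha> (N - 1))"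
proof -
  define w where "w j = of_real (A j) * (psi z (Suc j) / (of_real \<epsilon> * psi z j) - 1)" for j
  have w: "w \<longlonglongrightarrow> exponent z" unfolding w_def by (rule psi_growth_factor[OF z])
  have inc: "(\<lambda>j. A j * ln (cmod (1 + w j / of_real (A j)))) \<longlonglongrightarrow> Re (exponent z)"
    by (rule tendsto_scaled_ln_cmod[OF A_top w])
  have Np: "N * \<alpha> (N - 1) \<noteq> 0" using N \<alpha>[of "N - 1"] by simp
  have "(\<lambda>j. (A j * ln (cmod (1 + w j / of_real (A j)))) / (A j * (tau (Suc j * N) - tau (j * N))))
    \<longlonglongrightarrow> Re (exponent z) / (N * \<alpha> (N - 1))"
    by (rule tendsto_divide[OF inc tau_block_tendsto Np])
  then have "(\<lambda>j. (ln (cmod (psi z (Suc j))) - ln (cmod (psi z j))) / (tau (Suc j * N) - tau (j * N)))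
    \<longlonglongrightarrow> Re (exponent z) / (N * \<alpha> (N - 1))"
  proof (rule Lim_transform_eventually)
    show "eventually (\<lambda>j. (A j * ln (cmod (1 + w j / of_real (A j)))) / (A j * (tau (Suc j * N) - tau (j * N)))
      = (ln (cmod (psi z (Suc j))) - ln (cmod (psi z j))) / (tau (Suc j * N) - tau (j * N))) sequentially"
      using eventually_ge_at_top[of 1]
    proof eventually_elim
      case (elim j)
      have Aj: "A j \<noteq> 0" using a[of "j * N + N - 1"] by simp
      have nz: "psi z j \<noteq> 0" "psi z (Suc j) \<noteq> 0" using psi_nonzero[OF z] elim by auto
      have "1 + w j / of_real (A j) = psi z (Suc j) / (of_real \<epsilon> * psi z j)" using Aj by (simp add: w_def)
      then have "cmod (1 + w j / of_real (A j)) = cmod (psi z (Suc j)) / cmod (psi z j)"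
        using eps by (auto simp: norm_divide norm_mult)
      then show ?case using nz Aj by (simp add: ln_div)
    qed
  qed
  from LIMSEQ_Suc[OF this]
  have st: "(\<lambda>j. (ln (cmod (psi z (Suc (Suc j)))) - ln (cmod (psi z (Suc j)))) / (tau (Suc (Suc j) * N) - tau (Suc j * N)))
    \<longlonglongrightarrow> Re (exponent z) / (N * \<alpha> (N - 1))" .
  have smono: "strict_mono tau" by (rule strict_mono_Suc_iff[THEN iffD2]) (simp add: tau_strict)
  have "(\<lambda>j. ln (cmod (psi z (Suc j))) / tau (Suc j * N)) \<longlonglongrightarrow> Re (exponent z) / (N * \<alpha> (N - 1))"
  proof (rule tendsto_ratio_of_increments[OF _ _ st])
    fix j show "tau (Suc j * N) < tau (Suc (Suc j) * N)"
      using N by (intro strict_monoD[OF smono]) simp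
  next
    have "filterlim (\<lambda>j. tau (j * N)) at_top sequentially"
      using filterlim_compose[OF tau_top index_at_top[of 0]] by simp
    then show "filterlim (\<lambda>j. tau (Suc j * N)) at_top sequentially"
      by (rule filterlim_compose) (rule filterlim_Suc)
  qed
  then show ?thesis by (rule LIMSEQ_imp_Suc)
qed

end

section \<open>Convergence of the Poisson sums\<close>

context monodromy_limit
begin

text \<open>Comparing increments along a vertical line avoids comparing \<open>|p\<^bsub>jN\<^esub>|\<close> with \<open>|psi|\<close> at a single point: by \<open>log_mod_step\<close>
both components of \<open>(p\<^bsub>jN-1\<^esub>, p\<^bsub>jN\<^esub>)\<close> grow by the same factor from one point to the other, up to a constant.\<close>

lemma log_mod_psi_bounded:
  fixes x s t :: real
  defines "z \<equiv> \<lambda>t. Complex x (exp t)"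
  shows "\<exists>K. \<forall>j\<ge>1. \<bar>(log_mod a b (j * N) x t - log_mod a b (j * N) x s)
      - (ln (cmod (psi (z t) j)) - ln (cmod (psi (z s) j)))\<bar> \<le> K"
proof -
  have one: "\<exists>K. \<forall>j\<ge>1. (ln (cmod (psi (z t) j)) - ln (cmod (psi (z s) j)))
      - (log_mod a b (j * N) x t - log_mod a b (j * N) x s) \<le> K" for s t
  proof -
    have Im: "Im (z u) > 0" for u by (simp add: z_def)
    have zu: "Complex x (exp u) = z u" for u by (simp add: z_def)
    obtain C where C: "C > 0" "\<And>j. j \<ge> 1 \<Longrightarrow> cmod (P (j * N - 1) (z s)) \<le> C * cmod (psi (z s) j)"
      "\<And>j. j \<ge> 1 \<Longrightarrow> cmod (P (j * N) (z s)) \<le> C * cmod (psi (z s) j)" using psi_bounds[OF Im] by blast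
    (* By log_mod_step, the growth factors of neighbouring polynomials from s to t agree up to this factor. *)
    define E where "E = exp \<bar>t - s\<bar>"
    define B where "B = (cmod (slope (z t)) * E + 1) * C"
    have E: "E \<ge> 1" by (simp add: E_def)
    have B: "B > 0" unfolding B_def using C(1) E by (intro mult_pos_pos add_nonneg_pos) auto
    have "ln (cmod (psi (z t) j)) - ln (cmod (psi (z s) j))
      - (log_mod a b (j * N) x t - log_mod a b (j * N) x s) \<le> ln B" if j: "j \<ge> 1" for j
    proof -
      have Sj: "Suc (j * N - 1) = j * N" using j N by (simp add: Suc_le_eq)
      define m where "m = j * N - 1"
      have jN: "j * N = Suc m" using Sj by (simp add: m_def)
      have pos: "cmod (P n (z u)) > 0" for n u
        using jpoly_nonzero_upper[where a = a and b = b and n = n and z = "z u", OF a Im] by simp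
      have psi_pos: "cmod (psi (z u) j) > 0" for u using psi_nonzero[OF Im j] by simp
      define k where "k = cmod (P (Suc m) (z t)) / cmod (P (Suc m) (z s))"
      have k: "k > 0" unfolding k_def using pos by simp
      have lk: "ln k = log_mod a b (Suc m) x t - log_mod a b (Suc m) x s"
        unfolding k_def log_mod_def zu using pos by (simp add: ln_div)
      have lk': "ln (cmod (P m (z t)) / cmod (P m (z s))) = log_mod a b m x t - log_mod a b m x s"
        unfolding log_mod_def zu using pos by (simp add: ln_div)
      have "ln (cmod (P m (z t)) / cmod (P m (z s))) \<le> ln k + \<bar>t - s\<bar>"
        unfolding lk lk' using log_mod_step[where a = a and b = b and n = m and x = x and t = t and s = s, OF a] by linarith
      also have "\<dots> = ln (k * E)" using k by (simp add: E_def ln_mult)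
      finally have "cmod (P m (z t)) / cmod (P m (z s)) \<le> k * E"
        using pos k E by (subst (asm) ln_le_cancel_iff) auto
      then have q1: "cmod (P m (z t)) \<le> k * E * cmod (P m (z s))"
        using pos[of m s] by (simp add: field_simps)
      have q2: "cmod (P (Suc m) (z t)) = k * cmod (P (Suc m) (z s))"
        using pos[of "Suc m" s] by (simp add: k_def)
      have "cmod (psi (z t) j) \<le> cmod (slope (z t)) * cmod (P m (z t)) + cmod (P (Suc m) (z t))"
        unfolding psi_def jN diff_Suc_1 by (metis norm_mult norm_triangle_ineq)
      also have "\<dots> \<le> cmod (slope (z t)) * (k * E * cmod (P m (z s))) + k * cmod (P (Suc m) (z s))"
        unfolding q2 by (intro add_right_mono mult_left_mono q1) simp
      also have "\<dots> \<le> cmod (slope (z t)) * (k * E * (C * cmod (psi (z s) j))) + k * (C * cmod (psi (z s) j))"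
        using C(2)[OF j] C(3)[OF j] k E unfolding jN diff_Suc_1
        by (intro add_mono mult_left_mono) auto
      also have "\<dots> = (k * B) * cmod (psi (z s) j)" by (simp add: B_def algebra_simps)
      finally have "ln (cmod (psi (z t) j)) \<le> ln ((k * B) * cmod (psi (z s) j))"
        using psi_pos by (subst ln_le_cancel_iff) (auto simp: k B intro!: mult_pos_pos)
      also have "\<dots> = ln k + ln B + ln (cmod (psi (z s) j))"
        using k B psi_pos by (simp add: ln_mult_pos)
      finally show ?thesis unfolding lk jN by simp
    qed
    then show ?thesis by blast
  qed
  obtain K1 where K1: "\<And>j. j \<ge> 1 \<Longrightarrow> (ln (cmod (psi (z t) j)) - ln (cmod (psi (z s) j)))
      - (log_mod a b (j * N) x t - log_mod a b (j * N) x s) \<le> K1" using one[where s = s and t = t] by (elim exE) blast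
  obtain K2 where K2: "\<And>j. j \<ge> 1 \<Longrightarrow> (ln (cmod (psi (z s) j)) - ln (cmod (psi (z t) j)))
      - (log_mod a b (j * N) x s - log_mod a b (j * N) x t) \<le> K2" using one[where s = t and t = s] by (elim exE) blast
  have "\<bar>(log_mod a b (j * N) x t - log_mod a b (j * N) x s)
      - (ln (cmod (psi (z t) j)) - ln (cmod (psi (z s) j)))\<bar> \<le> max K1 K2" if "j \<ge> 1" for j
    using K1[OF that] K2[OF that] by linarith
  then show ?thesis by blast
qed

lemma log_mod_tendsto:
  "(\<lambda>n. (log_mod a b n x t - log_mod a b n x s) / tau n) \<longlonglongrightarrow>
    Re (sqrt_h (Complex x (exp t))) / (2 * N * \<alpha> (N - 1)) - Re (sqrt_h (Complex x (exp s))) / (2 * N * \<alpha> (N - 1))"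
    (is "_ \<longlonglongrightarrow> ?L")
proof -
  have "(\<lambda>n. inverse (a n)) \<longlonglongrightarrow> 0" by (rule tendsto_inverse_0_at_top[OF a_top])
  then obtain B where B: "\<And>n. \<bar>inverse (a n)\<bar> \<le> B" using convergent_imp_Bseq[of "\<lambda>n. inverse (a n)"]
    unfolding convergent_def Bseq_def by auto
  obtain C where C: "\<And>n. \<bar>\<alpha> n\<bar> \<le> C" using \<alpha>_bounds(1) by (elim exE) blast
  have tau_inc: "\<bar>tau (Suc n) - tau n\<bar> \<le> C * B" for n
  proof -
    have "\<bar>tau (Suc n) - tau n\<bar> = \<bar>\<alpha> n\<bar> * \<bar>inverse (a n)\<bar>"
      unfolding tau_def by (simp add: divide_inverse abs_mult)
    also have "\<dots> \<le> C * B" using B C[of 0] by (intro mult_mono C B) auto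
    finally show ?thesis .
  qed
  show ?thesis
  proof (rule tendsto_ratio_along_multiples[OF N tau_top _ tau_inc])
    fix n
    show "\<bar>(log_mod a b (Suc n) x t - log_mod a b (Suc n) x s) - (log_mod a b n x t - log_mod a b n x s)\<bar> \<le> \<bar>t - s\<bar>"
      by (rule log_mod_step[where a = a, OF a])
  next
    define z where "z = (\<lambda>t. Complex x (exp t))"
    have Im: "Im (z u) > 0" for u by (simp add: z_def)
    obtain K where K: "\<And>j. j \<ge> 1 \<Longrightarrow> \<bar>(log_mod a b (j * N) x t - log_mod a b (j * N) x s)
        - (ln (cmod (psi (z t) j)) - ln (cmod (psi (z s) j)))\<bar> \<le> K"
      using log_mod_psi_bounded[of x t s] unfolding z_def by (elim exE) auto
    have tj: "filterlim (\<lambda>j. tau (j * N)) at_top sequentially"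
      using filterlim_compose[OF tau_top index_at_top[of 0]] by simp
    have it: "(\<lambda>j. inverse (tau (j * N))) \<longlonglongrightarrow> 0" by (rule tendsto_inverse_0_at_top[OF tj])
    have "(\<lambda>j. ((log_mod a b (j * N) x t - log_mod a b (j * N) x s)
        - (ln (cmod (psi (z t) j)) - ln (cmod (psi (z s) j)))) * inverse (tau (j * N))) \<longlonglongrightarrow> 0"
    proof (rule tendsto_0_le[OF it, of _ K], use eventually_ge_at_top[of 1] in eventually_elim)
      fix j :: nat assume j: "1 \<le> j"
      show "norm (((log_mod a b (j * N) x t - log_mod a b (j * N) x s)
        - (ln (cmod (psi (z t) j)) - ln (cmod (psi (z s) j)))) * inverse (tau (j * N))) \<le> norm (inverse (tau (j * N))) * K"
        unfolding norm_mult real_norm_def using mult_right_mono[OF K[OF j], of "\<bar>inverse (tau (j * N))\<bar>"]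
        by (simp add: abs_mult mult.commute)
    qed
    from tendsto_add[OF this tendsto_diff[OF ln_psi_tendsto[OF Im[of t]] ln_psi_tendsto[OF Im[of s]]]]
    have "(\<lambda>j. (log_mod a b (j * N) x t - log_mod a b (j * N) x s) / tau (j * N)) \<longlonglongrightarrow>
      Re (exponent (z t)) / (N * \<alpha> (N - 1)) - Re (exponent (z s)) / (N * \<alpha> (N - 1))"
      unfolding divide_inverse left_diff_distrib by simp
    also have "Re (exponent (z t)) / (N * \<alpha> (N - 1)) - Re (exponent (z s)) / (N * \<alpha> (N - 1)) = ?L"
      by (simp add: exponent_def z_def diff_divide_distrib[symmetric])
    finally show "(\<lambda>j. (log_mod a b (j * N) x t - log_mod a b (j * N) x s) / tau (j * N)) \<longlonglongrightarrow> ?L" .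
  qed
qed

text \<open>Otherwise the principal square root of \<open>h(z)\<close> would be imaginary.\<close>

lemma h_not_nonpos: "Im z > 0 \<Longrightarrow> h_at z \<notin> \<real>\<^sub>\<le>\<^sub>0"
proof
  assume z: "Im z > 0" and h: "h_at z \<in> \<real>\<^sub>\<le>\<^sub>0"
  then have "Im (h_at z) = 0" "Re (h_at z) \<le> 0" by (auto simp: complex_nonpos_Reals_iff)
  then have "Re (sqrt_h z) = 0" unfolding sqrt_h_def by (subst csqrt_of_real_nonpos) auto
  then show False using sqrt_h_slope_pos(1)[OF z] by simp
qed

definition sqrt_h_deriv :: "complex \<Rightarrow> complex" where
  "sqrt_h_deriv z = poly (pderiv (map_poly complex_of_real hpoly)) z / (2 * sqrt_h z)"

lemma sqrt_h_has_derivative: "Im z > 0 \<Longrightarrow> (sqrt_h has_field_derivative sqrt_h_deriv z) (at z)"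
  unfolding sqrt_h_def[abs_def] sqrt_h_deriv_def
  by (auto intro!: derivative_eq_intros poly_DERIV h_not_nonpos simp: sqrt_h_def)

text \<open>Differentiating \<open>log_mod_tendsto\<close> in \<open>t\<close> at \<open>t = ln y\<close>.\<close>

lemma poisson_sum_tendsto:
  assumes y: "y > 0"
  shows "(\<lambda>n. poisson_sum (jacobi_zeros a b (Suc n)) x y / rho \<alpha> a n) \<longlonglongrightarrow>
    - Im (sqrt_h_deriv (Complex x y)) / (2 * N * \<alpha> (N - 1))"
proof -
  let ?c = "2 * N * \<alpha> (N - 1)"
  define t where "t = ln y"
  have yt: "exp t = y" using y by (simp add: t_def)
  have t0: "tau n \<ge> 0" for n using a \<alpha> unfolding tau_def
    by (intro sum_nonneg divide_nonneg_nonneg) (simp_all add: less_imp_le)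
  have dz: "((\<lambda>t. Complex x (exp t)) has_vector_derivative (\<i> * of_real (exp t))) (at t)" for t
  proof -
    have "((\<lambda>t. complex_of_real x + \<i> * of_real (exp t)) has_vector_derivative (0 + \<i> * of_real (exp t))) (at t)"
      by (intro has_vector_derivative_add has_vector_derivative_const has_vector_derivative_mult_right
          has_vector_derivative_of_real DERIV_exp)
    then show ?thesis by (simp add: Complex_eq)
  qed
  have L: "((\<lambda>t. Re (sqrt_h (Complex x (exp t))) / ?c) has_real_derivative
      (y * (- Im (sqrt_h_deriv (Complex x y)))) / ?c) (at t)"
  proof -
    have "((sqrt_h \<circ> (\<lambda>t. Complex x (exp t))) has_vector_derivative
        (\<i> * of_real (exp t)) * sqrt_h_deriv (Complex x (exp t))) (at t)"
      by (rule field_vector_diff_chain_at[OF dz sqrt_h_has_derivative]) simp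
    from bounded_linear.has_vector_derivative[OF bounded_linear_Re this]
    have "((\<lambda>t. Re (sqrt_h (Complex x (exp t)))) has_real_derivative
      Re ((\<i> * of_real (exp t)) * sqrt_h_deriv (Complex x (exp t)))) (at t)"
      by (simp add: has_real_derivative_iff_has_vector_derivative o_def)
    from DERIV_cdivide[OF this, of ?c] show ?thesis by (simp add: yt)
  qed
  have "(\<lambda>n. exp t * poisson_sum (jacobi_zeros a b n) x (exp t) / tau n) \<longlonglongrightarrow>
      (y * (- Im (sqrt_h_deriv (Complex x y)))) / ?c"
  proof (rule tendsto_derivs_of_convex[where F = "\<lambda>n t. log_mod a b n x t / tau n"
        and L = "\<lambda>t. Re (sqrt_h (Complex x (exp t))) / ?c", OF _ _ _ L])
    fix n t
    show "((\<lambda>t. log_mod a b n x t / tau n) has_real_derivative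
      exp t * poisson_sum (jacobi_zeros a b n) x (exp t) / tau n) (at t)"
      by (intro DERIV_cdivide has_derivative_log_mod a)
  next
    fix n and s t :: real assume "s \<le> t"
    then show "exp s * poisson_sum (jacobi_zeros a b n) x (exp s) / tau n
      \<le> exp t * poisson_sum (jacobi_zeros a b n) x (exp t) / tau n"
      by (intro divide_right_mono poisson_sum_scaled_mono t0)
  next
    fix s t
    show "(\<lambda>n. log_mod a b n x t / tau n - log_mod a b n x s / tau n) \<longlonglongrightarrow>
      Re (sqrt_h (Complex x (exp t))) / ?c - Re (sqrt_h (Complex x (exp s))) / ?c"
      using log_mod_tendsto[of x t s] by (simp add: diff_divide_distrib)
  qed
  from tendsto_mult[OF tendsto_const[of "1 / y"] LIMSEQ_Suc[OF this]] y
  show ?thesis unfolding rho_eq_tau yt by simp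
qed

end

section \<open>Stieltjes inversion\<close>

text \<open>For \<open>x\<close> in a bounded set the kernel at \<open>x + i y\<close> is dominated by the kernel at \<open>i\<close>, uniformly in \<open>s\<close>, once
the distance from \<open>x + i y\<close> to the mass \<open>s\<close> is bounded below.\<close>

lemma poisson_kernel_le:
  fixes x s y M d :: real
  assumes y: "y > 0" and x: "\<bar>x\<bar> \<le> M" and d: "d > 0" "d\<^sup>2 \<le> (x - s)\<^sup>2 + y\<^sup>2"
  shows "y / ((x - s)\<^sup>2 + y\<^sup>2) \<le> y * (2 + (1 + 2 * M\<^sup>2) / d\<^sup>2) * (1 / (s\<^sup>2 + 1))"
proof -
  let ?Q = "(x - s)\<^sup>2 + y\<^sup>2"
  have Q: "?Q > 0" using y by (simp add: add_nonneg_pos)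
  have "x\<^sup>2 \<le> M\<^sup>2" using x by (metis abs_le_square_iff abs_of_nonneg abs_ge_zero order_trans power2_abs)
  moreover have "s\<^sup>2 \<le> 2 * x\<^sup>2 + 2 * (x - s)\<^sup>2"
  proof -
    have "0 \<le> (2 * x - s)\<^sup>2" by simp
    then show ?thesis by (simp add: power2_eq_square algebra_simps)
  qed
  ultimately have "s\<^sup>2 + 1 \<le> 2 * (x - s)\<^sup>2 + (1 + 2 * M\<^sup>2)" by linarith
  also have "\<dots> \<le> 2 * ?Q + (1 + 2 * M\<^sup>2) / d\<^sup>2 * ?Q"
  proof (rule add_mono)
    have "(1 + 2 * M\<^sup>2) / d\<^sup>2 * d\<^sup>2 \<le> (1 + 2 * M\<^sup>2) / d\<^sup>2 * ?Q" using d by (intro mult_left_mono) auto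
    then show "1 + 2 * M\<^sup>2 \<le> (1 + 2 * M\<^sup>2) / d\<^sup>2 * ?Q" using d by simp
  qed simp
  also have "\<dots> = (2 + (1 + 2 * M\<^sup>2) / d\<^sup>2) * ?Q" by (simp add: distrib_right)
  finally have le: "s\<^sup>2 + 1 \<le> (2 + (1 + 2 * M\<^sup>2) / d\<^sup>2) * ?Q" .
  have s: "s\<^sup>2 + 1 > 0" by (simp add: add_nonneg_pos)
  have "y * (s\<^sup>2 + 1) \<le> y * ((2 + (1 + 2 * M\<^sup>2) / d\<^sup>2) * ?Q)" using y le by (intro mult_left_mono) auto
  then have "y / ?Q \<le> y * (2 + (1 + 2 * M\<^sup>2) / d\<^sup>2) / (s\<^sup>2 + 1)"
    using Q s by (subst pos_divide_le_eq[OF Q]) (simp add: pos_le_divide_eq mult_ac)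
  then show ?thesis by simp
qed

text \<open>A primitive in \<open>x\<close> of \<open>poisson_sum S x y\<close>.\<close>

definition arc_sum :: "real set \<Rightarrow> real \<Rightarrow> real \<Rightarrow> real" where
  "arc_sum S x y = (\<Sum>s\<in>S. arctan ((x - s) / y))"

lemma arctan_deriv:
  assumes y: "y > 0"
  shows "((\<lambda>x. arctan ((x - s) / y)) has_real_derivative y / ((x - s)\<^sup>2 + y\<^sup>2)) (at x)"
proof -
  have "((\<lambda>x. arctan ((x - s) / y)) has_real_derivative inverse (1 + ((x - s) / y)\<^sup>2) * (1 / y)) (at x)"
    using y by (auto intro!: derivative_eq_intros)
  moreover have "inverse (1 + ((x - s) / y)\<^sup>2) * (1 / y) = y / ((x - s)\<^sup>2 + y\<^sup>2)"
  proof -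
    have "1 + ((x - s) / y)\<^sup>2 = ((x - s)\<^sup>2 + y\<^sup>2) / y\<^sup>2" using y by (simp add: power_divide add_divide_distrib)
    then show ?thesis using y by (simp add: power2_eq_square)
  qed
  ultimately show ?thesis by simp
qed

lemma arc_sum_deriv: "y > 0 \<Longrightarrow> ((\<lambda>x. arc_sum S x y) has_real_derivative poisson_sum S x y) (at x)"
  unfolding arc_sum_def poisson_sum_def by (rule DERIV_sum) (rule arctan_deriv)

text \<open>Integrate the convergence of \<open>poisson_sum\<close> over \<open>[u, v]\<close>; all kernels are dominated by the one at the point \<open>i\<close>.\<close>

lemma arc_sum_tendsto:
  fixes S :: "nat \<Rightarrow> real set" and w :: "nat \<Rightarrow> real"
  assumes w: "\<And>n. w n > 0"
    and P: "\<And>x y. y > 0 \<Longrightarrow> (\<lambda>n. poisson_sum (S n) x y / w n) \<longlonglongrightarrow> P x y"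
    and V: "\<And>x y. y > 0 \<Longrightarrow> ((\<lambda>x. V x y) has_real_derivative P x y) (at x)"
    and y: "y > 0" and uv: "u \<le> v"
  shows "(\<lambda>n. (arc_sum (S n) v y - arc_sum (S n) u y) / w n) \<longlonglongrightarrow> V v y - V u y"
proof -
  have ftc: "((\<lambda>x. poisson_sum (S n) x y / w n) has_integral (arc_sum (S n) v y / w n - arc_sum (S n) u y / w n)) {u..v}" for n
    using uv y by (intro fundamental_theorem_of_calculus)
      (auto intro!: has_field_derivative_at_within DERIV_cdivide arc_sum_deriv simp: has_real_derivative_iff_has_vector_derivative[symmetric])
  have ftcP: "((\<lambda>x. P x y) has_integral (V v y - V u y)) {u..v}"
    using uv y by (intro fundamental_theorem_of_calculus)
      (auto intro!: has_field_derivative_at_within V simp: has_real_derivative_iff_has_vector_derivative[symmetric])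
  obtain B where B: "\<And>n. \<bar>poisson_sum (S n) 0 1 / w n\<bar> \<le> B"
    using convergent_imp_Bseq[of "\<lambda>n. poisson_sum (S n) 0 1 / w n"] P[of 1 0]
    unfolding convergent_def Bseq_def by auto
  define M where "M = max \<bar>u\<bar> \<bar>v\<bar>"
  define C where "C = y * (2 + (1 + 2 * M\<^sup>2) / y\<^sup>2)"
  have C: "C \<ge> 0" using y by (simp add: C_def)
  have dom: "norm (poisson_sum (S n) x y / w n) \<le> C * B" if x: "x \<in> {u..v}" for n x
  proof -
    have "poisson_sum (S n) x y \<le> C * poisson_sum (S n) 0 1"
      unfolding poisson_sum_def sum_distrib_left
    proof (rule sum_mono)
      fix s
      have "\<bar>x\<bar> \<le> M" using x by (auto simp: M_def)
      from poisson_kernel_le[OF y this y, of s]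
      show "y / ((x - s)\<^sup>2 + y\<^sup>2) \<le> C * (1 / ((0 - s)\<^sup>2 + 1\<^sup>2))" by (simp add: C_def)
    qed
    moreover have "0 \<le> poisson_sum (S n) x y" using y unfolding poisson_sum_def by (intro sum_nonneg) simp
    ultimately have "norm (poisson_sum (S n) x y / w n) \<le> C * (poisson_sum (S n) 0 1 / w n)"
      using w[of n] by (simp add: divide_right_mono)
    also have "\<dots> \<le> C * B" using B[of n] C by (intro mult_left_mono) linarith+
    finally show ?thesis .
  qed
  have "(\<lambda>n. integral {u..v} (\<lambda>x. poisson_sum (S n) x y / w n)) \<longlonglongrightarrow> integral {u..v} (\<lambda>x. P x y)"
  proof (rule dominated_convergence(2)[where h = "\<lambda>_. C * B"])
    show "(\<lambda>x. poisson_sum (S n) x y / w n) integrable_on {u..v}" for n using ftc by (rule has_integral_integrable)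
    show "(\<lambda>_. C * B) integrable_on {u..v}" by (rule integrable_const_ivl)
    show "(\<lambda>n. poisson_sum (S n) x y / w n) \<longlonglongrightarrow> P x y" for x by (rule P[OF y])
  qed (rule dom)
  moreover have eq: "integral {u..v} (\<lambda>x. poisson_sum (S n) x y / w n) = (arc_sum (S n) v y - arc_sum (S n) u y) / w n" for n
    using integral_unique[OF ftc] by (simp add: diff_divide_distrib)
  ultimately show ?thesis unfolding eq integral_unique[OF ftcP] by blast
qed

text \<open>For a mass in the interval, the increment of its arc tangent over the enlarged interval is at least
\<open>2 arctan (d / y)\<close>, which tends to \<open>\<pi>\<close> as \<open>y\<close> decreases to \<open>0\<close>.\<close>

lemma card_le_arc_sum:
  assumes fin: "finite S" and y: "y > 0" and d: "d > 0" and uv: "u \<le> v"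
  shows "real (card (S \<inter> {u<..v})) * (2 * arctan (d / y)) \<le> arc_sum S (v + d) y - arc_sum S (u - d) y"
proof -
  let ?K = "\<lambda>s. arctan ((v + d - s) / y) - arctan ((u - d - s) / y)"
  have K0: "?K s \<ge> 0" for s using y d uv by (simp add: divide_right_mono arctan_le_iff)
  have K1: "2 * arctan (d / y) \<le> ?K s" if "s \<in> {u<..v}" for s
  proof -
    have "arctan (d / y) \<le> arctan ((v + d - s) / y)" using that y by (simp add: arctan_le_iff divide_right_mono)
    moreover have "arctan ((u - d - s) / y) \<le> arctan (- d / y)" using that y by (subst arctan_le_iff) (intro divide_right_mono; simp)
    ultimately show ?thesis by (simp add: arctan_minus)
  qed
  have "real (card (S \<inter> {u<..v})) * (2 * arctan (d / y)) = (\<Sum>s\<in>S \<inter> {u<..v}. 2 * arctan (d / y))" by simp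
  also have "\<dots> \<le> (\<Sum>s\<in>S \<inter> {u<..v}. ?K s)" by (intro sum_mono K1) auto
  also have "\<dots> \<le> (\<Sum>s\<in>S. ?K s)" using fin K0 by (intro sum_mono2) auto
  finally show ?thesis by (simp add: arc_sum_def sum_subtractf)
qed

text \<open>Masses in the interval contribute at most \<open>\<pi>\<close>. A mass outside has distance at least \<open>d\<close> from the shrunk interval, and
contributes \<open>O(y)\<close> relative to the Poisson kernel at \<open>i\<close>.\<close>

lemma arc_sum_le_card:
  fixes d u v :: real
  assumes d: "d > 0" "u + d < v - d"
  obtains C where "C \<ge> 0" "\<And>S y. finite S \<Longrightarrow> y > 0 \<Longrightarrow>
    arc_sum S (v - d) y - arc_sum S (u + d) y \<le> pi * real (card (S \<inter> {u<..v})) + C * y * poisson_sum S 0 1"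
proof -
  define M where "M = max \<bar>u\<bar> \<bar>v\<bar>"
  define C where "C = (v - u) * (2 + (1 + 2 * M\<^sup>2) / d\<^sup>2)"
  have C0: "C \<ge> 0" using d by (simp add: C_def)
  have "arc_sum S (v - d) y - arc_sum S (u + d) y \<le> pi * real (card (S \<inter> {u<..v})) + C * y * poisson_sum S 0 1"
    if fin: "finite S" and y: "y > 0" for S y
  proof -
    let ?K = "\<lambda>s. arctan ((v - d - s) / y) - arctan ((u + d - s) / y)"
    have in1: "?K s \<le> pi" for s
      using arctan_ubound[of "(v - d - s) / y"] arctan_lbound[of "(u + d - s) / y"] by linarith
    have out: "?K s \<le> C * y * (1 / (s\<^sup>2 + 1))" if s: "s \<notin> {u<..v}" for s
    proof -
      obtain x where x: "u + d < x" "x < v - d"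
        "?K s = (v - d - (u + d)) * (y / ((x - s)\<^sup>2 + y\<^sup>2))"
        using MVT2[OF d(2), where f = "\<lambda>x. arctan ((x - s) / y)" and f' = "\<lambda>x. y / ((x - s)\<^sup>2 + y\<^sup>2)", OF arctan_deriv[OF y]]
        by blast
      have "d \<le> \<bar>x - s\<bar>" using x s by auto
      then have "d\<^sup>2 \<le> (x - s)\<^sup>2" using d(1) by (metis abs_le_square_iff abs_of_pos)
      then have "d\<^sup>2 \<le> (x - s)\<^sup>2 + y\<^sup>2" by (simp add: add_increasing2)
      moreover have "\<bar>x\<bar> \<le> M" using x d by (auto simp: M_def)
      ultimately have "y / ((x - s)\<^sup>2 + y\<^sup>2) \<le> y * (2 + (1 + 2 * M\<^sup>2) / d\<^sup>2) * (1 / (s\<^sup>2 + 1))"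
        using poisson_kernel_le[OF y _ d(1)] by blast
      then have "?K s \<le> (v - u) * (y * (2 + (1 + 2 * M\<^sup>2) / d\<^sup>2) * (1 / (s\<^sup>2 + 1)))"
        unfolding x(3) using d y by (intro mult_mono) auto
      then show ?thesis by (simp add: C_def mult_ac)
    qed
    have "(\<Sum>s\<in>S. ?K s) = (\<Sum>s\<in>S \<inter> {u<..v}. ?K s) + (\<Sum>s\<in>S - {u<..v}. ?K s)"
      using fin by (subst sum.Int_Diff[of S _ "{u<..v}"]) auto
    also have "\<dots> \<le> (\<Sum>s\<in>S \<inter> {u<..v}. pi) + (\<Sum>s\<in>S - {u<..v}. C * y * (1 / (s\<^sup>2 + 1)))"
      by (intro add_mono sum_mono in1 out) auto
    also have "(\<Sum>s\<in>S - {u<..v}. C * y * (1 / (s\<^sup>2 + 1))) \<le> (\<Sum>s\<in>S. C * y * (1 / (s\<^sup>2 + 1)))"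
      using fin C0 y by (intro sum_mono2) auto
    also have "\<dots> = C * y * poisson_sum S 0 1" by (simp add: poisson_sum_def sum_distrib_left)
    finally show ?thesis by (simp add: arc_sum_def sum_subtractf mult.commute)
  qed
  then show thesis using that[OF C0] by blast
qed

text \<open>Let \<open>n\<close> tend to infinity, then \<open>y\<close> to \<open>0\<close>, then the margin \<open>d\<close> to \<open>0\<close> in the two estimates before.\<close>

lemma stieltjes_inversion_counting:
  fixes S :: "nat \<Rightarrow> real set" and w :: "nat \<Rightarrow> real"
  assumes fin: "\<And>n. finite (S n)" and w: "\<And>n. w n > 0"
    and P: "\<And>x y. y > 0 \<Longrightarrow> (\<lambda>n. poisson_sum (S n) x y / w n) \<longlonglongrightarrow> P x y"
    and V: "\<And>x y. y > 0 \<Longrightarrow> ((\<lambda>x. V x y) has_real_derivative P x y) (at x)"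
    and lim: "\<And>x. ((\<lambda>y. V x y) \<longlongrightarrow> \<Phi> x) (at_right 0)"
    and cont: "\<And>x. isCont \<Phi> x"
    and uv: "u \<le> v"
  shows "(\<lambda>n. real (card (S n \<inter> {u<..v})) / w n) \<longlonglongrightarrow> (\<Phi> v - \<Phi> u) / pi"
proof (cases "u = v")
  case False
  with uv have uv': "u < v" by simp
  let ?L = "(\<Phi> v - \<Phi> u) / pi"
  have arcs: "(\<lambda>n. (arc_sum (S n) v' y - arc_sum (S n) u' y) / w n) \<longlonglongrightarrow> V v' y - V u' y"
    if "y > 0" "u' \<le> v'" for y u' v' by (rule arc_sum_tendsto[OF w P V that])
  have shift: "((\<lambda>d. \<Phi> (x + s * d)) \<longlongrightarrow> \<Phi> x) (at_right 0)" for x s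
  proof -
    have "((\<lambda>d. x + s * d) \<longlongrightarrow> x + s * 0) (at_right 0)" by (intro tendsto_intros)
    then show ?thesis using isCont_tendsto_compose[OF cont[of x]] by simp
  qed
  have pos: "eventually (\<lambda>y::real. y > 0) (at_right 0)" by (rule eventually_at_right_less)
  show ?thesis
  proof (rule order_tendstoI)
    fix c assume c: "?L < c"
    have "((\<lambda>d. (\<Phi> (v + 1 * d) - \<Phi> (u + (-1) * d)) / pi) \<longlongrightarrow> ?L) (at_right 0)"
      by (intro tendsto_intros shift) simp
    from eventually_happens[OF eventually_conj[OF pos order_tendstoD(2)[OF this c]]]
    obtain d where d: "d > 0" "(\<Phi> (v + d) - \<Phi> (u - d)) / pi < c" by auto
    have at: "filterlim (\<lambda>y. d / y) at_top (at_right 0)"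
      unfolding divide_inverse
      by (rule filterlim_tendsto_pos_mult_at_top[OF tendsto_const d(1) filterlim_inverse_at_top_right])
    have "((\<lambda>y. (V (v + d) y - V (u - d) y) / (2 * arctan (d / y))) \<longlongrightarrow> (\<Phi> (v + d) - \<Phi> (u - d)) / (2 * (pi / 2))) (at_right 0)"
      by (intro tendsto_intros lim filterlim_compose[OF tendsto_arctan_at_top at]) simp
    then have "((\<lambda>y. (V (v + d) y - V (u - d) y) / (2 * arctan (d / y))) \<longlongrightarrow> (\<Phi> (v + d) - \<Phi> (u - d)) / pi) (at_right 0)"
      by simp
    from eventually_happens[OF eventually_conj[OF pos order_tendstoD(2)[OF this d(2)]]]
    obtain y where y: "y > 0" "(V (v + d) y - V (u - d) y) / (2 * arctan (d / y)) < c" by auto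
    have at0: "arctan (d / y) > 0" using d(1) y(1) by simp
    have "(\<lambda>n. (arc_sum (S n) (v + d) y - arc_sum (S n) (u - d) y) / w n / (2 * arctan (d / y))) \<longlonglongrightarrow>
      (V (v + d) y - V (u - d) y) / (2 * arctan (d / y))"
      using at0 d(1) uv by (intro tendsto_divide tendsto_const arcs y(1)) auto
    from order_tendstoD(2)[OF this y(2)]
    show "eventually (\<lambda>n. real (card (S n \<inter> {u<..v})) / w n < c) sequentially"
    proof eventually_elim
      case (elim n)
      have "real (card (S n \<inter> {u<..v})) \<le> (arc_sum (S n) (v + d) y - arc_sum (S n) (u - d) y) / (2 * arctan (d / y))"
        using card_le_arc_sum[OF fin y(1) d(1) uv, of n] at0 by (simp add: pos_le_divide_eq)
      then have "real (card (S n \<inter> {u<..v})) / w n \<le> (arc_sum (S n) (v + d) y - arc_sum (S n) (u - d) y) / (2 * arctan (d / y)) / w n"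
        using w[of n] by (intro divide_right_mono) auto
      also have "\<dots> = (arc_sum (S n) (v + d) y - arc_sum (S n) (u - d) y) / w n / (2 * arctan (d / y))"
        by (simp add: mult.commute)
      finally show ?case using elim by simp
    qed
  next
    fix c assume c: "c < ?L"
    have "((\<lambda>d. (\<Phi> (v + (-1) * d) - \<Phi> (u + 1 * d)) / pi) \<longlongrightarrow> ?L) (at_right 0)"
      by (intro tendsto_intros shift) simp
    note ev = order_tendstoD(1)[OF this c]
    have "eventually (\<lambda>d. d < (v - u) / 2) (at_right 0)"
      by (rule order_tendstoD(2)[OF tendsto_ident_at]) (use uv' in simp)
    from eventually_happens[OF eventually_conj[OF pos eventually_conj[OF this ev]]]
    obtain d where d: "d > 0" "d < (v - u) / 2" "c < (\<Phi> (v - d) - \<Phi> (u + d)) / pi" by auto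
    have ud: "u + d < v - d" using d(2) by (simp add: field_simps)
    obtain C where C: "C \<ge> 0" "\<And>S y. finite S \<Longrightarrow> y > 0 \<Longrightarrow>
      arc_sum S (v - d) y - arc_sum S (u + d) y \<le> pi * real (card (S \<inter> {u<..v})) + C * y * poisson_sum S 0 1"
      using arc_sum_le_card[OF d(1) ud] by blast
    have "((\<lambda>y. (V (v - d) y - V (u + d) y - C * y * P 0 1) / pi) \<longlongrightarrow> (\<Phi> (v - d) - \<Phi> (u + d) - C * 0 * P 0 1) / pi) (at_right 0)"
      by (intro tendsto_intros lim) simp
    then have "((\<lambda>y. (V (v - d) y - V (u + d) y - C * y * P 0 1) / pi) \<longlongrightarrow> (\<Phi> (v - d) - \<Phi> (u + d)) / pi) (at_right 0)"
      by simp
    from eventually_happens[OF eventually_conj[OF pos order_tendstoD(1)[OF this d(3)]]]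
    obtain y where y: "y > 0" "c < (V (v - d) y - V (u + d) y - C * y * P 0 1) / pi" by auto
    have "(\<lambda>n. ((arc_sum (S n) (v - d) y - arc_sum (S n) (u + d) y) / w n - C * y * (poisson_sum (S n) 0 1 / w n)) / pi) \<longlonglongrightarrow>
      (V (v - d) y - V (u + d) y - C * y * P 0 1) / pi"
      using ud by (intro tendsto_intros arcs P y(1)) auto
    from order_tendstoD(1)[OF this y(2)]
    show "eventually (\<lambda>n. c < real (card (S n \<inter> {u<..v})) / w n) sequentially"
    proof eventually_elim
      case (elim n)
      have "((arc_sum (S n) (v - d) y - arc_sum (S n) (u + d) y) - C * y * poisson_sum (S n) 0 1) / w n
        \<le> (pi * real (card (S n \<inter> {u<..v}))) / w n"
        using C(2)[OF fin y(1), of n] w[of n] by (intro divide_right_mono) auto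
      then have "((arc_sum (S n) (v - d) y - arc_sum (S n) (u + d) y) / w n - C * y * (poisson_sum (S n) 0 1 / w n)) / pi
        \<le> (pi * (real (card (S n \<inter> {u<..v})) / w n)) / pi"
        by (intro divide_right_mono) (simp_all add: diff_divide_distrib)
      then show ?case using elim by simp
    qed
  qed
qed simp

section \<open>From counting functions to continuous test functions\<close>

text \<open>The function \<open>f\<close> varies by at most \<open>e\<close> on each cell of the partition \<open>t\<close>.\<close>

lemma step_integral_error:
  fixes f :: "real \<Rightarrow> complex" and t :: "nat \<Rightarrow> real"
  assumes sets: "sets M = sets borel" and fin: "\<And>u v. emeasure M {u<..v} < \<infinity>"
    and f: "continuous_on UNIV f" and mono: "\<And>i. t i \<le> t (Suc i)"
    and osc: "\<And>i x. i < m \<Longrightarrow> t i \<le> x \<Longrightarrow> x \<le> t (Suc i) \<Longrightarrow> norm (f x - f (t i)) \<le> e"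
  shows "norm ((\<integral>x\<in>{t 0<..t m}. f x \<partial>M) - (\<Sum>i<m. measure M {t i<..t (Suc i)} *\<^sub>R f (t i)))
    \<le> e * measure M {t 0<..t m}"
  using osc
proof (induction m)
  case (Suc m)
  have I: "{u<..v} \<in> sets M" for u v :: real by (simp add: sets)
  have fm: "f \<in> borel_measurable M" using borel_measurable_continuous_onI[OF f] by (simp add: measurable_cong_sets[OF sets refl])
  have fin': "emeasure M {u<..v} \<noteq> \<infinity>" for u v using fin[of u v] by simp
  have si: "set_integrable M {u<..v} f" for u v
  proof -
    have "compact (f ` {u..v})" by (intro compact_continuous_image continuous_on_subset[OF f]) auto
    then obtain B where B: "\<And>x. x \<in> {u..v} \<Longrightarrow> norm (f x) \<le> B" by (meson bounded_iff compact_imp_bounded imageI)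
    show ?thesis unfolding set_integrable_def
    proof (rule Bochner_Integration.integrable_bound)
      show "integrable M (\<lambda>x. indicator {u<..v} x * max B 0)"
        using I fin[of u v] by (intro integrable_mult_left integrable_real_indicator) auto
      show "(\<lambda>x. indicator {u<..v} x *\<^sub>R f x) \<in> borel_measurable M"
        using fm I by (intro borel_measurable_scaleR borel_measurable_indicator)
      show "AE x in M. norm (indicator {u<..v} x *\<^sub>R f x) \<le> norm (indicator {u<..v} x * max B 0)"
      proof (intro AE_I2)
        fix x show "norm (indicator {u<..v} x *\<^sub>R f x) \<le> norm (indicator {u<..v} x * max B 0)"
          using B[of x] by (cases "x \<in> {u<..v}") (simp_all add: le_max_iff_disj)
      qed
    qed
  qed
  have t0: "t 0 \<le> t m" by (rule lift_Suc_mono_le[of t, OF mono]) simp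
  have un: "{t 0<..t (Suc m)} = {t 0<..t m} \<union> {t m<..t (Suc m)}" using t0 mono[of m] by auto
  have h_level: "{t 0<..t m} \<inter> {t m<..t (Suc m)} = {}" by auto
  have spl: "(\<integral>x\<in>{t 0<..t (Suc m)}. f x \<partial>M) = (\<integral>x\<in>{t 0<..t m}. f x \<partial>M) + (\<integral>x\<in>{t m<..t (Suc m)}. f x \<partial>M)"
    unfolding un by (rule set_integral_Un[OF h_level si si])
  have mspl: "measure M {t 0<..t (Suc m)} = measure M {t 0<..t m} + measure M {t m<..t (Suc m)}"
    unfolding un using I fin' h_level by (intro measure_Union)
  have "(\<integral>x\<in>{t m<..t (Suc m)}. f x \<partial>M) - measure M {t m<..t (Suc m)} *\<^sub>R f (t m) = (\<integral>x\<in>{t m<..t (Suc m)}. f x - f (t m) \<partial>M)"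
  proof -
    have c: "set_integrable M {t m<..t (Suc m)} (\<lambda>_. f (t m))"
      unfolding set_integrable_def using I fin' by (intro integrable_scaleR_left integrable_real_indicator) (auto simp: less_top)
    have "(\<integral>x\<in>{t m<..t (Suc m)}. f (t m) \<partial>M) = measure M {t m<..t (Suc m)} *\<^sub>R f (t m)"
      using I fin' by (simp add: set_integral_const)
    then show ?thesis using set_integral_diff(2)[OF si c] by simp
  qed
  also have "norm \<dots> \<le> (\<integral>x\<in>{t m<..t (Suc m)}. e \<partial>M)"
  proof -
    have "norm (\<integral>x\<in>{t m<..t (Suc m)}. f x - f (t m) \<partial>M) \<le> (\<integral>x. norm (indicator {t m<..t (Suc m)} x *\<^sub>R (f x - f (t m))) \<partial>M)"
      unfolding set_lebesgue_integral_def by (rule integral_norm_bound)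
    also have "\<dots> \<le> (\<integral>x. indicator {t m<..t (Suc m)} x *\<^sub>R e \<partial>M)"
    proof (rule integral_mono')
      show "integrable M (\<lambda>x. indicator {t m<..t (Suc m)} x *\<^sub>R e)"
        using I fin' by (intro integrable_scaleR_left integrable_real_indicator) (auto simp: less_top)
      have "0 \<le> e" using order_trans[OF norm_ge_zero Suc.prems[of m "t m"]] mono by simp
      then show "0 \<le> indicator {t m<..t (Suc m)} x *\<^sub>R e" for x by simp
      show "norm (indicator {t m<..t (Suc m)} x *\<^sub>R (f x - f (t m))) \<le> indicator {t m<..t (Suc m)} x *\<^sub>R e" for x
        using Suc.prems[of m x] by (auto simp: indicator_def)
    qed
    finally show ?thesis unfolding set_lebesgue_integral_def .
  qed
  also have "\<dots> = e * measure M {t m<..t (Suc m)}" using I fin' by (simp add: set_integral_const mult.commute)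
  finally have last: "norm ((\<integral>x\<in>{t m<..t (Suc m)}. f x \<partial>M) - measure M {t m<..t (Suc m)} *\<^sub>R f (t m)) \<le> e * measure M {t m<..t (Suc m)}" .
  have "norm ((\<integral>x\<in>{t 0<..t m}. f x \<partial>M) - (\<Sum>i<m. measure M {t i<..t (Suc i)} *\<^sub>R f (t i))) \<le> e * measure M {t 0<..t m}"
    by (rule Suc.IH) (simp add: Suc.prems)
  from norm_triangle_mono[OF this last] show ?case unfolding spl mspl by (simp add: algebra_simps)
qed (simp add: set_lebesgue_integral_def)

text \<open>Step functions on a fine partition approximate \<open>f\<close> for the measures \<open>M n\<close> and for \<open>L\<close> alike.\<close>

lemma tendsto_interval_integral_of_interval_measures:
  fixes f :: "real \<Rightarrow> complex"
  assumes sets: "\<And>n. sets (M n) = sets borel" "sets L = sets borel"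
    and fin: "\<And>n u v. emeasure (M n) {u<..v} < \<infinity>" "\<And>u v. emeasure L {u<..v} < \<infinity>"
    and w: "\<And>n. w n > 0"
    and lim: "\<And>u v. u \<le> v \<Longrightarrow> (\<lambda>n. measure (M n) {u<..v} / w n) \<longlonglongrightarrow> measure L {u<..v}"
    and f: "continuous_on UNIV f" and lr: "l \<le> r"
  shows "(\<lambda>n. (\<integral>x\<in>{l<..r}. f x \<partial>M n) /\<^sub>R w n) \<longlonglongrightarrow> (\<integral>x\<in>{l<..r}. f x \<partial>L)"
proof (rule tendstoI)
  fix e :: real assume e: "e > 0"
  (* An eventual bound for the normalized measures of the whole interval. *)
  define B where "B = measure L {l<..r} + 1"
  have B: "B > 0" by (simp add: B_def add_nonneg_pos)
  define e' where "e' = e / (4 * B)"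
  have e': "e' > 0" using e B by (simp add: e'_def)
  have "uniformly_continuous_on {l..r} f"
    by (intro compact_uniformly_continuous continuous_on_subset[OF f]) auto
  then obtain d where d: "d > 0" "\<And>x x'. x \<in> {l..r} \<Longrightarrow> x' \<in> {l..r} \<Longrightarrow> dist x' x < d \<Longrightarrow> dist (f x') (f x) < e'"
    using e' unfolding uniformly_continuous_on_def by blast
  obtain m :: nat where m: "m > 0" "(r - l) / m < d"
  proof -
    obtain m :: nat where "(r - l) / d < m" using reals_Archimedean2 by blast
    then have "(r - l) / d < Suc m" by simp
    then have "(r - l) / Suc m < d" using d(1) by (simp add: field_simps)
    then show thesis by (intro that[of "Suc m"]) auto
  qed
  define t where "t i = l + real i * ((r - l) / m)" for i
  have tm: "t 0 = l" "t m = r" using m by (auto simp: t_def)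
  have tS: "t (Suc i) = t i + (r - l) / m" for i unfolding t_def of_nat_Suc by (simp only: distrib_right mult_1 add_ac)
  have mono: "t i \<le> t (Suc i)" for i unfolding tS using lr by simp
  have tle: "t i \<le> t k" if "i \<le> k" for i k by (rule lift_Suc_mono_le[of t, OF mono that])
  have osc: "norm (f x - f (t i)) \<le> e'" if "i < m" "t i \<le> x" "x \<le> t (Suc i)" for i x
  proof -
    have "l \<le> t i" "t (Suc i) \<le> r" using tle[of 0 i] tle[of "Suc i" m] that tm by auto
    then have "dist (f x) (f (t i)) < e'" using that m(2) tS[of i] by (intro d(2)) (auto simp: dist_real_def)
    then show ?thesis by (simp add: dist_norm)
  qed
  let ?st = "\<lambda>M. \<Sum>i<m. measure M {t i<..t (Suc i)} *\<^sub>R f (t i)"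
  have errM: "norm ((\<integral>x\<in>{l<..r}. f x \<partial>M n) - ?st (M n)) \<le> e' * measure (M n) {l<..r}" for n
    using step_integral_error[where M = "M n" and t = t and m = m and e = e' and f = f, OF sets(1) fin(1) f mono osc] unfolding tm by blast
  have errL: "norm ((\<integral>x\<in>{l<..r}. f x \<partial>L) - ?st L) \<le> e' * measure L {l<..r}"
    using step_integral_error[where M = L and t = t and m = m and e = e' and f = f, OF sets(2) fin(2) f mono osc] unfolding tm by blast
  have "(\<lambda>n. \<Sum>i<m. (measure (M n) {t i<..t (Suc i)} / w n) *\<^sub>R f (t i)) \<longlonglongrightarrow> ?st L"
    by (intro tendsto_intros lim mono)
  then have "eventually (\<lambda>n. dist (\<Sum>i<m. (measure (M n) {t i<..t (Suc i)} / w n) *\<^sub>R f (t i)) (?st L) < e / 4) sequentially"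
    using e by (intro tendstoD) auto
  moreover have "eventually (\<lambda>n. measure (M n) {l<..r} / w n < B) sequentially"
    by (rule order_tendstoD(2)[OF lim[OF lr]]) (simp add: B_def)
  ultimately show "eventually (\<lambda>n. dist ((\<integral>x\<in>{l<..r}. f x \<partial>M n) /\<^sub>R w n) (\<integral>x\<in>{l<..r}. f x \<partial>L) < e) sequentially"
  proof eventually_elim
    case (elim n)
    let ?a = "\<integral>x\<in>{l<..r}. f x \<partial>M n" and ?b = "\<integral>x\<in>{l<..r}. f x \<partial>L"
    have st: "(\<Sum>i<m. (measure (M n) {t i<..t (Suc i)} / w n) *\<^sub>R f (t i)) = ?st (M n) /\<^sub>R w n"
      by (simp add: scaleR_sum_right divide_inverse mult.commute)
    have "norm (?a /\<^sub>R w n - ?st (M n) /\<^sub>R w n) = norm (?a - ?st (M n)) / w n"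
      using w[of n] by (simp add: scaleR_diff_right[symmetric] divide_inverse mult.commute)
    also have "\<dots> \<le> e' * measure (M n) {l<..r} / w n" using errM[of n] w[of n] by (intro divide_right_mono) auto
    also have "\<dots> \<le> e' * B" using elim(2) e' by (simp add: mult_left_mono less_imp_le flip: times_divide_eq_right)
    also have "\<dots> = e / 4" using B by (simp add: e'_def)
    finally have 1: "norm (?a /\<^sub>R w n - ?st (M n) /\<^sub>R w n) \<le> e / 4" .
    have "e' * measure L {l<..r} \<le> e' * B" using e' by (intro mult_left_mono) (auto simp: B_def)
    also have "\<dots> = e / 4" using B by (simp add: e'_def)
    finally have 2: "norm (?b - ?st L) \<le> e / 4" using errL by linarith
    have 3: "norm (?st (M n) /\<^sub>R w n - ?st L) < e / 4" using elim(1) unfolding st dist_norm .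
    have "?a /\<^sub>R w n - ?b = (?a /\<^sub>R w n - ?st (M n) /\<^sub>R w n) + (?st (M n) /\<^sub>R w n - ?st L) - (?b - ?st L)" by simp
    then have "norm (?a /\<^sub>R w n - ?b) \<le> norm (?a /\<^sub>R w n - ?st (M n) /\<^sub>R w n) + norm (?st (M n) /\<^sub>R w n - ?st L) + norm (?b - ?st L)"
      by (simp only:) (rule order_trans[OF norm_triangle_ineq4 add_right_mono[OF norm_triangle_ineq]])
    then show ?case unfolding dist_norm using 1 2 3 e by linarith
  qed
qed

text \<open>On a bounded interval this is the convergence of interval measures. Outside \<open>(c - k, c + k]\<close> the decay of \<open>f\<close> gives
\<open>|f(s)| \<le> (C / k) \<cdot> k / ((c - s)\<^sup>2 + k\<^sup>2)\<close>, so the remaining masses contribute at most \<open>C / k\<close> times the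
Poisson sum at \<open>c + i k\<close>, which stays bounded. Integrability of \<open>f\<close> follows by monotone convergence
from the uniform bound for \<open>|f|\<close> on bounded intervals.\<close>

lemma weak_convergence_of_poisson_sums:
  fixes S :: "nat \<Rightarrow> real set" and w :: "nat \<Rightarrow> real" and f :: "real \<Rightarrow> complex"
  assumes S: "\<And>n. finite (S n)" and w: "\<And>n. w n > 0"
    and P: "\<And>x y. y > 0 \<Longrightarrow> (\<lambda>n. poisson_sum (S n) x y / w n) \<longlonglongrightarrow> P x y"
    and bound: "\<And>y. y > 0 \<Longrightarrow> P c y \<le> B"
    and L: "sets L = sets borel" "\<And>u v. emeasure L {u<..v} < \<infinity>"
    and count: "\<And>u v. u \<le> v \<Longrightarrow> (\<lambda>n. real (card (S n \<inter> {u<..v})) / w n) \<longlonglongrightarrow> measure L {u<..v}"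
    and f: "continuous_on UNIV f" and decay: "\<And>x. (1 + x\<^sup>2) * norm (f x) \<le> K"
  shows "integrable L f" "(\<lambda>n. (\<Sum>s\<in>S n. f s) /\<^sub>R w n) \<longlonglongrightarrow> (\<integral>x. f x \<partial>L)"
proof -
  define M where "M n = distr (count_space (S n)) borel (\<lambda>x. x)" for n
  have sM: "sets (M n) = sets borel" for n by (simp add: M_def)
  have eM: "emeasure (M n) {u<..v} = of_nat (card (S n \<inter> {u<..v}))" for n u v
    unfolding M_def using S[of n] by (subst emeasure_distr) (auto simp: emeasure_count_space Int_commute)
  have mM: "measure (M n) {u<..v} = real (card (S n \<inter> {u<..v}))" for n u v
    by (simp add: measure_def eM)
  have iM: "(\<integral>x\<in>{u<..v}. g x \<partial>M n) = (\<Sum>s\<in>S n \<inter> {u<..v}. g s)" if "continuous_on UNIV g" for g :: "real \<Rightarrow> complex" and n u v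
  proof -
    have gm: "g \<in> borel_measurable borel" using borel_measurable_continuous_onI[OF that] .
    have "(\<integral>x\<in>{u<..v}. g x \<partial>M n) = (\<Sum>s\<in>S n. indicator {u<..v} s *\<^sub>R g s)"
      unfolding M_def set_lebesgue_integral_def using S[of n] gm
      by (subst integral_distr) (simp_all add: lebesgue_integral_count_space_finite)
    also have "\<dots> = (\<Sum>s\<in>S n \<inter> {u<..v}. g s)"
      using S[of n] by (subst sum.inter_restrict) (auto intro!: sum.cong simp: indicator_def)
    finally show ?thesis .
  qed
  have conv: "(\<lambda>n. (\<Sum>s\<in>S n \<inter> {u<..v}. g s) /\<^sub>R w n) \<longlonglongrightarrow> (\<integral>x\<in>{u<..v}. g x \<partial>L)"
    if g: "continuous_on UNIV g" and "u \<le> v" for g :: "real \<Rightarrow> complex" and u v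
  proof -
    have fin: "emeasure (M n) {u<..v} < \<infinity>" for n u v by (simp add: eM of_nat_less_top)
    have "(\<lambda>n. measure (M n) {u<..v} / w n) \<longlonglongrightarrow> measure L {u<..v}" if "u \<le> v" for u v
      unfolding mM by (rule count[OF that])
    from tendsto_interval_integral_of_interval_measures[where M = M and L = L and w = w, OF sM L(1) fin L(2) w this g \<open>u \<le> v\<close>]
    show ?thesis unfolding iM[OF g] .
  qed
  have fm: "f \<in> borel_measurable L" using borel_measurable_continuous_onI[OF f] by (simp add: measurable_cong_sets[OF L(1) refl])
  have fnm: "(\<lambda>x. norm (f x)) \<in> borel_measurable L" using fm by measurable
  have I: "{u<..v} \<in> sets L" for u v :: real by (simp add: L(1))
  have one: "norm (f s) \<le> K * (1 / ((0 - s)\<^sup>2 + 1\<^sup>2))" for s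
  proof -
    have "1 + s\<^sup>2 > 0" by (simp add: add_pos_nonneg)
    then show ?thesis using decay[of s] by (simp add: field_simps)
  qed
  have K0: "K \<ge> 0" using order_trans[OF _ decay[of 0]] by simp
  let ?nf = "\<lambda>x. complex_of_real (norm (f x))"
  have nfc: "continuous_on UNIV ?nf" by (intro continuous_intros f)
  have si: "set_integrable L {u<..v} (\<lambda>x. norm (f x))" for u v
    unfolding set_integrable_def
  proof (rule Bochner_Integration.integrable_bound)
    show "integrable L (\<lambda>x. indicator {u<..v} x * K)"
      using I L(2)[of u v] by (intro integrable_mult_left integrable_real_indicator) auto
    show "(\<lambda>x. indicator {u<..v} x *\<^sub>R norm (f x)) \<in> borel_measurable L"
      by (intro borel_measurable_scaleR borel_measurable_indicator fnm I)
    show "AE x in L. norm (indicator {u<..v} x *\<^sub>R norm (f x)) \<le> norm (indicator {u<..v} x * K)"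
    proof (intro AE_I2)
      fix x
      have "norm (f x) \<le> (1 + x\<^sup>2) * norm (f x)" by (simp add: distrib_right)
      then have "norm (f x) \<le> K" using decay[of x] by linarith
      then show "norm (indicator {u<..v} x *\<^sub>R norm (f x)) \<le> norm (indicator {u<..v} x * K)"
        using K0 by (simp add: indicator_def)
    qed
  qed
  have mass: "(\<integral>x\<in>{u<..v}. norm (f x) \<partial>L) \<le> K * P 0 1" if uv: "u \<le> v" for u v
  proof -
    have re: "Re (\<integral>x\<in>{u<..v}. ?nf x \<partial>L) = (\<integral>x\<in>{u<..v}. norm (f x) \<partial>L)"
      using set_integral_complex_of_real[of L "{u<..v}" "\<lambda>x. norm (f x)"] by simp
    have "(\<lambda>n. Re ((\<Sum>s\<in>S n \<inter> {u<..v}. ?nf s) /\<^sub>R w n)) \<longlonglongrightarrow> (\<integral>x\<in>{u<..v}. norm (f x) \<partial>L)"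
      using tendsto_Re[OF conv[OF nfc uv]] unfolding re .
    moreover have "(\<lambda>n. K * (poisson_sum (S n) 0 1 / w n)) \<longlonglongrightarrow> K * P 0 1" by (intro tendsto_intros P) simp
    moreover have "Re ((\<Sum>s\<in>S n \<inter> {u<..v}. ?nf s) /\<^sub>R w n) \<le> K * (poisson_sum (S n) 0 1 / w n)" for n
    proof -
      have "(\<Sum>s\<in>S n \<inter> {u<..v}. norm (f s)) \<le> (\<Sum>s\<in>S n. norm (f s))" using S by (intro sum_mono2) auto
      also have "\<dots> \<le> (\<Sum>s\<in>S n. K * (1 / ((0 - s)\<^sup>2 + 1\<^sup>2)))" by (intro sum_mono one)
      also have "\<dots> = K * poisson_sum (S n) 0 1" by (simp add: poisson_sum_def sum_distrib_left)
      finally have "(\<Sum>s\<in>S n \<inter> {u<..v}. norm (f s)) / w n \<le> K * poisson_sum (S n) 0 1 / w n"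
        using w[of n] by (intro divide_right_mono) auto
      then show ?thesis by (simp add: divide_inverse mult_ac)
    qed
    ultimately show ?thesis by (intro LIMSEQ_le[where X = "\<lambda>n. Re ((\<Sum>s\<in>S n \<inter> {u<..v}. ?nf s) /\<^sub>R w n)"]) auto
  qed
  (* Bounded intervals that exhaust the line. *)
  define J where "J k = {c - real k<..c + real k}" for k :: nat
  have Jmono: "J k \<subseteq> J (Suc k)" for k by (auto simp: J_def)
  have Jlim: "(\<lambda>k. indicator (J k) x :: real) \<longlonglongrightarrow> 1" for x
  proof -
    (* Every point lies in all sufficiently large intervals. *)
    obtain k0 :: nat where "\<bar>x - c\<bar> < k0" using reals_Archimedean2 by blast
    then have "x \<in> J k" if "k \<ge> k0" for k
      using of_nat_mono[OF that, where 'a = real] unfolding J_def by (auto simp: abs_less_iff)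
    then have "eventually (\<lambda>k. indicator (J k) x = (1::real)) sequentially"
      unfolding eventually_sequentially by (intro exI[of _ k0]) simp
    then show ?thesis by (rule tendsto_eventually)
  qed
  have int_norm: "integrable L (\<lambda>x. norm (f x))"
  proof -
    define m where "m k = (\<integral>x\<in>J k. norm (f x) \<partial>L)" for k
    have "incseq m" unfolding m_def set_lebesgue_integral_def
    proof (intro incseq_SucI integral_mono)
      fix k and x
      show "integrable L (\<lambda>x. indicator (J k) x *\<^sub>R norm (f x))" "integrable L (\<lambda>x. indicator (J (Suc k)) x *\<^sub>R norm (f x))"
        using si unfolding set_integrable_def J_def by auto
      show "indicator (J k) x *\<^sub>R norm (f x) \<le> indicator (J (Suc k)) x *\<^sub>R norm (f x)"
        using Jmono[of k] by (auto simp: indicator_def)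
    qed
    moreover have "m k \<le> K * P 0 1" for k unfolding m_def J_def by (rule mass) simp
    ultimately obtain l where "m \<longlonglongrightarrow> l" using incseq_convergent[of m "K * P 0 1"] by blast
    then show ?thesis unfolding m_def set_lebesgue_integral_def
    proof (rule integrable_monotone_convergence[rotated 3])
      show "integrable L (\<lambda>x. indicator (J k) x *\<^sub>R norm (f x))" for k
        using si unfolding set_integrable_def J_def by auto
      show "AE x in L. mono (\<lambda>k. indicator (J k) x *\<^sub>R norm (f x))"
        using Jmono by (intro AE_I2 incseq_SucI) (auto simp: indicator_def)
      show "AE x in L. (\<lambda>k. indicator (J k) x *\<^sub>R norm (f x)) \<longlonglongrightarrow> norm (f x)"
        by (intro AE_I2 tendsto_scaleR[OF Jlim tendsto_const, unfolded scaleR_one])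
      show "(\<lambda>x. norm (f x)) \<in> borel_measurable L" by (rule fnm)
    qed
  qed
  then show int: "integrable L f" using fm by (simp add: integrable_norm_iff)
  have lim_int: "(\<lambda>k. \<integral>x\<in>J k. f x \<partial>L) \<longlonglongrightarrow> (\<integral>x. f x \<partial>L)"
    unfolding set_lebesgue_integral_def
  proof (rule integral_dominated_convergence[where w = "\<lambda>x. norm (f x)"])
    show "(\<lambda>x. indicator (J k) x *\<^sub>R f x) \<in> borel_measurable L" for k
      using fm I unfolding J_def by (intro borel_measurable_scaleR borel_measurable_indicator)
    show "AE x in L. (\<lambda>k. indicator (J k) x *\<^sub>R f x) \<longlonglongrightarrow> f x"
      by (intro AE_I2 tendsto_scaleR[OF Jlim tendsto_const, unfolded scaleR_one])
    show "AE x in L. norm (indicator (J k) x *\<^sub>R f x) \<le> norm (f x)" for k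
      by (intro AE_I2) (simp add: indicator_def)
  qed (use fm int_norm in auto)
  (* The decay of f measured from the centre c instead of 0: (c - s)^2 <= 2 (1 + c^2) (1 + s^2). *)
  define K' where "K' = 2 * (1 + c\<^sup>2) * K"
  have K'0: "K' \<ge> 0" using K0 by (simp add: K'_def add_nonneg_nonneg)
  have tail: "norm (f s) \<le> 2 * K' / real k * (real k / ((c - s)\<^sup>2 + (real k)\<^sup>2))" if k: "k \<ge> 1" and s: "s \<notin> J k" for k s
  proof -
    have "real k \<le> \<bar>c - s\<bar>" using s by (auto simp: J_def)
    then have k2: "(real k)\<^sup>2 \<le> (c - s)\<^sup>2" by (metis abs_le_square_iff abs_of_nat)
    have "0 \<le> (c + s)\<^sup>2 + 2 * c\<^sup>2 * s\<^sup>2 + 1" by simp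
    then have "(c - s)\<^sup>2 \<le> 2 * (1 + c\<^sup>2) * (1 + s\<^sup>2)" by (simp add: power2_eq_square algebra_simps)
    then have "(c - s)\<^sup>2 * norm (f s) \<le> 2 * (1 + c\<^sup>2) * (1 + s\<^sup>2) * norm (f s)" by (intro mult_right_mono) auto
    also have "\<dots> = 2 * (1 + c\<^sup>2) * ((1 + s\<^sup>2) * norm (f s))" by simp
    also have "\<dots> \<le> K'" unfolding K'_def by (intro mult_left_mono decay) simp
    finally have 1: "(c - s)\<^sup>2 * norm (f s) \<le> K'" .
    have "((c - s)\<^sup>2 + (real k)\<^sup>2) * norm (f s) \<le> (2 * (c - s)\<^sup>2) * norm (f s)" using k2 by (intro mult_right_mono) auto
    also have "\<dots> \<le> 2 * K'" using 1 by simp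
    finally have "norm (f s) * ((c - s)\<^sup>2 + (real k)\<^sup>2) \<le> 2 * K'" by (simp only: mult.commute)
    moreover have "(c - s)\<^sup>2 + (real k)\<^sup>2 > 0" using k by (simp add: add_nonneg_pos)
    ultimately have "norm (f s) \<le> 2 * K' / ((c - s)\<^sup>2 + (real k)\<^sup>2)" by (simp add: pos_le_divide_eq)
    then show ?thesis using k by simp
  qed
  show "(\<lambda>n. (\<Sum>s\<in>S n. f s) /\<^sub>R w n) \<longlonglongrightarrow> (\<integral>x. f x \<partial>L)"
  proof (rule tendstoI)
    fix e :: real assume e: "e > 0"
    have "(\<lambda>k. 2 * K' * (B + 1) * inverse (real k)) \<longlonglongrightarrow> 2 * K' * (B + 1) * 0"
      by (intro tendsto_intros lim_inverse_n)
    then have "eventually (\<lambda>k. 2 * K' * (B + 1) * inverse (real k) < e / 3) sequentially"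
      using e by (intro order_tendstoD(2)) auto
    moreover have "eventually (\<lambda>k. dist (\<integral>x\<in>J k. f x \<partial>L) (\<integral>x. f x \<partial>L) < e / 3) sequentially"
      using e by (intro tendstoD[OF lim_int]) auto
    ultimately have "eventually (\<lambda>k. k \<ge> 1 \<and> 2 * K' * (B + 1) * inverse (real k) < e / 3 \<and>
        dist (\<integral>x\<in>J k. f x \<partial>L) (\<integral>x. f x \<partial>L) < e / 3) sequentially"
      using eventually_ge_at_top[of 1] by eventually_elim auto
    from eventually_happens[OF this] obtain k where k: "k \<ge> 1" "2 * K' * (B + 1) * inverse (real k) < e / 3"
      "dist (\<integral>x\<in>J k. f x \<partial>L) (\<integral>x. f x \<partial>L) < e / 3" by auto
    have k0: "real k > 0" using k(1) by simp
    have "eventually (\<lambda>n. dist ((\<Sum>s\<in>S n \<inter> J k. f s) /\<^sub>R w n) (\<integral>x\<in>J k. f x \<partial>L) < e / 3) sequentially"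
      unfolding J_def using e by (intro tendstoD[OF conv[OF f]]) auto
    moreover have "eventually (\<lambda>n. poisson_sum (S n) c (real k) / w n < B + 1) sequentially"
      using bound[OF k0] by (intro order_tendstoD(2)[OF P[OF k0]]) simp
    ultimately show "eventually (\<lambda>n. dist ((\<Sum>s\<in>S n. f s) /\<^sub>R w n) (\<integral>x. f x \<partial>L) < e) sequentially"
    proof eventually_elim
      case (elim n)
      have "norm (\<Sum>s\<in>S n - J k. f s) \<le> (\<Sum>s\<in>S n - J k. 2 * K' / real k * (real k / ((c - s)\<^sup>2 + (real k)\<^sup>2)))"
        by (intro order_trans[OF norm_sum] sum_mono tail[OF k(1)]) auto
      also have "\<dots> \<le> (\<Sum>s\<in>S n. 2 * K' / real k * (real k / ((c - s)\<^sup>2 + (real k)\<^sup>2)))"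
        using S K'0 by (intro sum_mono2) auto
      also have "\<dots> = 2 * K' / real k * poisson_sum (S n) c (real k)"
        by (simp only: poisson_sum_def sum_distrib_left)
      finally have "norm (\<Sum>s\<in>S n - J k. f s) / w n \<le> 2 * K' / real k * poisson_sum (S n) c (real k) / w n"
        using w[of n] by (intro divide_right_mono) auto
      also have "\<dots> = 2 * K' / real k * (poisson_sum (S n) c (real k) / w n)" by simp
      also have "\<dots> \<le> 2 * K' / real k * (B + 1)" using elim(2) K'0 by (intro mult_left_mono) auto
      also have "2 * K' / real k * (B + 1) = 2 * K' * (B + 1) * inverse (real k)" using k0 by (simp add: field_simps)
      also have "\<dots> < e / 3" by (rule k(2))
      finally have "norm (\<Sum>s\<in>S n - J k. f s) / w n < e / 3" .
      moreover have "norm ((\<Sum>s\<in>S n - J k. f s) /\<^sub>R w n) = norm (\<Sum>s\<in>S n - J k. f s) / w n"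
        using w[of n] by (simp add: field_simps)
      ultimately have t: "norm ((\<Sum>s\<in>S n - J k. f s) /\<^sub>R w n) < e / 3" by (simp only:)
      have split: "(\<Sum>s\<in>S n. f s) /\<^sub>R w n = (\<Sum>s\<in>S n \<inter> J k. f s) /\<^sub>R w n + (\<Sum>s\<in>S n - J k. f s) /\<^sub>R w n"
        unfolding scaleR_add_right[symmetric] using sum.Int_Diff[OF S, of f n "J k"] by simp
      have "dist ((\<Sum>s\<in>S n. f s) /\<^sub>R w n) ((\<Sum>s\<in>S n \<inter> J k. f s) /\<^sub>R w n) < e / 3"
        unfolding split dist_norm using t by simp
      then show ?case using elim(1) k(3) by metric
    qed
  qed
qed

section \<open>The limit measure\<close>

text \<open>The function \<open>sqrt (\<kappa> (u\<^sup>2 - D))\<close> to the right of \<open>sqrt D\<close>, extended by zero. The nested maxima make its continuity evident.\<close>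

definition right_branch :: "real \<Rightarrow> real \<Rightarrow> real \<Rightarrow> real" where
  "right_branch \<kappa> D u = sqrt (\<kappa> * max 0 ((max 0 u)\<^sup>2 - D))"

lemma right_branch_zero: "D \<ge> 0 \<Longrightarrow> u \<le> sqrt D \<Longrightarrow> right_branch \<kappa> D u = 0"
proof -
  assume D: "D \<ge> 0" "u \<le> sqrt D"
  have "(max 0 u)\<^sup>2 \<le> (sqrt D)\<^sup>2" using D by (intro power_mono) auto
  then show ?thesis using D by (simp add: right_branch_def max_def)
qed

lemma right_branch_pos: "D \<ge> 0 \<Longrightarrow> u \<ge> sqrt D \<Longrightarrow> right_branch \<kappa> D u = sqrt (\<kappa> * (u\<^sup>2 - D))"
proof -
  assume D: "D \<ge> 0" "u \<ge> sqrt D"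
  have "(sqrt D)\<^sup>2 \<le> u\<^sup>2" using D by (intro power_mono) auto
  moreover have "u \<ge> 0" using D by (meson order_trans real_sqrt_ge_zero)
  ultimately show ?thesis using D by (simp add: right_branch_def)
qed

lemma isCont_right_branch: "isCont (right_branch \<kappa> D) u"
  unfolding right_branch_def[abs_def] by (intro continuous_intros)

lemma right_branch_deriv:
  assumes \<kappa>: "\<kappa> > 0" and D: "D \<ge> 0" and u: "u \<noteq> sqrt D"
  shows "(right_branch \<kappa> D has_real_derivative (if u > sqrt D then \<kappa> * u / sqrt (\<kappa> * (u\<^sup>2 - D)) else 0)) (at u)"
proof (cases "u > sqrt D")
  case True
  have "0 \<le> sqrt D" using D by simp
  then have "(sqrt D)\<^sup>2 < u\<^sup>2" using True by (intro power_strict_mono) auto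
  then have pos: "\<kappa> * (u\<^sup>2 - D) > 0" using \<kappa> D by simp
  have "((\<lambda>u. sqrt (\<kappa> * (u\<^sup>2 - D))) has_real_derivative (\<kappa> * u / sqrt (\<kappa> * (u\<^sup>2 - D)))) (at u)"
    using pos by (auto intro!: derivative_eq_intros simp: field_simps)
  then have "(right_branch \<kappa> D has_real_derivative (\<kappa> * u / sqrt (\<kappa> * (u\<^sup>2 - D)))) (at u)"
    by (rule has_field_derivative_transform_within_open[where S = "{sqrt D<..}"])
       (use True D in \<open>auto simp: right_branch_pos\<close>)
  then show ?thesis using True by simp
next
  case False
  then have lt: "u < sqrt D" using u by simp
  have "((\<lambda>_. 0) has_real_derivative 0) (at u)" by simp
  then have "(right_branch \<kappa> D has_real_derivative 0) (at u)"
    by (rule has_field_derivative_transform_within_open[where S = "{..<sqrt D}"])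
       (use lt D in \<open>auto simp: right_branch_zero\<close>)
  then show ?thesis using False by simp
qed

context monodromy_limit
begin

text \<open>The normal form \<open>h(x) = h_scale (h_level - (x - h_center)\<^sup>2)\<close>.\<close>

definition h_scale :: real where "h_scale = 4 * (X * Y - \<sigma>\<^sup>2)"
definition h_center :: real where "h_center = coeff hpoly 1 / (2 * h_scale)"
definition h_level :: real where "h_level = coeff hpoly 0 / h_scale + h_center\<^sup>2"

lemma h_scale_pos: "h_scale > 0" using det_pos by (simp add: h_scale_def)

lemma hpoly_square: "hpoly = [: h_scale * (h_level - h_center\<^sup>2), 2 * h_scale * h_center, - h_scale :]"
  using h_scale_pos by (simp add: h_level_def h_center_def hpoly_def h_scale_def)

lemma poly_hpoly: "poly hpoly x = h_scale * (h_level - (x - h_center)\<^sup>2)"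
  unfolding hpoly_square by (simp add: power2_eq_square algebra_simps)

lemma poly_pderiv_hpoly: "poly (pderiv hpoly) x = - 2 * h_scale * (x - h_center)"
  unfolding hpoly_square by (simp add: pderiv_pCons algebra_simps)

lemma map_hpoly: "map_poly complex_of_real hpoly = [: of_real (h_scale * (h_level - h_center\<^sup>2)), of_real (2 * h_scale * h_center), of_real (- h_scale) :]"
  unfolding hpoly_square by (simp add: Polynomial.map_poly_pCons)

lemma h_square: "h_at z = of_real h_scale * (of_real h_level - (z - of_real h_center)\<^sup>2)"
  unfolding map_hpoly by (simp add: power2_eq_square algebra_simps)

lemma h_deriv_square: "poly (pderiv (map_poly complex_of_real hpoly)) z = - 2 * of_real h_scale * (z - of_real h_center)"
  unfolding map_hpoly by (simp add: pderiv_pCons algebra_simps)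

lemma degree_hpoly: "degree hpoly = 2" "lead_coeff hpoly < 0"
  unfolding hpoly_square using h_scale_pos by simp_all

text \<open>If \<open>h\<close> were negative on the whole line, it would have a zero in the upper half-plane, where \<open>h_not_nonpos\<close> forbids it.\<close>

lemma h_level_nonneg: "h_level \<ge> 0"
proof (rule ccontr)
  assume "\<not> h_level \<ge> 0"
  then have d: "sqrt (- h_level) > 0" "(sqrt (- h_level))\<^sup>2 = - h_level" by simp_all
  let ?z = "Complex h_center (sqrt (- h_level))"
  have "?z - of_real h_center = \<i> * of_real (sqrt (- h_level))" by (simp add: complex_eq_iff)
  then have "(?z - of_real h_center)\<^sup>2 = - of_real ((sqrt (- h_level))\<^sup>2)" by (simp add: power_mult_distrib del: real_sqrt_pow2_iff)
  then have "h_at ?z = 0" unfolding h_square d(2) by simp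
  then show False using h_not_nonpos[of ?z] d(1) by simp
qed

definition norm_const :: real where "norm_const = 1 / (2 * N * \<alpha> (N - 1))"
text \<open>Up to the factor \<open>1 / \<pi>\<close> a distribution function of the limit measure: on \<open>h < 0\<close> it is \<open>sqrt (-h)\<close> with the sign of \<open>x - h_center\<close>,
multiplied by \<open>norm_const\<close>.\<close>

definition limit_cdf :: "real \<Rightarrow> real" where
  "limit_cdf x = norm_const * (right_branch h_scale h_level (x - h_center) - right_branch h_scale h_level (h_center - x))"

lemma norm_const_pos: "norm_const > 0" using N \<alpha>[of "N - 1"] by (simp add: norm_const_def)

lemma isCont_limit_cdf: "isCont limit_cdf x"
proof -
  have 1: "isCont (\<lambda>x. right_branch h_scale h_level (x - h_center)) x"
    by (rule isCont_o2[OF _ isCont_right_branch]) (intro continuous_intros)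
  have 2: "isCont (\<lambda>x. right_branch h_scale h_level (h_center - x)) x"
    by (rule isCont_o2[OF _ isCont_right_branch]) (intro continuous_intros)
  show ?thesis unfolding limit_cdf_def[abs_def] by (intro continuous_intros 1 2)
qed

text \<open>The two excluded points are the zeros of \<open>h\<close>, where the density may be infinite.\<close>

lemma limit_cdf_deriv:
  assumes x: "x \<notin> {h_center - sqrt h_level, h_center + sqrt h_level}"
  shows "((\<lambda>x. limit_cdf x / pi) has_real_derivative limit_density N \<alpha> hpoly x) (at x)"
proof -
  let ?d = "\<lambda>u. if u > sqrt h_level then h_scale * u / sqrt (h_scale * (u\<^sup>2 - h_level)) else 0"
  have n1: "x - h_center \<noteq> sqrt h_level" "h_center - x \<noteq> sqrt h_level" using x by auto
  have 1: "((\<lambda>x. right_branch h_scale h_level (x - h_center)) has_real_derivative ?d (x - h_center) * 1) (at x)"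
    by (rule DERIV_chain2[where f = "right_branch h_scale h_level" and g = "\<lambda>x. x - h_center", OF right_branch_deriv[OF h_scale_pos h_level_nonneg n1(1)]])
       (auto intro!: derivative_eq_intros)
  have 2: "((\<lambda>x. right_branch h_scale h_level (h_center - x)) has_real_derivative ?d (h_center - x) * (-1)) (at x)"
    by (rule DERIV_chain2[where f = "right_branch h_scale h_level" and g = "\<lambda>x. h_center - x", OF right_branch_deriv[OF h_scale_pos h_level_nonneg n1(2)]])
       (auto intro!: derivative_eq_intros)
  have "((\<lambda>x. limit_cdf x / pi) has_real_derivative norm_const * (?d (x - h_center) * 1 - ?d (h_center - x) * (-1)) / pi) (at x)"
    unfolding limit_cdf_def by (intro DERIV_cdivide DERIV_cmult DERIV_diff 1 2)
  moreover have "norm_const * (?d (x - h_center) * 1 - ?d (h_center - x) * (-1)) / pi = limit_density N \<alpha> hpoly x"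
  proof -
    have s0: "0 \<le> sqrt h_level" using h_level_nonneg by simp
    have sq: "h_level < (x - h_center)\<^sup>2 \<longleftrightarrow> sqrt h_level < \<bar>x - h_center\<bar>"
      by (metis real_sqrt_abs real_sqrt_less_iff)
    have lt: "poly hpoly x < 0 \<longleftrightarrow> sqrt h_level < \<bar>x - h_center\<bar>"
      unfolding poly_hpoly sq[symmetric] using h_scale_pos by (simp add: mult_less_0_iff)
    have e: "- poly hpoly x = h_scale * ((x - h_center)\<^sup>2 - h_level)" unfolding poly_hpoly by (simp add: algebra_simps)
    have comm: "(h_center - x)\<^sup>2 = (x - h_center)\<^sup>2" by (rule power2_commute)
    have m: "?d (x - h_center) + ?d (h_center - x) = (if sqrt h_level < \<bar>x - h_center\<bar> then h_scale * \<bar>x - h_center\<bar> / sqrt (h_scale * ((x - h_center)\<^sup>2 - h_level)) else 0)"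
    proof -
      consider "sqrt h_level < x - h_center" | "sqrt h_level < h_center - x" | "\<bar>x - h_center\<bar> \<le> sqrt h_level" by linarith
      then show ?thesis
      proof cases
        case 1
        then have "\<not> sqrt h_level < h_center - x" "\<bar>x - h_center\<bar> = x - h_center" using s0 by linarith+
        then show ?thesis using 1 by simp
      next
        case 2
        then have "\<not> sqrt h_level < x - h_center" "\<bar>x - h_center\<bar> = h_center - x" using s0 by linarith+
        then show ?thesis using 2 by (simp add: comm)
      next
        case 3
        then have "\<not> sqrt h_level < x - h_center" "\<not> sqrt h_level < h_center - x" "\<not> sqrt h_level < \<bar>x - h_center\<bar>" by linarith+
        then show ?thesis by simp
      qed
    qed
    have "norm_const * (?d (x - h_center) * 1 - ?d (h_center - x) * (-1)) / pi = norm_const * (?d (x - h_center) + ?d (h_center - x)) / pi" by simp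
    also have "\<dots> = limit_density N \<alpha> hpoly x"
      unfolding m limit_density_def e poly_pderiv_hpoly norm_const_def using h_scale_pos lt
      by (simp add: abs_mult indicator_def)
    finally show ?thesis .
  qed
  ultimately show ?thesis by simp
qed

text \<open>The fundamental theorem of calculus with two exceptional points.\<close>

lemma emeasure_limit_measure:
  assumes "u \<le> v"
  shows "emeasure (limit_measure N \<alpha> hpoly) {u<..v} = ennreal ((limit_cdf v - limit_cdf u) / pi)"
proof -
  let ?d = "limit_density N \<alpha> hpoly"
  have d0: "?d x \<ge> 0" for x unfolding limit_density_def using \<alpha>[of "N - 1"]
    by (auto simp: indicator_def intro!: divide_nonneg_nonneg mult_nonneg_nonneg)
  have dm: "?d \<in> borel_measurable borel"
    unfolding limit_density_def[abs_def] poly_hpoly[abs_def] poly_pderiv_hpoly[abs_def] by measurable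
  have "(?d has_integral (limit_cdf v / pi - limit_cdf u / pi)) {u..v}"
  proof (rule fundamental_theorem_of_calculus_interior_strong[of "{h_center - sqrt h_level, h_center + sqrt h_level}"])
    show "((\<lambda>x. limit_cdf x / pi) has_vector_derivative ?d x) (at x)"
      if "x \<in> {u<..<v} - {h_center - sqrt h_level, h_center + sqrt h_level}" for x
      using limit_cdf_deriv[of x] that by (simp add: has_real_derivative_iff_has_vector_derivative)
    show "continuous_on {u..v} (\<lambda>x. limit_cdf x / pi)"
      by (intro continuous_at_imp_continuous_on ballI continuous_intros isCont_limit_cdf) simp
  qed (use assms in auto)
  then have "((\<lambda>x. if x \<in> {u..v} then ?d x else 0) has_integral (limit_cdf v - limit_cdf u) / pi) UNIV"
    unfolding has_integral_restrict_UNIV by (simp add: diff_divide_distrib)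
  then have "((\<lambda>x. indicator {u<..v} x * ?d x) has_integral (limit_cdf v - limit_cdf u) / pi) UNIV"
    by (rule has_integral_spike_finite[where S = "{u}", rotated 2]) (auto simp: indicator_def)
  from nn_integral_has_integral_lborel[OF _ _ this] d0 dm
  have "(\<integral>\<^sup>+ x. ennreal (indicator {u<..v} x * ?d x) \<partial>lborel) = ennreal ((limit_cdf v - limit_cdf u) / pi)" by simp
  moreover have "emeasure (limit_measure N \<alpha> hpoly) {u<..v} = (\<integral>\<^sup>+ x. ennreal (indicator {u<..v} x * ?d x) \<partial>lborel)"
    unfolding limit_measure_def using dm
    by (subst emeasure_density) (auto intro!: nn_integral_cong simp: indicator_def)
  ultimately show ?thesis by simp
qed

lemma limit_cdf_mono: "u \<le> v \<Longrightarrow> limit_cdf u \<le> limit_cdf v"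
proof -
  assume uv: "u \<le> v"
  have m: "right_branch h_scale h_level s \<le> right_branch h_scale h_level t" if "s \<le> t" for s t
  proof -
    have "(max 0 s)\<^sup>2 \<le> (max 0 t)\<^sup>2" using that by (intro power_mono) auto
    then have "max 0 ((max 0 s)\<^sup>2 - h_level) \<le> max 0 ((max 0 t)\<^sup>2 - h_level)"
      by (intro max.mono order_refl diff_right_mono)
    then show ?thesis unfolding right_branch_def using h_scale_pos by simp
  qed
  show ?thesis unfolding limit_cdf_def using norm_const_pos uv by (intro mult_left_mono diff_mono m) auto
qed

text \<open>Above the point \<open>x\<close> the imaginary part of \<open>h\<close> has the sign of \<open>h_center - x\<close>, which selects the sign of \<open>Im (sqrt_h z)\<close>;
its modulus \<open>sqrt ((|h| - Re h) / 2)\<close> is continuous up to the real line.\<close>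

lemma boundary_values:
  "((\<lambda>y. - Im (sqrt_h (Complex x y)) * norm_const) \<longlongrightarrow> limit_cdf x) (at_right 0)"
proof -
  define u where "u = x - h_center"
  define W where "W y = of_real h_scale * (of_real h_level - (Complex u y)\<^sup>2)" for y
  have hW: "h_at (Complex x y) = W y" for y
  proof -
    have "Complex x y - of_real h_center = Complex u y" by (simp add: complex_eq_iff u_def)
    then show ?thesis unfolding h_square W_def by simp
  qed
  have ReW: "Re (W y) = h_scale * (h_level - u\<^sup>2 + y\<^sup>2)" and ImW: "Im (W y) = - 2 * h_scale * u * y" for y
    by (simp_all add: W_def power2_eq_square algebra_simps)
  have form: "- Im (sqrt_h (Complex x y)) = sgn u * sqrt ((cmod (W y) - Re (W y)) / 2)" if y: "y > 0" for y
  proof (cases "u = 0")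
    case True
    then have "Im (W y) = 0" "Re (W y) \<ge> 0" using h_scale_pos h_level_nonneg by (auto simp: ReW ImW)
    then have "cmod (W y) = Re (W y)" by (simp add: cmod_def)
    then show ?thesis unfolding sqrt_h_def hW using True by simp
  next
    case False
    then have "Im (W y) \<noteq> 0" using y h_scale_pos by (simp add: ImW)
    moreover have "sgn (Im (W y)) = - sgn u" using y h_scale_pos by (simp add: ImW sgn_mult)
    ultimately show ?thesis unfolding sqrt_h_def hW by simp
  qed
  have cW: "isCont W 0"
  proof -
    have "W = (\<lambda>y. of_real h_scale * (of_real h_level - (of_real u + \<i> * of_real y)\<^sup>2))" by (simp add: W_def Complex_eq fun_eq_iff)
    then show ?thesis by (simp only:) (intro continuous_intros)
  qed
  then have "(W \<longlongrightarrow> W 0) (at 0)" by (simp add: isCont_def)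
  then have "(W \<longlongrightarrow> W 0) (at_right 0)" by (rule tendsto_mono[OF at_le, rotated]) simp
  then have "((\<lambda>y. sgn u * sqrt ((cmod (W y) - Re (W y)) / 2) * norm_const) \<longlongrightarrow> sgn u * sqrt ((cmod (W 0) - Re (W 0)) / 2) * norm_const) (at_right 0)"
    by (intro tendsto_intros) simp_all
  also have "sgn u * sqrt ((cmod (W 0) - Re (W 0)) / 2) * norm_const = limit_cdf x"
  proof -
    have "Im (W 0) = 0" by (simp add: ImW)
    then have c0: "cmod (W 0) = \<bar>Re (W 0)\<bar>" by (simp add: cmod_def)
    have "(cmod (W 0) - Re (W 0)) / 2 = h_scale * max 0 (u\<^sup>2 - h_level)"
    proof (cases "u\<^sup>2 \<le> h_level")
      case True
      then show ?thesis unfolding c0 ReW using h_scale_pos by simp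
    next
      case False
      then have "h_scale * (h_level - u\<^sup>2 + 0\<^sup>2) < 0" using h_scale_pos by (simp add: mult_less_0_iff)
      then have "\<bar>h_scale * (h_level - u\<^sup>2 + 0\<^sup>2)\<bar> = h_scale * (u\<^sup>2 - h_level)" by (simp add: abs_if right_diff_distrib)
      moreover have "h_scale * (h_level - u\<^sup>2 + 0\<^sup>2) = - (h_scale * (u\<^sup>2 - h_level))" by (simp add: right_diff_distrib)
      ultimately show ?thesis unfolding c0 ReW using False by simp
    qed
    then have "sgn u * sqrt ((cmod (W 0) - Re (W 0)) / 2) = right_branch h_scale h_level u - right_branch h_scale h_level (- u)"
      using h_level_nonneg by (cases "u > 0"; cases "u = 0") (auto simp: right_branch_def)
    then show ?thesis unfolding limit_cdf_def u_def by (simp add: mult.commute)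
  qed
  finally have "((\<lambda>y. sgn u * sqrt ((cmod (W y) - Re (W y)) / 2) * norm_const) \<longlongrightarrow> limit_cdf x) (at_right 0)" .
  then show ?thesis
    by (rule Lim_transform_eventually) (use eventually_at_right_less[of 0] in \<open>eventually_elim; simp only: form\<close>)
qed

lemma sqrt_h_Im_deriv:
  assumes y: "y > 0"
  shows "((\<lambda>x. - Im (sqrt_h (Complex x y)) * norm_const) has_real_derivative - Im (sqrt_h_deriv (Complex x y)) * norm_const) (at x)"
proof -
  have "((\<lambda>x. complex_of_real x + \<i> * of_real y) has_vector_derivative (1 + 0)) (at x)"
    by (intro has_vector_derivative_add has_vector_derivative_const) (auto intro!: derivative_eq_intros)
  then have "((\<lambda>x. Complex x y) has_vector_derivative 1) (at x)" by (simp add: Complex_eq)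
  from field_vector_diff_chain_at[OF this sqrt_h_has_derivative] y
  have "((sqrt_h \<circ> (\<lambda>x. Complex x y)) has_vector_derivative sqrt_h_deriv (Complex x y)) (at x)" by simp
  from bounded_linear.has_vector_derivative[OF bounded_linear_Im this]
  have "((\<lambda>x. Im (sqrt_h (Complex x y))) has_real_derivative Im (sqrt_h_deriv (Complex x y))) (at x)"
    by (simp add: has_real_derivative_iff_has_vector_derivative o_def)
  then show ?thesis by (intro DERIV_cmult_right DERIV_minus)
qed

text \<open>On the vertical line through \<open>h_center\<close> the values of \<open>h\<close> are positive, so the square root is explicit.\<close>

lemma sqrt_h_deriv_vertical_bound:
  assumes y: "y > 0"
  shows "- Im (sqrt_h_deriv (Complex h_center y)) * norm_const \<le> sqrt h_scale * norm_const"
proof -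
  define q where "q = h_scale * (h_level + y\<^sup>2)"
  have q: "q > 0" using h_scale_pos h_level_nonneg y by (simp add: q_def add_nonneg_pos)
  have z: "Complex h_center y - of_real h_center = \<i> * of_real y" by (simp add: complex_eq_iff)
  have "h_at (Complex h_center y) = of_real q" unfolding h_square z q_def by (simp add: power_mult_distrib)
  then have r: "sqrt_h (Complex h_center y) = of_real (sqrt q)" unfolding sqrt_h_def using q by simp
  have "sqrt_h_deriv (Complex h_center y) = - (\<i> * of_real (h_scale * y / sqrt q))"
    unfolding sqrt_h_deriv_def h_deriv_square r z by simp
  then have "- Im (sqrt_h_deriv (Complex h_center y)) = h_scale * y / sqrt q" by simp
  also have "\<dots> \<le> sqrt h_scale"
  proof -
    have "sqrt h_scale * y = sqrt (h_scale * y\<^sup>2)" using y by (simp add: real_sqrt_mult)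
    also have "\<dots> \<le> sqrt q" unfolding q_def using h_scale_pos h_level_nonneg by simp
    finally have "sqrt h_scale * (sqrt h_scale * y) \<le> sqrt h_scale * sqrt q" using h_scale_pos by (intro mult_left_mono) auto
    moreover have "sqrt h_scale * (sqrt h_scale * y) = h_scale * y" using h_scale_pos by (simp add: mult.assoc[symmetric])
    ultimately show ?thesis using q by (simp add: pos_divide_le_eq)
  qed
  finally show ?thesis using norm_const_pos by (intro mult_right_mono) auto
qed

lemma zero_distribution:
  fixes f :: "real \<Rightarrow> complex"
  assumes f: "continuous_on UNIV f" and bdd: "bdd_above (range (\<lambda>x. (1 + x\<^sup>2) * norm (f x)))"
  shows "integrable (limit_measure N \<alpha> hpoly) f"
    "(\<lambda>n. 1 / complex_of_real (rho \<alpha> a n) * (\<integral>x. f x \<partial>eigenvalue_measure a b n))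
      \<longlonglongrightarrow> (\<integral>x. f x \<partial>limit_measure N \<alpha> hpoly)"
proof -
  let ?S = "\<lambda>n. jacobi_zeros a b (Suc n)" and ?L = "limit_measure N \<alpha> hpoly"
  have S: "finite (?S n)" for n by (rule finite_jpoly_roots[where a = a, OF a])
  have w: "rho \<alpha> a n > 0" for n
    unfolding rho_def using a \<alpha> by (intro sum_pos) auto
  have P: "(\<lambda>n. poisson_sum (?S n) x y / rho \<alpha> a n) \<longlonglongrightarrow> - Im (sqrt_h_deriv (Complex x y)) * norm_const" if "y > 0" for x y
    using poisson_sum_tendsto[OF that, of x] by (simp add: norm_const_def)
  have L: "sets ?L = sets borel" by (simp add: limit_measure_def)
  have Lfin: "emeasure ?L {u<..v} < \<infinity>" for u v
    by (cases "u \<le> v") (simp_all add: emeasure_limit_measure)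
  have count: "(\<lambda>n. real (card (?S n \<inter> {u<..v})) / rho \<alpha> a n) \<longlonglongrightarrow> measure ?L {u<..v}" if uv: "u \<le> v" for u v
  proof -
    have "measure ?L {u<..v} = (limit_cdf v - limit_cdf u) / pi"
      unfolding measure_def emeasure_limit_measure[OF uv] using limit_cdf_mono[OF uv] by simp
    then show ?thesis
      using stieltjes_inversion_counting[where S = ?S and w = "rho \<alpha> a" and \<Phi> = limit_cdf, OF S w P sqrt_h_Im_deriv boundary_values isCont_limit_cdf uv]
      by simp
  qed
  obtain K where K: "\<And>x. (1 + x\<^sup>2) * norm (f x) \<le> K" using bdd unfolding bdd_above_def by auto
  note res = weak_convergence_of_poisson_sums[where S = ?S and w = "rho \<alpha> a" and c = h_center, OF S w P sqrt_h_deriv_vertical_bound L Lfin count f K]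
  show "integrable ?L f" by (rule res(1))
  have "f \<in> borel_measurable borel" by (rule borel_measurable_continuous_onI[OF f])
  then have "1 / complex_of_real (rho \<alpha> a n) * (\<integral>x. f x \<partial>eigenvalue_measure a b n) = (\<Sum>s\<in>?S n. f s) /\<^sub>R rho \<alpha> a n" for n
    by (simp add: integral_eigenvalue_measure[where a = a, OF a] scaleR_conv_of_real divide_inverse)
  then show "(\<lambda>n. 1 / complex_of_real (rho \<alpha> a n) * (\<integral>x. f x \<partial>eigenvalue_measure a b n)) \<longlonglongrightarrow> (\<integral>x. f x \<partial>?L)"
    using res(2) by simp
qed

end

section \<open>Existence of the limit and the zero distribution\<close>

theorem theorem3:
  fixes N :: nat and a b \<alpha> \<beta> :: "nat \<Rightarrow> real" and \<epsilon> :: real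
  assumes "N \<ge> 1"
    and "\<And>n. a n > 0"
    and "\<And>n. \<alpha> n > 0"
    and "periodic N \<alpha>" and "periodic N \<beta>"
    and "periodically_modulated \<alpha> \<beta> a b"
    and "\<epsilon> \<in> {-1, 1}"
    and "transfer_product \<alpha> \<beta> N N 0 = \<epsilon> *\<^sub>R mat 1"
    and "(\<lambda>n. a n * (a (n - 1) / a n - \<alpha> (n - 1) / \<alpha> n)) \<in> D1 N"
    and "(\<lambda>n. a n * (b n / a n - \<beta> n / \<alpha> n)) \<in> D1 N"
    and "(\<lambda>n. 1 / a n) \<in> D1 N"
  shows "\<exists>h :: real poly.
    (\<forall>z :: complex.
       (\<lambda>j. (complex_of_real (a (j * N + N - 1)))\<^sup>2 * discr (transfer_product a b N (j * N) z))
         \<longlonglongrightarrow> poly (map_poly complex_of_real h) z) \<and>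
    degree h = 2 \<and> lead_coeff h < 0 \<and>
    (\<forall>f :: real \<Rightarrow> complex.
       continuous_on UNIV f \<longrightarrow> bounded (range f) \<longrightarrow>
       bdd_above (range (\<lambda>x. (1 + x\<^sup>2) * norm (f x))) \<longrightarrow>
       integrable (limit_measure N \<alpha> h) f \<and>
       (\<lambda>n. 1 / complex_of_real (rho \<alpha> a n) * (\<integral>x. f x \<partial>eigenvalue_measure a b n))
         \<longlonglongrightarrow> (\<integral>x. f x \<partial>limit_measure N \<alpha> h))"
proof -
  interpret critical_jacobi N a b \<alpha> \<beta> \<epsilon>
    by (intro critical_jacobi.intro assms(1-10))
  obtain X Y \<sigma> u11 u12 u21 u22 :: real where lim: "monodromy_limit_axioms N a b \<epsilon> X Y \<sigma> u11 u12 u21 u22"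
    by (rule monodromy_expansion, rule that, rule monodromy_limit_axioms.intro)
  interpret monodromy_limit N a b \<alpha> \<beta> \<epsilon> X Y \<sigma> u11 u12 u21 u22
    using lim by (intro monodromy_limit.intro critical_jacobi_axioms)
  show ?thesis
    using discr_tendsto degree_hpoly zero_distribution by (intro exI[of _ hpoly]) blast
qed

end
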